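(* For every integer $g\geq 0$, the fundamental group of the surface $S_g$ is given by $$\pi_1(S_g)\cong\Big\langle a_1,b_1,\ldots,a_g,b_g\ \Big|\ \prod_{i=1}^g a_ib_ia_i^{-1}b_i^{-1}=e\Big\rangle$$ (for $g=0$ this is the trivial group). Moreover, these groups are pairwise non-isomorphic for different choices of $g$.
   Context: The surfaces $S_g$ are defined as follows. $S_0:=\mathbb{S}^2$ is the 2-sphere. For $g\geq 1$, $S_g$ is the closed surface obtained from a closed disc, regarded as a polygon with $4g$ sides whose oriented sides, read in cyclic order along the boundary, are labelled $$a_1,b_1,\overline{a_1},\overline{b_1},\ldots,a_g,b_g,\overline{a_g},\overline{b_g},$$ by identifying, for each $i$, the side $a_i$ with the side $\overline{a_i}$ with reversed orientation, and the side $b_i$ with the side $\overline{b_i}$ with reversed orientation. *)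

theory Defs
  imports "HOL-Analysis.Analysis" "HOL-Algebra.Generated_Groups"
begin

section \<open>Quotient spaces\<close>

definition quotient_space :: "'a topology \<Rightarrow> ('a \<times> 'a) set \<Rightarrow> 'a set topology" where
  "quotient_space X r =
     topology (\<lambda>U. U \<subseteq> topspace X // r \<and> openin X {x \<in> topspace X. r `` {x} \<in> U})"

lemma openin_quotient_space:
  "openin (quotient_space X r) U \<longleftrightarrow>
     U \<subseteq> topspace X // r \<and> openin X {x \<in> topspace X. r `` {x} \<in> U}"
proof -
  have "istopology (\<lambda>U. U \<subseteq> topspace X // r \<and> openin X {x \<in> topspace X. r `` {x} \<in> U})"
    unfolding istopology_def
  proof (intro conjI allI impI)
    fix S T
    assume S: "S \<subseteq> topspace X // r \<and> openin X {x \<in> topspace X. r `` {x} \<in> S}"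
      and T: "T \<subseteq> topspace X // r \<and> openin X {x \<in> topspace X. r `` {x} \<in> T}"
    show "S \<inter> T \<subseteq> topspace X // r" using S by blast
    have "{x \<in> topspace X. r `` {x} \<in> S \<inter> T}
        = {x \<in> topspace X. r `` {x} \<in> S} \<inter> {x \<in> topspace X. r `` {x} \<in> T}" by blast
    then show "openin X {x \<in> topspace X. r `` {x} \<in> S \<inter> T}" using S T by auto
  next
    fix K
    assume K: "\<forall>U\<in>K. U \<subseteq> topspace X // r \<and> openin X {x \<in> topspace X. r `` {x} \<in> U}"
    show "\<Union>K \<subseteq> topspace X // r" using K by blast
    have "{x \<in> topspace X. r `` {x} \<in> \<Union>K}
        = (\<Union>U\<in>K. {x \<in> topspace X. r `` {x} \<in> U})" by blast
    then show "openin X {x \<in> topspace X. r `` {x} \<in> \<Union>K}" using K by auto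
  qed
  then show ?thesis by (simp add: quotient_space_def)
qed

lemma topspace_quotient_space [simp]: "topspace (quotient_space X r) = topspace X // r"
proof
  show "topspace (quotient_space X r) \<subseteq> topspace X // r"
    by (simp add: topspace_def openin_quotient_space Sup_le_iff)
  have "{x \<in> topspace X. r `` {x} \<in> topspace X // r} = topspace X"
    by (auto intro: quotientI)
  then have "openin (quotient_space X r) (topspace X // r)"
    by (simp add: openin_quotient_space)
  then show "topspace X // r \<subseteq> topspace (quotient_space X r)"
    by (rule openin_subset)
qed

lemma quotient_map_quotient_space: "quotient_map X (quotient_space X r) (\<lambda>x. r `` {x})"
  by (auto simp: quotient_map_def openin_quotient_space quotient_def)

section \<open>The surfaces\<close>

text \<open>The closed unit disc is regarded as an \<open>n\<close>-gon with sides the arcs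
  \<open>polygon_side n k ` {0..1}\<close> for \<open>k < n\<close>, each oriented counterclockwise.\<close>

definition polygon_side :: "nat \<Rightarrow> nat \<Rightarrow> real \<Rightarrow> complex" where
  "polygon_side n k t = cis (2 * pi * (real k + t) / real n)"

text \<open>Counting sides from \<open>0\<close>, the four sides
  \<open>4 * i\<close>, \<open>4 * i + 1\<close>, \<open>4 * i + 2\<close>, \<open>4 * i + 3\<close> carry the labels
  \<open>a\<close>, \<open>b\<close>, \<open>a bar\<close>, \<open>b bar\<close> with index \<open>i + 1\<close>.\<close>

definition side_pairing :: "nat \<Rightarrow> complex \<Rightarrow> complex \<Rightarrow> bool" where
  "side_pairing g z w \<longleftrightarrow> (\<exists>i<g. \<exists>t\<in>{0..1}.
     (z = polygon_side (4 * g) (4 * i) t \<and> w = polygon_side (4 * g) (4 * i + 2) (1 - t)) \<or>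
     (z = polygon_side (4 * g) (4 * i + 1) t \<and> w = polygon_side (4 * g) (4 * i + 3) (1 - t)))"

definition disc :: "(complex \<times> real) set" where
  "disc = cball 0 1 \<times> {0}"

definition side_gluing :: "nat \<Rightarrow> ((complex \<times> real) \<times> (complex \<times> real)) set" where
  "side_gluing g =
     {(p, q). p \<in> disc \<and> q \<in> disc \<and> equivclp (side_pairing g) (fst p) (fst q)}"

text \<open>The disc lies in \<open>\<complex> \<times> \<real>\<close> and the sphere is divided by equality (so that its
  points are singletons) only in order that all surfaces have points of the same type.\<close>

definition surface :: "nat \<Rightarrow> (complex \<times> real) set topology" where
  "surface g =
     (if g = 0 then quotient_space (top_of_set (sphere 0 1)) (Id_on (sphere 0 1))
      else quotient_space (top_of_set disc) (side_gluing g))"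

lemma equiv_side_gluing: "equiv disc (side_gluing g)"
  by (intro equivI refl_onI symI transI)
     (auto simp: side_gluing_def intro: equivclp_sym equivclp_trans)

lemma topspace_surface_nonempty: "topspace (surface g) \<noteq> {}"
proof -
  have "(0, 1) \<in> sphere (0 :: complex \<times> real) 1" by (simp add: norm_Pair)
  moreover have "(0, 0) \<in> disc" by (simp add: disc_def)
  ultimately have ne: "sphere (0 :: complex \<times> real) 1 \<noteq> {}" "disc \<noteq> {}" by blast+
  have "topspace (surface g) = (if g = 0 then sphere 0 1 // Id_on (sphere 0 1)
                                else disc // side_gluing g)"
    by (simp only: surface_def topspace_quotient_space topspace_euclidean_subtopology split: if_split) simp
  then show ?thesis using ne by (simp only: quotient_is_empty split: if_split) simp
qed

lemma surface_0_homeomorphic_sphere: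
  "top_of_set (sphere (0 :: complex \<times> real) 1) homeomorphic_space surface 0"
proof -
  let ?S = "sphere (0 :: complex \<times> real) 1"
  have "inj_on (\<lambda>x. Id_on ?S `` {x}) (topspace (top_of_set ?S))"
    by (auto simp: inj_on_def)
  then have "homeomorphic_map (top_of_set ?S) (surface 0) (\<lambda>x. Id_on ?S `` {x})"
    unfolding surface_def homeomorphic_map_def
    using quotient_map_quotient_space[of "top_of_set ?S" "Id_on ?S"] by simp
  then show ?thesis by (rule homeomorphic_map_imp_homeomorphic_space)
qed

section \<open>Groups of equivalence classes\<close>

lemma group_of_classes:
  assumes r: "equiv A r"
    and closed: "\<And>x y. x \<in> A \<Longrightarrow> y \<in> A \<Longrightarrow> f x y \<in> A"
    and cong: "\<And>x x' y y'. (x, x') \<in> r \<Longrightarrow> (y, y') \<in> r \<Longrightarrow> (f x y, f x' y') \<in> r"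
    and e: "e \<in> A"
    and assoc: "\<And>x y z. x \<in> A \<Longrightarrow> y \<in> A \<Longrightarrow> z \<in> A \<Longrightarrow> (f (f x y) z, f x (f y z)) \<in> r"
    and lunit: "\<And>x. x \<in> A \<Longrightarrow> (f e x, x) \<in> r"
    and linv: "\<And>x. x \<in> A \<Longrightarrow> \<exists>y\<in>A. (f y x, e) \<in> r"
  shows "group \<lparr>carrier = A // r, mult = (\<lambda>P Q. \<Union>p\<in>P. \<Union>q\<in>Q. r `` {f p q}), one = r `` {e}\<rparr>"
    (is "group ?G")
proof -
  have "congruent2 r r (\<lambda>p q. r `` {f p q})"
    by (auto simp: congruent2_def intro!: equiv_class_eq[OF r] cong)
  then have m: "(\<Union>p\<in>r `` {x}. \<Union>q\<in>r `` {y}. r `` {f p q}) = r `` {f x y}"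
    if "x \<in> A" "y \<in> A" for x y
    by (rule UN_equiv_class2[OF r r _ that])
  have m': "r `` {x} \<otimes>\<^bsub>?G\<^esub> r `` {y} = r `` {f x y}" if "x \<in> A" "y \<in> A" for x y
    using m[OF that] by simp
  show ?thesis
  proof (rule groupI)
    fix P Q assume "P \<in> carrier ?G" "Q \<in> carrier ?G"
    then obtain x y where xy: "x \<in> A" "P = r `` {x}" "y \<in> A" "Q = r `` {y}"
      by (auto elim!: quotientE)
    then show "P \<otimes>\<^bsub>?G\<^esub> Q \<in> carrier ?G"
      using m'[of x y] closed by (simp add: quotientI)
  next
    show "\<one>\<^bsub>?G\<^esub> \<in> carrier ?G" using e by (simp add: quotientI)
  next
    fix P Q S assume "P \<in> carrier ?G" "Q \<in> carrier ?G" "S \<in> carrier ?G"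
    then obtain x y z where "x \<in> A" "P = r `` {x}" "y \<in> A" "Q = r `` {y}" "z \<in> A" "S = r `` {z}"
      by (auto elim!: quotientE)
    then show "P \<otimes>\<^bsub>?G\<^esub> Q \<otimes>\<^bsub>?G\<^esub> S = P \<otimes>\<^bsub>?G\<^esub> (Q \<otimes>\<^bsub>?G\<^esub> S)"
      using equiv_class_eq[OF r assoc[of x y z]] by (simp only: m' closed)
  next
    fix P assume "P \<in> carrier ?G"
    then obtain x where x: "x \<in> A" "P = r `` {x}" by (auto elim!: quotientE)
    have one: "\<one>\<^bsub>?G\<^esub> = r `` {e}" by simp
    show "\<one>\<^bsub>?G\<^esub> \<otimes>\<^bsub>?G\<^esub> P = P"
      unfolding one x(2) m'[OF e x(1)] using lunit[OF x(1)] by (rule equiv_class_eq[OF r])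
    obtain y where y: "y \<in> A" "(f y x, e) \<in> r" using linv x(1) by blast
    have "r `` {y} \<otimes>\<^bsub>?G\<^esub> P = \<one>\<^bsub>?G\<^esub>"
      unfolding one x(2) m'[OF y(1) x(1)] using y(2) by (rule equiv_class_eq[OF r])
    moreover have "r `` {y} \<in> carrier ?G" using y(1) by (simp add: quotientI)
    ultimately show "\<exists>Q\<in>carrier ?G. Q \<otimes>\<^bsub>?G\<^esub> P = \<one>\<^bsub>?G\<^esub>" by blast
  qed
qed

section \<open>The fundamental group\<close>

text \<open>Loops are functions on all of \<open>\<real>\<close> of which only the values on \<open>{0..1}\<close> matter:
  loops that agree on \<open>{0..1}\<close> are homotopic.\<close>

definition loops :: "'a topology \<Rightarrow> 'a \<Rightarrow> (real \<Rightarrow> 'a) set" where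
  "loops X x = {p. pathin X p \<and> p 0 = x \<and> p 1 = x}"

definition loop_homotopy :: "'a topology \<Rightarrow> 'a \<Rightarrow> ((real \<Rightarrow> 'a) \<times> (real \<Rightarrow> 'a)) set" where
  "loop_homotopy X x =
     {(p, q). homotopic_with (\<lambda>r. r 0 = x \<and> r 1 = x) (top_of_set {0..1}) X p q}"

definition loop_join :: "(real \<Rightarrow> 'a) \<Rightarrow> (real \<Rightarrow> 'a) \<Rightarrow> real \<Rightarrow> 'a" where
  "loop_join p q = (\<lambda>t. if t \<le> 1/2 then p (2 * t) else q (2 * t - 1))"

definition fundamental_group :: "'a topology \<Rightarrow> 'a \<Rightarrow> (real \<Rightarrow> 'a) set monoid" where
  "fundamental_group X x =
     \<lparr>carrier = loops X x // loop_homotopy X x,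
      mult = (\<lambda>P Q. \<Union>p\<in>P. \<Union>q\<in>Q. loop_homotopy X x `` {loop_join p q}),
      one = loop_homotopy X x `` {\<lambda>_. x}\<rparr>"

lemma equiv_loop_homotopy: "equiv (loops X x) (loop_homotopy X x)"
proof (intro equivI refl_onI symI transI)
  show "loop_homotopy X x \<subseteq> loops X x \<times> loops X x"
    by (auto simp: loop_homotopy_def loops_def pathin_def
        dest: homotopic_with_imp_continuous_maps homotopic_with_imp_property)
qed (auto simp: loop_homotopy_def loops_def pathin_def homotopic_with_sym
      intro: homotopic_with_trans)

lemma loop_homotopyI:
  fixes h :: "real \<times> real \<Rightarrow> 'a"
  assumes "continuous_map (prod_topology (top_of_set {0..1}) (top_of_set {0..1})) X h"
    and "\<And>s. s \<in> {0..1} \<Longrightarrow> h (0, s) = p s" "\<And>s. s \<in> {0..1} \<Longrightarrow> h (1, s) = q s"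
    and "\<And>t. t \<in> {0..1} \<Longrightarrow> h (t, 0) = x" "\<And>t. t \<in> {0..1} \<Longrightarrow> h (t, 1) = x"
  shows "(p, q) \<in> loop_homotopy X x"
  unfolding loop_homotopy_def
proof (intro CollectI case_prodI, subst homotopic_with)
  show "\<exists>h. continuous_map (prod_topology (top_of_set {0..1::real}) (top_of_set {0..1})) X h \<and>
          (\<forall>s\<in>topspace (top_of_set {0..1}). h (0, s) = p s) \<and>
          (\<forall>s\<in>topspace (top_of_set {0..1}). h (1, s) = q s) \<and>
          (\<forall>t\<in>{0..1}. h (t, 0) = x \<and> h (t, 1) = x)"
    by (rule exI[of _ h]) (intro conjI assms(1) ballI; use assms(2-) in simp)
qed auto

lemma loop_homotopyE:
  fixes X :: "'a topology"
  assumes "(p, q) \<in> loop_homotopy X x"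
  obtains h :: "real \<times> real \<Rightarrow> 'a"
  where "continuous_map (prod_topology (top_of_set {0..1}) (top_of_set {0..1})) X h"
    and "\<And>s. h (0, s) = p s" "\<And>s. h (1, s) = q s"
    and "\<And>t. t \<in> {0..1} \<Longrightarrow> h (t, 0) = x" "\<And>t. t \<in> {0..1} \<Longrightarrow> h (t, 1) = x"
proof -
  obtain h :: "real \<times> real \<Rightarrow> 'a"
    where h: "continuous_map (prod_topology (top_of_set {0..1}) (top_of_set {0..1})) X h"
    "\<forall>s. h (0, s) = p s" "\<forall>s. h (1, s) = q s" "\<forall>t\<in>{0..1}. h (t, 0) = x \<and> h (t, 1) = x"
    using assms unfolding loop_homotopy_def homotopic_with_def by blast
  show thesis by (rule that[OF h(1)]) (use h(2-) in auto)
qed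

lemma loop_homotopy_join:
  assumes "(p, p') \<in> loop_homotopy X x" "(q, q') \<in> loop_homotopy X x"
  shows "(loop_join p q, loop_join p' q') \<in> loop_homotopy X x"
proof -
  let ?I = "top_of_set {0..1::real}"
  obtain h where h: "continuous_map (prod_topology ?I ?I) X h"
    "\<And>s. h (0, s) = p s" "\<And>s. h (1, s) = p' s"
    "\<And>t. t \<in> {0..1} \<Longrightarrow> h (t, 0) = x" "\<And>t. t \<in> {0..1} \<Longrightarrow> h (t, 1) = x"
    using loop_homotopyE[OF assms(1)] by metis
  obtain k where k: "continuous_map (prod_topology ?I ?I) X k"
    "\<And>s. k (0, s) = q s" "\<And>s. k (1, s) = q' s"
    "\<And>t. t \<in> {0..1} \<Longrightarrow> k (t, 0) = x" "\<And>t. t \<in> {0..1} \<Longrightarrow> k (t, 1) = x"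
    using loop_homotopyE[OF assms(2)] by metis
  let ?H = "\<lambda>z. if snd z \<le> 1/2 then (h \<circ> (\<lambda>z. (fst z, 2 * snd z))) z
                else (k \<circ> (\<lambda>z. (fst z, 2 * snd z - 1))) z"
  have P: "prod_topology ?I ?I = top_of_set ({0..1} \<times> {0..1})" by simp
  have "continuous_map (prod_topology ?I ?I) X ?H"
  proof (rule continuous_map_cases_le)
    show "continuous_map (prod_topology ?I ?I) euclideanreal snd"
      unfolding P by (auto intro!: continuous_intros)
    show "continuous_map (subtopology (prod_topology ?I ?I)
        {z \<in> topspace (prod_topology ?I ?I). snd z \<le> 1/2}) X (h \<circ> (\<lambda>z. (fst z, 2 * snd z)))"
      by (rule continuous_map_compose[OF _ h(1)])
         (auto simp: P subtopology_subtopology intro!: continuous_intros)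
    show "continuous_map (subtopology (prod_topology ?I ?I)
        {z \<in> topspace (prod_topology ?I ?I). 1/2 \<le> snd z}) X (k \<circ> (\<lambda>z. (fst z, 2 * snd z - 1)))"
      by (rule continuous_map_compose[OF _ k(1)])
         (auto simp: P subtopology_subtopology intro!: continuous_intros)
    fix z assume z: "z \<in> topspace (prod_topology ?I ?I)" and "snd z = 1/2"
    then have e: "2 * snd z = 1" by simp
    have "fst z \<in> {0..1}" using z by auto
    then show "(h \<circ> (\<lambda>z. (fst z, 2 * snd z))) z = (k \<circ> (\<lambda>z. (fst z, 2 * snd z - 1))) z"
      by (simp add: e h k)
  qed auto
  then show ?thesis
    by (rule loop_homotopyI) (auto simp: loop_join_def h k)
qed

lemma loop_homotopy_reparametrize:
  assumes p: "pathin X p"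
    and f: "continuous_on {0..1} f" "f ` {0..1} \<subseteq> {0..1}"
    and g: "continuous_on {0..1} g" "g ` {0..1} \<subseteq> {0..1}"
    and eq: "f 0 = g 0" "f 1 = g 1" "p (f 0) = x" "p (f 1) = x"
    and u: "\<And>s. s \<in> {0..1} \<Longrightarrow> u s = p (f s)" and v: "\<And>s. s \<in> {0..1} \<Longrightarrow> v s = p (g s)"
  shows "(u, v) \<in> loop_homotopy X x"
proof (rule loop_homotopyI)
  let ?k = "\<lambda>z::real \<times> real. (1 - fst z) * f (snd z) + fst z * g (snd z)"
  have c: "convex {0..1::real}" by simp
  have "?k (t, s) \<in> {0..1}" if "t \<in> {0..1}" "s \<in> {0..1}" for t s
    using convexD[OF c, of "f s" "g s" "1 - t" t] that f(2) g(2) by (auto simp: image_subset_iff)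
  moreover have "continuous_on ({0..1} \<times> {0..1}) ?k"
    by (intro continuous_intros continuous_on_compose2[OF f(1)] continuous_on_compose2[OF g(1)]) auto
  ultimately show "continuous_map (prod_topology (top_of_set {0..1}) (top_of_set {0..1})) X (p \<circ> ?k)"
    by (intro continuous_map_compose[OF _ p[unfolded pathin_def]]) auto
  have "(1 - t) * a + t * a = a" for t a :: real by (simp add: algebra_simps)
  then show "(p \<circ> ?k) (t, 0) = x" "(p \<circ> ?k) (t, 1) = x" for t
    using eq by auto
qed (auto simp: u v)

lemma pathin_loop_join:
  assumes "pathin X p" "pathin X q" "p 1 = q 0"
  shows "pathin X (loop_join p q)"
proof -
  let ?I = "top_of_set {0..1::real}"
  have "continuous_map ?I X (\<lambda>s. if s \<le> 1/2 then (p \<circ> (\<lambda>t. 2 * t)) s else (q \<circ> (\<lambda>t. 2 * t - 1)) s)"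
  proof (rule continuous_map_cases_le)
    show "continuous_map (subtopology ?I {z \<in> topspace ?I. z \<le> 1/2}) X (p \<circ> (\<lambda>t. 2 * t))"
      by (rule continuous_map_compose[OF _ assms(1)[unfolded pathin_def]])
         (auto simp: subtopology_subtopology intro!: continuous_intros)
    show "continuous_map (subtopology ?I {z \<in> topspace ?I. 1/2 \<le> z}) X (q \<circ> (\<lambda>t. 2 * t - 1))"
      by (rule continuous_map_compose[OF _ assms(2)[unfolded pathin_def]])
         (auto simp: subtopology_subtopology intro!: continuous_intros)
    fix s :: real assume "s = 1/2"
    then have e: "2 * s = 1" by simp
    show "(p \<circ> (\<lambda>t. 2 * t)) s = (q \<circ> (\<lambda>t. 2 * t - 1)) s" by (simp add: e assms)
  qed auto
  then show ?thesis by (simp only: pathin_def loop_join_def o_def)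
qed

lemma loop_join_closed:
  "p \<in> loops X x \<Longrightarrow> q \<in> loops X x \<Longrightarrow> loop_join p q \<in> loops X x"
  by (auto simp: loops_def intro!: pathin_loop_join) (auto simp: loop_join_def)

lemma group_fundamental_group:
  assumes x: "x \<in> topspace X"
  shows "group (fundamental_group X x)"
  unfolding fundamental_group_def
proof (rule group_of_classes)
  show "equiv (loops X x) (loop_homotopy X x)" by (rule equiv_loop_homotopy)
  show "(\<lambda>_. x) \<in> loops X x" using x by (auto simp: loops_def pathin_def)
next
  fix p q s assume p: "p \<in> loops X x" and q: "q \<in> loops X x" and s: "s \<in> loops X x"
  let ?f = "\<lambda>t::real. if t \<le> 1/4 then 2 * t else if t \<le> 1/2 then t + 1/4 else t / 2 + 1/2"
  show "(loop_join (loop_join p q) s, loop_join p (loop_join q s)) \<in> loop_homotopy X x"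
  proof (rule loop_homotopy_reparametrize[where f = ?f and g = "\<lambda>t. t"])
    show "pathin X (loop_join p (loop_join q s))"
      using loop_join_closed[OF p loop_join_closed[OF q s]] by (simp add: loops_def)
    have "?f = (\<lambda>t. min (2 * t) (min (t + 1/4) (t / 2 + 1/2)) )"
      by (auto simp: min_def fun_eq_iff)
    then show "continuous_on {0..1} ?f"
      by (simp only:) (intro continuous_intros, auto)
    show "loop_join (loop_join p q) s t = loop_join p (loop_join q s) (?f t)" if "t \<in> {0..1}" for t
    proof -
      consider "t \<le> 1/4" | "1/4 < t" "t \<le> 1/2" | "1/2 < t" by linarith
      then show ?thesis
        by cases (auto simp: loop_join_def algebra_simps)
    qed
  qed (use p q s in \<open>auto simp: loops_def loop_join_def\<close>)
next
  fix p assume p: "p \<in> loops X x"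
  let ?f = "\<lambda>t::real. max 0 (2 * t - 1)"
  show "(loop_join (\<lambda>_. x) p, p) \<in> loop_homotopy X x"
  proof (rule loop_homotopy_reparametrize[where p = p and f = ?f and g = "\<lambda>t. t"])
    show "continuous_on {0..1} ?f" by (intro continuous_intros)
    show "loop_join (\<lambda>_. x) p t = p (?f t)" for t
    proof (cases "t \<le> 1/2")
      case True
      then have "?f t = 0" by simp
      then show ?thesis using True p by (simp add: loop_join_def loops_def)
    qed (simp add: loop_join_def)
  qed (use p in \<open>auto simp: loops_def\<close>)
  let ?q = "\<lambda>t. p (1 - t)"
  have "pathin X (p \<circ> (\<lambda>t. 1 - t))"
    unfolding pathin_def using p
    by (intro continuous_map_compose[of _ "top_of_set {0..1}"])
       (auto simp: loops_def pathin_def intro!: continuous_intros)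
  then have q: "?q \<in> loops X x" using p by (auto simp: loops_def o_def)
  have "(loop_join ?q p, \<lambda>_. x) \<in> loop_homotopy X x"
  proof (rule loop_homotopy_reparametrize[where p = p and f = "\<lambda>t. \<bar>2 * t - 1\<bar>" and g = "\<lambda>_. 1"])
    show "continuous_on {0..1} (\<lambda>t::real. \<bar>2 * t - 1\<bar>)" by (intro continuous_intros)
    show "loop_join ?q p t = p \<bar>2 * t - 1\<bar>" for t
    proof (cases "t \<le> 1/2")
      case True
      then have "\<bar>2 * t - 1\<bar> = 1 - 2 * t" by simp
      then show ?thesis using True by (simp add: loop_join_def)
    qed (simp add: loop_join_def)
  qed (use p in \<open>auto simp: loops_def\<close>)
  with q show "\<exists>q\<in>loops X x. (loop_join q p, \<lambda>_. x) \<in> loop_homotopy X x" by blast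
qed (auto intro: loop_join_closed loop_homotopy_join)

section \<open>Group presentations\<close>

text \<open>A word is a list of letters \<open>(a, b)\<close>, which stand for the generator \<open>a\<close> if \<open>b\<close> holds
  and for its inverse otherwise.\<close>

type_synonym 'a word = "('a \<times> bool) list"

definition words :: "'a set \<Rightarrow> 'a word set" where
  "words A = lists (A \<times> UNIV)"

definition cancel_step :: "'a set \<Rightarrow> 'a word \<Rightarrow> 'a word \<Rightarrow> bool" where
  "cancel_step A u v \<longleftrightarrow> u \<in> words A \<and>
     (\<exists>x y a b. u = x @ [(a, b), (a, \<not> b)] @ y \<and> v = x @ y)"

definition free_equiv :: "'a set \<Rightarrow> ('a word \<times> 'a word) set" where
  "free_equiv A = {(u, v). u \<in> words A \<and> v \<in> words A \<and> equivclp (cancel_step A) u v}"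

definition free_group :: "'a set \<Rightarrow> 'a word set monoid" where
  "free_group A =
     \<lparr>carrier = words A // free_equiv A,
      mult = (\<lambda>U V. \<Union>u\<in>U. \<Union>v\<in>V. free_equiv A `` {u @ v}),
      one = free_equiv A `` {[]}\<rparr>"

lemma words_append [simp]: "u @ v \<in> words A \<longleftrightarrow> u \<in> words A \<and> v \<in> words A"
  by (auto simp: words_def)

lemma equiv_free_equiv: "equiv (words A) (free_equiv A)"
  by (intro equivI refl_onI symI transI)
     (auto simp: free_equiv_def intro: equivclp_sym equivclp_trans)

lemma cancel_step_append:
  assumes "cancel_step A u v" "x \<in> words A" "y \<in> words A"
  shows "cancel_step A (x @ u @ y) (x @ v @ y)"
proof -
  obtain p q a b where u: "u \<in> words A" "u = p @ [(a, b), (a, \<not> b)] @ q" "v = p @ q"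
    using assms(1) unfolding cancel_step_def by blast
  have "x @ u @ y = (x @ p) @ [(a, b), (a, \<not> b)] @ (q @ y)" "x @ v @ y = (x @ p) @ (q @ y)"
    using u by auto
  moreover have "x @ u @ y \<in> words A" using u(1) assms(2,3) by simp
  ultimately show ?thesis unfolding cancel_step_def by blast
qed

lemma equivclp_cancel_step_append:
  assumes "equivclp (cancel_step A) u v" "x \<in> words A" "y \<in> words A"
  shows "equivclp (cancel_step A) (x @ u @ y) (x @ v @ y)"
  using assms(1)
proof (induction rule: equivclp_induct)
  case (step v w)
  then show ?case
    using cancel_step_append[OF _ assms(2,3)] by (meson equivclp_into_equivclp)
qed simp

lemma free_equiv_append:
  assumes "(u, u') \<in> free_equiv A" "(v, v') \<in> free_equiv A"
  shows "(u @ v, u' @ v') \<in> free_equiv A"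
proof -
  have w: "u \<in> words A" "u' \<in> words A" "v \<in> words A" "v' \<in> words A"
    and e: "equivclp (cancel_step A) u u'" "equivclp (cancel_step A) v v'"
    using assms by (auto simp: free_equiv_def)
  have nil: "[] \<in> words A" by (simp add: words_def)
  have "equivclp (cancel_step A) (u @ v) (u' @ v)"
    using equivclp_cancel_step_append[OF e(1) nil w(3)] by simp
  also have "equivclp (cancel_step A) (u' @ v) (u' @ v')"
    using equivclp_cancel_step_append[OF e(2) w(2) nil] by simp
  finally show ?thesis using w by (simp add: free_equiv_def)
qed

lemma free_equiv_left_inverse:
  assumes "w \<in> words A"
  shows "\<exists>v\<in>words A. (v @ w, []) \<in> free_equiv A"
  using assms
proof (induction w)
  case Nil
  then show ?case by (intro bexI[of _ "[]"]) (auto simp: free_equiv_def)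
next
  case (Cons l w)
  obtain a b where l: "l = (a, b)" by fastforce
  have a: "a \<in> A" "w \<in> words A" using Cons.prems l by (auto simp: words_def)
  obtain v where v: "v \<in> words A" "(v @ w, []) \<in> free_equiv A" using Cons.IH a(2) by blast
  have inv: "[(a, \<not> b)] \<in> words A" using a(1) by (simp add: words_def)
  have "cancel_step A ((v @ [(a, \<not> b)]) @ l # w) (v @ w)"
    unfolding cancel_step_def
  proof (intro conjI exI)
    show "(v @ [(a, \<not> b)]) @ l # w \<in> words A"
      using v(1) inv Cons.prems by (simp only: words_append)
    show "(v @ [(a, \<not> b)]) @ l # w = v @ [(a, \<not> b), (a, \<not> \<not> b)] @ w" by (simp add: l)
  qed simp
  moreover have "(v @ [(a, \<not> b)]) @ l # w \<in> words A"
    using v(1) inv Cons.prems by (simp only: words_append)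
  ultimately have "((v @ [(a, \<not> b)]) @ l # w, []) \<in> free_equiv A"
    using v(2) unfolding free_equiv_def
    by (blast intro: equivclp_trans r_into_equivclp)
  with v(1) inv show ?case by (intro bexI[of _ "v @ [(a, \<not> b)]"]) (simp_all only: words_append simp_thms)
qed

lemma group_free_group: "group (free_group A)"
  unfolding free_group_def
proof (rule group_of_classes[OF equiv_free_equiv])
  show "(u @ v, u' @ v') \<in> free_equiv A"
    if "(u, u') \<in> free_equiv A" "(v, v') \<in> free_equiv A" for u u' v v'
    using that by (rule free_equiv_append)
  show "\<exists>v\<in>words A. (v @ w, []) \<in> free_equiv A" if "w \<in> words A" for w
    using that by (rule free_equiv_left_inverse)
qed (auto simp: free_equiv_def words_def)

definition normal_closure :: "('a, 'b) monoid_scheme \<Rightarrow> 'a set \<Rightarrow> 'a set" where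
  "normal_closure G S = \<Inter>{N. N \<lhd> G \<and> S \<subseteq> N}"

lemma normal_normal_closure:
  assumes G: "group G" and S: "S \<subseteq> carrier G"
  shows "normal_closure G S \<lhd> G"
proof (rule group.normal_invI[OF G])
  have c: "carrier G \<lhd> G" by (rule group.normal_self[OF G])
  show "subgroup (normal_closure G S) G"
    unfolding normal_closure_def
  proof (rule group.subgroups_Inter[OF G])
    show "{N. N \<lhd> G \<and> S \<subseteq> N} \<noteq> {}" using c S by blast
  qed (auto simp: normal_def)
  show "x \<otimes>\<^bsub>G\<^esub> n \<otimes>\<^bsub>G\<^esub> inv\<^bsub>G\<^esub> x \<in> normal_closure G S"
    if "x \<in> carrier G" "n \<in> normal_closure G S" for x n
    using that by (auto simp: normal_closure_def dest: normal.inv_op_closed2)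
qed

definition presented_group :: "'a set \<Rightarrow> 'a word set \<Rightarrow> 'a word set set monoid" where
  "presented_group A R =
     free_group A Mod normal_closure (free_group A) ((\<lambda>w. free_equiv A `` {w}) ` R)"

lemma group_presented_group:
  assumes "R \<subseteq> words A"
  shows "group (presented_group A R)"
  unfolding presented_group_def
proof (intro normal.factorgroup_is_group normal_normal_closure group_free_group)
  show "(\<lambda>w. free_equiv A `` {w}) ` R \<subseteq> carrier (free_group A)"
    using assms by (auto simp: free_group_def intro: quotientI)
qed

datatype surface_gen = Gen_a nat | Gen_b nat

definition surface_relator :: "nat \<Rightarrow> surface_gen word" where
  "surface_relator g =
     concat (map (\<lambda>i. [(Gen_a i, True), (Gen_b i, True), (Gen_a i, False), (Gen_b i, False)])
                 [1..<Suc g])"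

definition surface_group :: "nat \<Rightarrow> surface_gen word set set monoid" where
  "surface_group g = presented_group (Gen_a ` {1..g} \<union> Gen_b ` {1..g}) {surface_relator g}"

lemma group_surface_group: "group (surface_group g)"
  unfolding surface_group_def
  by (rule group_presented_group) (auto simp: surface_relator_def words_def)

end

theory Submission
  imports Defs
begin

text \<open>
  For \<open>g \<ge> 1\<close> let \<open>q\<close> be the quotient map from the closed disc \<open>D\<close> onto \<open>S\<^sub>g\<close>, let
  \<open>G\<close> be the surface group and \<open>n = 4 g\<close>. The isomorphism \<open>\<pi>\<^sub>1(S\<^sub>g) \<rightarrow> G\<close> is the monodromy of
  the universal covering, which is \<open>G \<times> D\<close> with the side \<open>k\<close> of the copy \<open>x\<close> glued to the partner
  side of the copy \<open>x \<gamma>\<^sub>k\<close>, where \<open>\<gamma>\<^sub>k\<close> is the generator of that side or its inverse. The covering space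
  itself is never built. It is replaced by its local sections: a family of functions \<open>f\<^sub>i\<close> with values in
  \<open>G\<close> on the members \<open>U\<^sub>i\<close> of an open cover such that \<open>f\<^sub>i f\<^sub>j\<^sup>-\<^sup>1\<close> is locally constant.

  Three kinds of patches \<open>U\<^sub>i\<close> cover \<open>S\<^sub>g\<close>: the open face, one patch around the single vertex, and
  one around the midpoint of each edge. The preimage of a patch in the disc is a disjoint union of
  cells (the open disc, or sectors around corners or midpoints of sides), and radial contraction of the
  cells to their centres respects the gluing. A section is therefore given by one label in \<open>G\<close> for
  every cell. Crossing a side forces the labels of the corners at its two ends to differ from those
  at the ends of the partner side by \<open>\<gamma>\<^sub>k\<close>. Solving these equations around the polygon makes the label
  of corner \<open>4 i\<close> the product of the first \<open>i\<close> commutators, so that the labels close up at corner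
  \<open>n\<close> exactly because of the defining relation. This is \<open>polygon_glued_convex\<close>.

  The argument that a local system computes the fundamental group is \<open>fundamental_group_iso\<close>. Lifts
  exist over a square (\<open>lift_unit_square\<close>), so the holonomy of a path is invariant under homotopy. In
  the other direction, a spoke is a radial path from the centre of the disc; going out along one spoke
  and back along another one with the same end in \<open>S\<^sub>g\<close> gives a loop. Sliding the end along an edge
  shows that the classes of these loops satisfy the same equations as the labels, and this defines a
  homomorphism \<open>\<phi>\<close> from \<open>G\<close> to the fundamental group. Since cells contract, a path inside one patch
  is homotopic to the one through the centre, so \<open>\<phi>\<close> of its holonomy is its own class once it
  is closed up by spokes (\<open>tree_class_in_patch\<close>). Cutting a loop into short pieces shows that \<open>\<phi>\<close>
  after the holonomy is the identity; the other composition is checked on generators.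

  For \<open>g = 0\<close> both groups are trivial. The groups are told apart by the number of their
  homomorphisms to a group of order two, which is \<open>4\<^sup>g\<close>: every generator may be sent
  anywhere, as commutators vanish in an abelian group.
\<close>

section \<open>Homomorphisms from presented groups\<close>

definition word_eval :: "('b, 'c) monoid_scheme \<Rightarrow> ('a \<Rightarrow> 'b) \<Rightarrow> 'a word \<Rightarrow> 'b" where
  "word_eval K f w =
     foldr (\<lambda>l y. (if snd l then f (fst l) else inv\<^bsub>K\<^esub> f (fst l)) \<otimes>\<^bsub>K\<^esub> y) w \<one>\<^bsub>K\<^esub>"

lemma word_eval_Nil [simp]: "word_eval K f [] = \<one>\<^bsub>K\<^esub>"
  by (simp add: word_eval_def)

lemma word_eval_Cons [simp]:
  "word_eval K f ((a, b) # w) = (if b then f a else inv\<^bsub>K\<^esub> f a) \<otimes>\<^bsub>K\<^esub> word_eval K f w"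
  by (simp add: word_eval_def)

lemma words_Nil [simp]: "[] \<in> words A"
  by (simp add: words_def)

lemma words_Cons [simp]: "(a, b) # w \<in> words A \<longleftrightarrow> a \<in> A \<and> w \<in> words A"
  by (auto simp: words_def)

context
  fixes K :: "('b, 'c) monoid_scheme" (structure) and A :: "'a set" and f :: "'a \<Rightarrow> 'b"
  assumes K: "group K" and f: "f \<in> A \<rightarrow> carrier K"
begin

interpretation group K by (rule K)

lemma word_eval_closed [simp]: "w \<in> words A \<Longrightarrow> word_eval K f w \<in> carrier K"
  by (induction w) (use f in \<open>auto simp: Pi_iff\<close>)

lemma word_eval_append:
  "u \<in> words A \<Longrightarrow> v \<in> words A \<Longrightarrow> word_eval K f (u @ v) = word_eval K f u \<otimes> word_eval K f v"
  by (induction u) (use f in \<open>auto simp: m_assoc Pi_iff\<close>)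

lemma word_eval_cancel_step:
  assumes "cancel_step A u v"
  shows "word_eval K f u = word_eval K f v"
proof -
  obtain x y a b where u: "u \<in> words A" "u = x @ [(a, b), (a, \<not> b)] @ y" "v = x @ y"
    using assms by (auto simp: cancel_step_def)
  then have w: "x \<in> words A" "y \<in> words A" "a \<in> A" by auto
  have "word_eval K f ([(a, b), (a, \<not> b)] @ y) = word_eval K f y"
    using w f by (auto simp: m_assoc[symmetric] Pi_iff)
  then show ?thesis
    using u w by (simp only: word_eval_append words_append words_Cons words_Nil simp_thms)
qed

lemma word_eval_free_equiv:
  assumes "(u, v) \<in> free_equiv A"
  shows "word_eval K f u = word_eval K f v"
proof -
  have "equivclp (cancel_step A) u v" using assms by (simp add: free_equiv_def)
  then show ?thesis
    by (induction rule: equivclp_induct) (auto dest: word_eval_cancel_step)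
qed

end

text \<open>The element of the presented group that a word represents.\<close>

definition pres_class :: "'a set \<Rightarrow> 'a word set \<Rightarrow> 'a word \<Rightarrow> 'a word set set" where
  "pres_class A R w =
     normal_closure (free_group A) ((\<lambda>w. free_equiv A `` {w}) ` R) #>\<^bsub>free_group A\<^esub> (free_equiv A `` {w})"

lemma free_group_mult:
  assumes "u \<in> words A" "v \<in> words A"
  shows "free_equiv A `` {u} \<otimes>\<^bsub>free_group A\<^esub> free_equiv A `` {v} = free_equiv A `` {u @ v}"
proof -
  have "congruent2 (free_equiv A) (free_equiv A) (\<lambda>p q. free_equiv A `` {p @ q})"
    by (auto simp: congruent2_def intro!: equiv_class_eq[OF equiv_free_equiv] free_equiv_append)
  from UN_equiv_class2[OF equiv_free_equiv equiv_free_equiv this assms]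
  show ?thesis by (simp add: free_group_def)
qed

lemma carrier_free_group: "carrier (free_group A) = (\<lambda>w. free_equiv A `` {w}) ` words A"
  by (auto simp: free_group_def quotient_def)

lemma free_group_lift:
  assumes K: "group K" and f: "f \<in> A \<rightarrow> carrier K"
  obtains h where "h \<in> hom (free_group A) K"
    and "\<And>w. w \<in> words A \<Longrightarrow> h (free_equiv A `` {w}) = word_eval K f w"
proof -
  define h where "h U = the_elem (word_eval K f ` U)" for U
  have h: "h (free_equiv A `` {w}) = word_eval K f w" if "w \<in> words A" for w
  proof -
    have "w \<in> free_equiv A `` {w}"
      using that by (simp add: free_equiv_def)
    moreover have "word_eval K f v = word_eval K f w" if "v \<in> free_equiv A `` {w}" for v
      using that word_eval_free_equiv[OF K f, of w v] by auto
    ultimately have "word_eval K f ` (free_equiv A `` {w}) = {word_eval K f w}" by blast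
    then show ?thesis by (simp add: h_def)
  qed
  moreover have "h \<in> hom (free_group A) K"
    by (auto simp: hom_def carrier_free_group h free_group_mult
      word_eval_closed[OF K f] word_eval_append[OF K f])
  ultimately show thesis using that by blast
qed

lemma free_relators: "R \<subseteq> words A \<Longrightarrow> (\<lambda>w. free_equiv A `` {w}) ` R \<subseteq> carrier (free_group A)"
  by (auto simp: carrier_free_group)

text \<open>The universal property. The kernel of the map induced on the free group is a normal subgroup
  that contains the relators, hence it contains their normal closure.\<close>

lemma presented_group_lift:
  assumes R: "R \<subseteq> words A" and K: "group K" and f: "f \<in> A \<rightarrow> carrier K"
    and rel: "\<And>r. r \<in> R \<Longrightarrow> word_eval K f r = \<one>\<^bsub>K\<^esub>"
  obtains h where "h \<in> hom (presented_group A R) K"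
    and "\<And>w. w \<in> words A \<Longrightarrow> h (pres_class A R w) = word_eval K f w"
proof -
  let ?F = "free_group A" and ?S = "(\<lambda>w. free_equiv A `` {w}) ` R"
  obtain h where h: "h \<in> hom ?F K" "\<And>w. w \<in> words A \<Longrightarrow> h (free_equiv A `` {w}) = word_eval K f w"
    using free_group_lift[OF K f] by blast
  interpret h: group_hom ?F K h
    using h(1) K group_free_group by (auto simp: group_hom_def group_hom_axioms_def)
  have S: "?S \<subseteq> kernel ?F K h"
    using R rel h(2) free_relators[OF R] by (auto simp: kernel_def)
  have "normal_closure ?F ?S \<subseteq> kernel ?F K h"
    unfolding normal_closure_def using h.normal_kernel S by blast
  moreover have "normal_closure ?F ?S \<lhd> ?F"
    by (rule normal_normal_closure[OF group_free_group free_relators[OF R]])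
  moreover have "h x = h y" if x: "x \<in> carrier ?F" and y: "y \<in> carrier ?F"
    and e: "normal_closure ?F ?S #>\<^bsub>?F\<^esub> x = normal_closure ?F ?S #>\<^bsub>?F\<^esub> y" for x y
  proof -
    have "x \<in> normal_closure ?F ?S #>\<^bsub>?F\<^esub> y"
      using e x calculation(2) by (metis group.rcos_self group_free_group normal_imp_subgroup)
    then obtain k where k: "k \<in> normal_closure ?F ?S" "x = k \<otimes>\<^bsub>?F\<^esub> y"
      by (auto simp: r_coset_def)
    then have "k \<in> carrier ?F" "h k = \<one>\<^bsub>K\<^esub>" using calculation(1) by (auto simp: kernel_def)
    then show ?thesis using k y by simp
  qed
  ultimately obtain g where "g \<in> hom (?F Mod normal_closure ?F ?S) K"
    "\<And>x. x \<in> carrier ?F \<Longrightarrow> g (normal_closure ?F ?S #>\<^bsub>?F\<^esub> x) = h x"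
    using FactGroup_universal[OF h(1)] by blast
  then show thesis
    using that h(2) by (auto simp: presented_group_def pres_class_def carrier_free_group)
qed

context
  fixes A :: "'a set" and R :: "'a word set"
  assumes R: "R \<subseteq> words A"
begin

lemma carrier_presented_group: "carrier (presented_group A R) = pres_class A R ` words A"
  by (auto simp: presented_group_def FactGroup_def RCOSETS_def carrier_free_group pres_class_def)

lemma pres_class_closed: "w \<in> words A \<Longrightarrow> pres_class A R w \<in> carrier (presented_group A R)"
  by (simp add: carrier_presented_group)

lemma pres_class_append:
  assumes "u \<in> words A" "v \<in> words A"
  shows "pres_class A R (u @ v) = pres_class A R u \<otimes>\<^bsub>presented_group A R\<^esub> pres_class A R v"
  using normal.rcos_sum[OF normal_normal_closure[OF group_free_group free_relators[OF R]],
      of "free_equiv A `` {u}" "free_equiv A `` {v}"] assms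
  by (simp add: presented_group_def FactGroup_def pres_class_def carrier_free_group free_group_mult)

lemma pres_class_Nil: "pres_class A R [] = \<one>\<^bsub>presented_group A R\<^esub>"
proof -
  have "normal_closure (free_group A) ((\<lambda>w. free_equiv A `` {w}) ` R) \<subseteq> carrier (free_group A)"
    using normal_normal_closure[OF group_free_group free_relators[OF R]]
    by (simp add: normal_imp_subgroup subgroup.subset)
  then have "normal_closure (free_group A) ((\<lambda>w. free_equiv A `` {w}) ` R)
      #>\<^bsub>free_group A\<^esub> \<one>\<^bsub>free_group A\<^esub> = normal_closure (free_group A) ((\<lambda>w. free_equiv A `` {w}) ` R)"
    by (intro group.coset_mult_one[OF group_free_group])
  then show ?thesis by (simp add: presented_group_def pres_class_def free_group_def)
qed

lemma pres_class_relator: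
  assumes "r \<in> R"
  shows "pres_class A R r = \<one>\<^bsub>presented_group A R\<^esub>"
proof -
  let ?N = "normal_closure (free_group A) ((\<lambda>w. free_equiv A `` {w}) ` R)"
  have N: "subgroup ?N (free_group A)"
    using normal_normal_closure[OF group_free_group free_relators[OF R]]
    by (simp add: normal_imp_subgroup)
  have "free_equiv A `` {r} \<in> ?N" using assms by (auto simp: normal_closure_def)
  then have "?N #>\<^bsub>free_group A\<^esub> (free_equiv A `` {r}) = ?N"
    using group.coset_join2[OF group_free_group _ N] assms R by (auto simp: carrier_free_group)
  then show ?thesis by (simp add: presented_group_def pres_class_def)
qed

lemma pres_class_letter:
  assumes a: "a \<in> A"
  shows "pres_class A R [(a, b)] =
    (if b then pres_class A R [(a, True)] else inv\<^bsub>presented_group A R\<^esub> pres_class A R [(a, True)])"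
proof -
  interpret P: group "presented_group A R" by (rule group_presented_group[OF R])
  let ?s = "[(a, False)]" and ?t = "[(a, True)]"
  have w: "?s \<in> words A" "?t \<in> words A" using a by auto
  have "cancel_step A (?s @ ?t) []"
    unfolding cancel_step_def using a
    by (intro conjI exI[of _ "[]"] exI[of _ a] exI[of _ False]) auto
  then have "(?s @ ?t, []) \<in> free_equiv A"
    using w by (simp add: free_equiv_def r_into_equivclp)
  then have "free_equiv A `` {?s @ ?t} = free_equiv A `` {[]}"
    by (rule equiv_class_eq[OF equiv_free_equiv])
  then have "pres_class A R (?s @ ?t) = \<one>\<^bsub>presented_group A R\<^esub>"
    unfolding pres_class_Nil[symmetric] by (simp only: pres_class_def)
  then have "pres_class A R ?s \<otimes>\<^bsub>presented_group A R\<^esub> pres_class A R ?t = \<one>\<^bsub>presented_group A R\<^esub>"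
    by (simp only: pres_class_append[OF w])
  then have "pres_class A R ?s = inv\<^bsub>presented_group A R\<^esub> pres_class A R ?t"
    using P.inv_equality[OF _ pres_class_closed[OF w(2)] pres_class_closed[OF w(1)]] by simp
  then show ?thesis by (cases b) auto
qed

text \<open>Turns statements about represented elements into evaluations, so that the same computation
  serves the presented group and the target of a homomorphism.\<close>

lemma pres_class_eq_word_eval:
  "w \<in> words A \<Longrightarrow>
    pres_class A R w = word_eval (presented_group A R) (\<lambda>a. pres_class A R [(a, True)]) w"
proof (induction w)
  case (Cons l w)
  obtain a b where l: "l = (a, b)" by fastforce
  then have w: "[(a, b)] \<in> words A" "w \<in> words A" "a \<in> A" using Cons.prems by auto
  have "pres_class A R (l # w) = pres_class A R [(a, b)] \<otimes>\<^bsub>presented_group A R\<^esub> pres_class A R w"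
    using pres_class_append[OF w(1,2)] l by simp
  then show ?case using Cons.IH[OF w(2)] pres_class_letter[OF w(3), of b] by (simp add: l)
qed (simp add: pres_class_Nil)

lemma presented_group_generated:
  "carrier (presented_group A R) = generate (presented_group A R) ((\<lambda>a. pres_class A R [(a, True)]) ` A)"
    (is "_ = generate ?P ?X")
proof
  interpret P: group ?P by (rule group_presented_group[OF R])
  have X: "?X \<subseteq> carrier ?P" by (auto intro!: pres_class_closed)
  have letter: "pres_class A R [(a, b)] \<in> generate ?P ?X" if "a \<in> A" for a b
    unfolding pres_class_letter[OF that, of b] using that
    by (simp add: generate.incl generate.inv)
  have "pres_class A R w \<in> generate ?P ?X" if "w \<in> words A" for w
    using that
  proof (induction w)
    case (Cons l w)
    obtain a b where l: "l = (a, b)" by fastforce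
    then have "pres_class A R (l # w) = pres_class A R [(a, b)] \<otimes>\<^bsub>?P\<^esub> pres_class A R w"
      using pres_class_append[of "[(a, b)]" w] Cons.prems by simp
    then show ?case using Cons l letter[of a b] by (simp add: generate.eng)
  qed (simp add: pres_class_Nil generate.one)
  then show "carrier ?P \<subseteq> generate ?P ?X" by (auto simp: carrier_presented_group)
  show "generate ?P ?X \<subseteq> carrier ?P" using P.generate_incl[OF X] .
qed

end

section \<open>Homotopies of paths\<close>

abbreviation (input) unit_square :: "(real \<times> real) topology" where
  "unit_square \<equiv> prod_topology (top_of_set {0..1}) (top_of_set {0..1})"

text \<open>Homotopy of paths with fixed end points. As for loops, only the values on \<open>{0..1}\<close> matter.\<close>

definition path_hom :: "'a topology \<Rightarrow> 'a \<Rightarrow> 'a \<Rightarrow> (real \<Rightarrow> 'a) \<Rightarrow> (real \<Rightarrow> 'a) \<Rightarrow> bool" where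
  "path_hom X x y p q \<longleftrightarrow>
     homotopic_with (\<lambda>r. r 0 = x \<and> r 1 = y) (top_of_set {0..1}) X p q"

definition path_rev :: "(real \<Rightarrow> 'a) \<Rightarrow> real \<Rightarrow> 'a" where
  "path_rev p = (\<lambda>t. p (1 - t))"

lemma loop_homotopy_iff: "(p, q) \<in> loop_homotopy X x \<longleftrightarrow> path_hom X x x p q"
  by (simp add: loop_homotopy_def path_hom_def)

lemma path_homI:
  fixes h :: "real \<times> real \<Rightarrow> 'a"
  assumes "continuous_map unit_square X h"
    and "\<And>s. s \<in> {0..1} \<Longrightarrow> h (0, s) = p s" "\<And>s. s \<in> {0..1} \<Longrightarrow> h (1, s) = q s"
    and "\<And>t. t \<in> {0..1} \<Longrightarrow> h (t, 0) = x" "\<And>t. t \<in> {0..1} \<Longrightarrow> h (t, 1) = y"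
  shows "path_hom X x y p q"
  unfolding path_hom_def
proof (subst homotopic_with)
  show "\<exists>h. continuous_map unit_square X h \<and>
          (\<forall>s\<in>topspace (top_of_set {0..1}). h (0, s) = p s) \<and>
          (\<forall>s\<in>topspace (top_of_set {0..1}). h (1, s) = q s) \<and>
          (\<forall>t\<in>{0..1}. h (t, 0) = x \<and> h (t, 1) = y)"
    by (rule exI[of _ h]) (intro conjI assms(1) ballI; use assms(2-) in simp)
qed auto

lemma path_homE:
  fixes X :: "'a topology"
  assumes "path_hom X x y p q"
  obtains h :: "real \<times> real \<Rightarrow> 'a"
  where "continuous_map unit_square X h"
    and "\<And>s. h (0, s) = p s" "\<And>s. h (1, s) = q s"
    and "\<And>t. t \<in> {0..1} \<Longrightarrow> h (t, 0) = x" "\<And>t. t \<in> {0..1} \<Longrightarrow> h (t, 1) = y"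
proof -
  obtain h :: "real \<times> real \<Rightarrow> 'a"
    where h: "continuous_map unit_square X h"
    "\<forall>s. h (0, s) = p s" "\<forall>s. h (1, s) = q s" "\<forall>t\<in>{0..1}. h (t, 0) = x \<and> h (t, 1) = y"
    using assms unfolding path_hom_def homotopic_with_def by blast
  show thesis by (rule that[OF h(1)]) (use h(2-) in auto)
qed

lemma path_hom_sym: "path_hom X x y p q \<Longrightarrow> path_hom X x y q p"
  by (simp add: path_hom_def homotopic_with_sym)

lemma path_hom_trans [trans]:
  "path_hom X x y p q \<Longrightarrow> path_hom X x y q r \<Longrightarrow> path_hom X x y p r"
  unfolding path_hom_def by (rule homotopic_with_trans)

lemma path_hom_refl: "pathin X p \<Longrightarrow> p 0 = x \<Longrightarrow> p 1 = y \<Longrightarrow> path_hom X x y p p"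
  by (simp add: path_hom_def pathin_def)

lemma path_hom_imp:
  assumes "path_hom X x y p q"
  shows "pathin X p" "pathin X q" "p 0 = x" "p 1 = y" "q 0 = x" "q 1 = y"
  using assms unfolding path_hom_def pathin_def
  by (auto dest: homotopic_with_imp_continuous_maps homotopic_with_imp_property)

lemma pathin_rev:
  assumes "pathin X p"
  shows "pathin X (path_rev p)"
proof -
  have "pathin X (p \<circ> (\<lambda>t. 1 - t))"
    unfolding pathin_def using assms
    by (intro continuous_map_compose[of _ "top_of_set {0..1}"])
       (auto simp: pathin_def intro!: continuous_intros)
  then show ?thesis by (simp add: path_rev_def o_def)
qed

lemma path_rev_ends [simp]: "path_rev p 0 = p 1" "path_rev p 1 = p 0"
  by (simp_all add: path_rev_def)

lemma loop_join_ends [simp]: "loop_join p q 0 = p 0" "loop_join p q 1 = q 1"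
  by (simp_all add: loop_join_def)

text \<open>Two paths with the same ends in a convex set are joined by the straight-line homotopy, which
  any continuous map carries along. Most homotopies below are instances.\<close>

lemma path_hom_convex_image:
  fixes K :: "'k::real_normed_vector set"
  assumes F: "continuous_map (top_of_set K) X F" and K: "convex K"
    and u: "continuous_on {0..1} u" "u ` {0..1} \<subseteq> K"
    and v: "continuous_on {0..1} v" "v ` {0..1} \<subseteq> K"
    and e: "u 0 = v 0" "u 1 = v 1"
    and p: "\<And>s. s \<in> {0..1} \<Longrightarrow> p s = F (u s)" and q: "\<And>s. s \<in> {0..1} \<Longrightarrow> q s = F (v s)"
  shows "path_hom X (p 0) (p 1) p q"
proof (rule path_homI)
  let ?k = "\<lambda>z::real \<times> real. (1 - fst z) *\<^sub>R u (snd z) + fst z *\<^sub>R v (snd z)"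
  have "?k (t, s) \<in> K" if "t \<in> {0..1}" "s \<in> {0..1}" for t s
    using convexD[OF K, of "u s" "v s" "1 - t" t] that u(2) v(2) by (auto simp: image_subset_iff)
  moreover have "continuous_on ({0..1} \<times> {0..1}) ?k"
    by (intro continuous_intros continuous_on_compose2[OF u(1)] continuous_on_compose2[OF v(1)]) auto
  ultimately show "continuous_map unit_square X (F \<circ> ?k)"
    by (intro continuous_map_compose[OF _ F]) auto
  have "(1 - t) *\<^sub>R a + t *\<^sub>R a = a" for t :: real and a :: 'k
    by (simp add: scaleR_left_diff_distrib)
  then show "(F \<circ> ?k) (t, 0) = p 0" "(F \<circ> ?k) (t, 1) = p 1" for t
    using e p by auto
qed (auto simp: p q)

lemma path_hom_reparametrize:
  assumes "pathin X F"
    and "continuous_on {0..1} u" "u ` {0..1} \<subseteq> {0..1}"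
    and "continuous_on {0..1} v" "v ` {0..1} \<subseteq> {0..1}"
    and "u 0 = v 0" "u 1 = v 1"
    and "\<And>s. s \<in> {0..1} \<Longrightarrow> p s = F (u s)" "\<And>s. s \<in> {0..1} \<Longrightarrow> q s = F (v s)"
    and "p 0 = x" "p 1 = y"
  shows "path_hom X x y p q"
  using path_hom_convex_image[of "{0..1::real}" X F u v p q] assms by (simp add: pathin_def)

lemma path_hom_join:
  assumes "path_hom X x y p p'" "path_hom X y z q q'"
  shows "path_hom X x z (loop_join p q) (loop_join p' q')"
proof -
  let ?I = "top_of_set {0..1::real}"
  obtain h where h: "continuous_map (prod_topology ?I ?I) X h"
    "\<And>s. h (0, s) = p s" "\<And>s. h (1, s) = p' s"
    "\<And>t. t \<in> {0..1} \<Longrightarrow> h (t, 0) = x" "\<And>t. t \<in> {0..1} \<Longrightarrow> h (t, 1) = y"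
    using path_homE[OF assms(1)] by metis
  obtain k where k: "continuous_map (prod_topology ?I ?I) X k"
    "\<And>s. k (0, s) = q s" "\<And>s. k (1, s) = q' s"
    "\<And>t. t \<in> {0..1} \<Longrightarrow> k (t, 0) = y" "\<And>t. t \<in> {0..1} \<Longrightarrow> k (t, 1) = z"
    using path_homE[OF assms(2)] by metis
  let ?H = "\<lambda>z. if snd z \<le> 1/2 then (h \<circ> (\<lambda>z. (fst z, 2 * snd z))) z
                else (k \<circ> (\<lambda>z. (fst z, 2 * snd z - 1))) z"
  have P: "prod_topology ?I ?I = top_of_set ({0..1} \<times> {0..1})" by simp
  have "continuous_map (prod_topology ?I ?I) X ?H"
  proof (rule continuous_map_cases_le)
    show "continuous_map (prod_topology ?I ?I) euclideanreal snd"
      unfolding P by (auto intro!: continuous_intros)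
    show "continuous_map (subtopology (prod_topology ?I ?I)
        {z \<in> topspace (prod_topology ?I ?I). snd z \<le> 1/2}) X (h \<circ> (\<lambda>z. (fst z, 2 * snd z)))"
      by (rule continuous_map_compose[OF _ h(1)])
         (auto simp: P subtopology_subtopology intro!: continuous_intros)
    show "continuous_map (subtopology (prod_topology ?I ?I)
        {z \<in> topspace (prod_topology ?I ?I). 1/2 \<le> snd z}) X (k \<circ> (\<lambda>z. (fst z, 2 * snd z - 1)))"
      by (rule continuous_map_compose[OF _ k(1)])
         (auto simp: P subtopology_subtopology intro!: continuous_intros)
    fix z assume z: "z \<in> topspace (prod_topology ?I ?I)" and "snd z = 1/2"
    then have e: "2 * snd z = 1" by simp
    have "fst z \<in> {0..1}" using z by auto
    then show "(h \<circ> (\<lambda>z. (fst z, 2 * snd z))) z = (k \<circ> (\<lambda>z. (fst z, 2 * snd z - 1))) z"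
      by (simp add: e h k)
  qed auto
  then show ?thesis
    by (rule path_homI) (auto simp: loop_join_def h k)
qed

lemma path_hom_assoc:
  assumes "pathin X p" "pathin X q" "pathin X s" "p 1 = q 0" "q 1 = s 0" "p 0 = x" "s 1 = y"
  shows "path_hom X x y (loop_join (loop_join p q) s) (loop_join p (loop_join q s))"
proof -
  let ?f = "\<lambda>t::real. if t \<le> 1/4 then 2 * t else if t \<le> 1/2 then t + 1/4 else t / 2 + 1/2"
  show ?thesis
  proof (rule path_hom_reparametrize[where u = ?f and v = "\<lambda>t. t"])
    show "pathin X (loop_join p (loop_join q s))"
      using assms by (auto intro!: pathin_loop_join)
    have "?f = (\<lambda>t. min (2 * t) (min (t + 1/4) (t / 2 + 1/2)) )"
      by (auto simp: min_def fun_eq_iff)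
    then show "continuous_on {0..1} ?f"
      by (simp only:) (intro continuous_intros, auto)
    show "loop_join (loop_join p q) s t = loop_join p (loop_join q s) (?f t)" if "t \<in> {0..1}" for t
    proof -
      consider "t \<le> 1/4" | "1/4 < t" "t \<le> 1/2" | "1/2 < t" by linarith
      then show ?thesis
        by cases (auto simp: loop_join_def algebra_simps)
    qed
  qed (use assms in auto)
qed

lemma path_hom_const_left:
  assumes "pathin X p" "p 0 = x" "p 1 = y"
  shows "path_hom X x y (loop_join (\<lambda>_. x) p) p"
proof (rule path_hom_reparametrize[where F = p and u = "\<lambda>t. max 0 (2 * t - 1)" and v = "\<lambda>t. t"])
  show "loop_join (\<lambda>_. x) p s = p (max 0 (2 * s - 1))" if "s \<in> {0..1}" for s
  proof (cases "s \<le> 1/2")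
    case True
    then have "max 0 (2 * s - 1) = 0" by simp
    then show ?thesis using True assms by (simp add: loop_join_def)
  qed (simp add: loop_join_def)
qed (use assms in \<open>auto intro!: continuous_intros\<close>)

lemma path_hom_const_right:
  assumes "pathin X p" "p 0 = x" "p 1 = y"
  shows "path_hom X x y (loop_join p (\<lambda>_. y)) p"
proof (rule path_hom_reparametrize[where F = p and u = "\<lambda>t. min 1 (2 * t)" and v = "\<lambda>t. t"])
  show "loop_join p (\<lambda>_. y) s = p (min 1 (2 * s))" if "s \<in> {0..1}" for s
  proof (cases "s \<le> 1/2")
    case False
    then have "min 1 (2 * s) = 1" by simp
    then show ?thesis using False assms by (simp add: loop_join_def)
  qed (simp add: loop_join_def)
qed (use assms in \<open>auto intro!: continuous_intros\<close>)

lemma path_hom_rev_left: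
  assumes "pathin X p" "p 1 = y"
  shows "path_hom X y y (loop_join (path_rev p) p) (\<lambda>_. y)"
proof (rule path_hom_reparametrize[where F = p and u = "\<lambda>t. \<bar>2 * t - 1\<bar>" and v = "\<lambda>_. 1"])
  show "loop_join (path_rev p) p s = p \<bar>2 * s - 1\<bar>" if "s \<in> {0..1}" for s
  proof (cases "s \<le> 1/2")
    case True
    then have "\<bar>2 * s - 1\<bar> = 1 - 2 * s" by simp
    then show ?thesis using True by (simp add: loop_join_def path_rev_def)
  qed (simp add: loop_join_def)
qed (use assms in \<open>auto intro!: continuous_intros\<close>)

lemma path_rev_rev [simp]: "path_rev (path_rev p) = p"
  by (simp add: path_rev_def)

lemma path_hom_rev_right:
  assumes "pathin X p" "p 0 = x"
  shows "path_hom X x x (loop_join p (path_rev p)) (\<lambda>_. x)"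
  using path_hom_rev_left[OF pathin_rev[OF assms(1)], of x] assms(2) by simp

text \<open>The two ways around a square are homotopic because the square is convex. This is how a free
  homotopy yields a relation between classes of paths.\<close>

lemma path_hom_square:
  fixes h :: "real \<times> real \<Rightarrow> 'a"
  assumes h: "continuous_map unit_square X h"
  shows "path_hom X (h (0, 0)) (h (1, 1)) (loop_join (\<lambda>s. h (0, s)) (\<lambda>t. h (t, 1)))
    (loop_join (\<lambda>t. h (t, 0)) (\<lambda>s. h (1, s)))"
proof -
  let ?u = "\<lambda>s::real. (max 0 (2 * s - 1), min 1 (2 * s))"
  let ?v = "\<lambda>s::real. (min 1 (2 * s), max 0 (2 * s - 1))"
  let ?p = "loop_join (\<lambda>s. h (0, s)) (\<lambda>t. h (t, 1))"
  have "path_hom X (?p 0) (?p 1) ?p (loop_join (\<lambda>t. h (t, 0)) (\<lambda>s. h (1, s)))"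
  proof (rule path_hom_convex_image[where K = "{0..1} \<times> {0..1}" and F = h and u = ?u and v = ?v])
    show "continuous_map (top_of_set ({0..1} \<times> {0..1})) X h" using h by simp
    show "continuous_on {0..1} ?u" "continuous_on {0..1} ?v"
      by (intro continuous_intros)+
    show "?p s = h (?u s)" for s
      by (cases "s \<le> 1/2") (auto simp: loop_join_def)
    show "loop_join (\<lambda>t. h (t, 0)) (\<lambda>s. h (1, s)) s = h (?v s)" for s
      by (cases "s \<le> 1/2") (auto simp: loop_join_def)
  qed (auto intro!: convex_Times)
  then show ?thesis by simp
qed

definition path_part :: "(real \<Rightarrow> 'a) \<Rightarrow> real \<Rightarrow> real \<Rightarrow> real \<Rightarrow> 'a" where
  "path_part p a b = (\<lambda>s. p (a + s * (b - a)))"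

lemma path_part_ends [simp]: "path_part p a b 0 = p a" "path_part p a b 1 = p b"
  by (simp_all add: path_part_def)

lemma segment_in_unit_interval:
  assumes "0 \<le> a" "a \<le> b" "b \<le> 1" "s \<in> {0..1::real}"
  shows "a + s * (b - a) \<in> {a..b}" "a + s * (b - a) \<in> {0..1}"
proof -
  have "0 \<le> s * (b - a)" "s * (b - a) \<le> b - a"
    using assms by (auto intro!: mult_left_le_one_le)
  then show "a + s * (b - a) \<in> {a..b}" "a + s * (b - a) \<in> {0..1}" using assms by auto
qed

lemma pathin_part:
  assumes "pathin X p" "0 \<le> a" "a \<le> b" "b \<le> 1"
  shows "pathin X (path_part p a b)"
proof -
  have "pathin X (p \<circ> (\<lambda>s. a + s * (b - a)))"
    unfolding pathin_def using assms segment_in_unit_interval[of a b]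
    by (intro continuous_map_compose[of _ "top_of_set {0..1}"])
       (auto simp: pathin_def intro!: continuous_intros)
  then show ?thesis by (simp add: path_part_def o_def)
qed

lemma path_part_join:
  assumes p: "pathin X p" and c: "0 \<le> a" "a \<le> b" "b \<le> c" "c \<le> 1"
  shows "path_hom X (p a) (p c) (path_part p a c) (loop_join (path_part p a b) (path_part p b c))"
proof -
  let ?v = "\<lambda>s. a + min 1 (2 * s) * (b - a) + max 0 (2 * s - 1) * (c - b)"
  have v: "?v s \<in> {0..1}" if s: "s \<in> {0..1}" for s
  proof -
    have "min 1 (2 * s) * (b - a) \<le> b - a" "max 0 (2 * s - 1) * (c - b) \<le> c - b"
      "0 \<le> min 1 (2 * s) * (b - a)" "0 \<le> max 0 (2 * s - 1) * (c - b)"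
      using s c by (auto intro!: mult_left_le_one_le)
    then show ?thesis using c by auto
  qed
  show ?thesis
  proof (rule path_hom_reparametrize[where F = p and u = "\<lambda>s. a + s * (c - a)" and v = ?v])
    show "loop_join (path_part p a b) (path_part p b c) s = p (?v s)" for s
    proof (cases "s \<le> 1/2")
      case True
      then have "min 1 (2 * s) = 2 * s" "max 0 (2 * s - 1) = 0" by auto
      then show ?thesis using True by (simp only: loop_join_def path_part_def) simp
    next
      case False
      then have "min 1 (2 * s) = 1" "max 0 (2 * s - 1) = 2 * s - 1" by auto
      then show ?thesis using False by (simp only: loop_join_def path_part_def) simp
    qed
    show "continuous_on {0..1} ?v" by (intro continuous_intros)
    show "(\<lambda>s. a + s * (c - a)) ` {0..1} \<subseteq> {0..1}"
      using segment_in_unit_interval[of a c] c by auto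
    show "?v ` {0..1} \<subseteq> {0..1}" using v by blast
    show "continuous_on {0..1} (\<lambda>s. a + s * (c - a))" by (intro continuous_intros)
  qed (simp_all add: p path_part_def)
qed

definition loop_class :: "'a topology \<Rightarrow> 'a \<Rightarrow> (real \<Rightarrow> 'a) \<Rightarrow> (real \<Rightarrow> 'a) set" where
  "loop_class X x p = loop_homotopy X x `` {p}"

lemma carrier_fundamental_group: "carrier (fundamental_group X x) = loop_class X x ` loops X x"
  by (auto simp: fundamental_group_def quotient_def loop_class_def)

lemma fundamental_group_one: "\<one>\<^bsub>fundamental_group X x\<^esub> = loop_class X x (\<lambda>_. x)"
  by (simp add: fundamental_group_def loop_class_def)

lemma fundamental_group_mult:
  assumes "p \<in> loops X x" "q \<in> loops X x"
  shows "loop_class X x p \<otimes>\<^bsub>fundamental_group X x\<^esub> loop_class X x q = loop_class X x (loop_join p q)"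
proof -
  have "congruent2 (loop_homotopy X x) (loop_homotopy X x) (\<lambda>p q. loop_homotopy X x `` {loop_join p q})"
    by (auto simp: congruent2_def intro!: equiv_class_eq[OF equiv_loop_homotopy] loop_homotopy_join)
  from UN_equiv_class2[OF equiv_loop_homotopy equiv_loop_homotopy this assms]
  show ?thesis by (simp add: fundamental_group_def loop_class_def)
qed

lemma loop_class_eq_iff:
  assumes "p \<in> loops X x" "q \<in> loops X x"
  shows "loop_class X x p = loop_class X x q \<longleftrightarrow> path_hom X x x p q"
  unfolding loop_class_def using eq_equiv_class_iff[OF equiv_loop_homotopy assms]
  by (simp add: loop_homotopy_iff)

lemma loop_class_eqI: "path_hom X x x p q \<Longrightarrow> loop_class X x p = loop_class X x q"
  using loop_class_eq_iff[of p X x q] path_hom_imp[of X x x p q] by (simp add: loops_def)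

lemma loop_class_rep:
  assumes "p \<in> loops X x"
  shows "path_hom X x x p (SOME r. r \<in> loop_class X x p)"
proof -
  have "p \<in> loop_class X x p"
    using assms path_hom_refl[of X p x x] by (simp add: loop_class_def loop_homotopy_iff loops_def)
  then have "(SOME r. r \<in> loop_class X x p) \<in> loop_class X x p"
    by (rule someI[where P = "\<lambda>r. r \<in> loop_class X x p"])
  then show ?thesis by (simp add: loop_class_def loop_homotopy_iff)
qed

section \<open>Closing up paths along a tree\<close>

text \<open>A choice of a path \<open>T x\<close> from the base point to every point \<open>x\<close>, with no continuity in \<open>x\<close>.
  Closing up a path by these turns the fundamental groupoid into the fundamental group, and
  composition of paths into multiplication.\<close>

locale path_tree =
  fixes X :: "'a topology" and x0 :: 'a and T :: "'a \<Rightarrow> real \<Rightarrow> 'a"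
  assumes base: "x0 \<in> topspace X"
    and pathin_tree: "\<And>x. x \<in> topspace X \<Longrightarrow> pathin X (T x)"
    and tree_start: "\<And>x. x \<in> topspace X \<Longrightarrow> T x 0 = x0"
    and tree_end: "\<And>x. x \<in> topspace X \<Longrightarrow> T x 1 = x"
    and tree_base: "path_hom X x0 x0 (T x0) (\<lambda>_. x0)"
begin

abbreviation P :: "(real \<Rightarrow> 'a) set monoid" where "P \<equiv> fundamental_group X x0"

sublocale P: group P by (rule group_fundamental_group[OF base])

definition close_up :: "(real \<Rightarrow> 'a) \<Rightarrow> real \<Rightarrow> 'a" where
  "close_up p = loop_join (T (p 0)) (loop_join p (path_rev (T (p 1))))"

definition tree_class :: "(real \<Rightarrow> 'a) \<Rightarrow> (real \<Rightarrow> 'a) set" where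
  "tree_class p = loop_class X x0 (close_up p)"

lemma pathin_ends: "pathin X p \<Longrightarrow> p 0 \<in> topspace X \<and> p 1 \<in> topspace X"
  by (auto simp: pathin_def continuous_map_def Pi_iff)

lemma pathin_const: "x \<in> topspace X \<Longrightarrow> pathin X (\<lambda>_. x)"
  by (simp add: pathin_def)

lemmas path_facts = pathin_ends pathin_tree tree_start tree_end pathin_rev pathin_loop_join pathin_const

lemma close_up_loop: "pathin X p \<Longrightarrow> close_up p \<in> loops X x0"
  using pathin_ends[of p] by (auto simp: loops_def close_up_def path_facts)

lemma tree_class_closed: "pathin X p \<Longrightarrow> tree_class p \<in> carrier P"
  by (simp add: tree_class_def carrier_fundamental_group close_up_loop)

lemma tree_class_cong:
  assumes "path_hom X x y p q"
  shows "tree_class p = tree_class q"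
proof -
  note e = path_hom_imp[OF assms]
  have xy: "x \<in> topspace X" "y \<in> topspace X" using pathin_ends e by auto
  have "path_hom X x0 x0 (close_up p) (close_up q)"
    unfolding close_up_def e
    by (intro path_hom_join[of _ _ x] path_hom_join[of _ _ y] assms path_hom_refl)
       (auto simp: path_facts xy)
  then show ?thesis unfolding tree_class_def by (rule loop_class_eqI)
qed

text \<open>Between the two paths the tree path is run back and forth, which cancels.\<close>

lemma tree_class_join:
  assumes p: "pathin X p" and q: "pathin X q" and e: "p 1 = q 0"
  shows "tree_class (loop_join p q) = tree_class p \<otimes>\<^bsub>P\<^esub> tree_class q"
proof -
  define x y z where "x = p 0" "y = p 1" "z = q 1"
  have t: "x \<in> topspace X" "y \<in> topspace X" "z \<in> topspace X"
    using pathin_ends p q by (auto simp: x_y_z_def)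
  define a b b' c where "a = T x" "b = path_rev (T y)" "b' = T y" "c = path_rev (T z)"
  have ends: "a 0 = x0" "a 1 = x" "p 0 = x" "p 1 = y" "q 0 = y" "q 1 = z" "b 0 = y" "b 1 = x0"
    "b' 0 = x0" "b' 1 = y" "c 0 = z" "c 1 = x0"
    using e t by (auto simp: a_b_b'_c_def x_y_z_def path_facts)
  have pa: "pathin X a" "pathin X b" "pathin X b'" "pathin X c"
    using t by (auto simp: a_b_b'_c_def path_facts)
  note [simp] = ends pa p q
  have b: "path_hom X y y (loop_join b b') (\<lambda>_. y)"
    using path_hom_rev_left[of X "T y" y] t by (simp add: a_b_b'_c_def path_facts)
  let ?q = "loop_join q c"
  have "path_hom X y x0 (loop_join b (loop_join b' ?q)) (loop_join (loop_join b b') ?q)"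
    by (intro path_hom_sym[OF path_hom_assoc]) (auto intro!: pathin_loop_join)
  also have "path_hom X y x0 (loop_join (loop_join b b') ?q) (loop_join (\<lambda>_. y) ?q)"
    by (intro path_hom_join[OF b] path_hom_refl) (auto intro!: pathin_loop_join)
  also have "path_hom X y x0 (loop_join (\<lambda>_. y) ?q) ?q"
    by (intro path_hom_const_left) (auto intro!: pathin_loop_join)
  finally have 1: "path_hom X y x0 (loop_join b (loop_join b' ?q)) ?q" .
  have "path_hom X x x0 (loop_join (loop_join p b) (loop_join b' ?q))
     (loop_join p (loop_join b (loop_join b' ?q)))"
    by (intro path_hom_assoc) (auto intro!: pathin_loop_join)
  also have "path_hom X x x0 (loop_join p (loop_join b (loop_join b' ?q))) (loop_join p ?q)"
    by (intro path_hom_join[OF path_hom_refl 1]) auto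
  also have "path_hom X x x0 (loop_join p ?q) (loop_join (loop_join p q) c)"
    by (intro path_hom_sym[OF path_hom_assoc]) auto
  finally have 2: "path_hom X x x0 (loop_join (loop_join p b) (loop_join b' ?q))
     (loop_join (loop_join p q) c)" .
  have "path_hom X x0 x0 (loop_join (loop_join a (loop_join p b)) (loop_join b' ?q))
    (loop_join a (loop_join (loop_join p b) (loop_join b' ?q)))"
    by (intro path_hom_assoc) (auto intro!: pathin_loop_join)
  also have "path_hom X x0 x0 (loop_join a (loop_join (loop_join p b) (loop_join b' ?q)))
    (loop_join a (loop_join (loop_join p q) c))"
    by (intro path_hom_join[OF path_hom_refl 2]) auto
  finally have "path_hom X x0 x0 (loop_join (close_up p) (close_up q)) (close_up (loop_join p q))"
    unfolding close_up_def by (simp only: a_b_b'_c_def x_y_z_def e loop_join_ends)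
  then show ?thesis
    unfolding tree_class_def by (simp add: fundamental_group_mult close_up_loop loop_class_eqI)
qed

lemma tree_class_const:
  assumes x: "x \<in> topspace X"
  shows "tree_class (\<lambda>_. x) = \<one>\<^bsub>P\<^esub>"
proof -
  have "path_hom X x x (loop_join (\<lambda>_. x) (\<lambda>_. x)) (\<lambda>_. x)"
    by (intro path_hom_const_left) (auto simp: path_facts x)
  then have "tree_class (\<lambda>_. x) = tree_class (\<lambda>_. x) \<otimes>\<^bsub>P\<^esub> tree_class (\<lambda>_. x)"
    using tree_class_join[of "\<lambda>_. x" "\<lambda>_. x"] x by (simp add: path_facts tree_class_cong)
  then show ?thesis using tree_class_closed[OF pathin_const[OF x]] P.l_cancel_one' by metis
qed

lemma tree_class_rev:
  assumes p: "pathin X p"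
  shows "tree_class (path_rev p) = inv\<^bsub>P\<^esub> tree_class p"
proof -
  have "tree_class (path_rev p) \<otimes>\<^bsub>P\<^esub> tree_class p = tree_class (loop_join (path_rev p) p)"
    by (rule tree_class_join[symmetric]) (auto simp: path_facts p)
  also have "\<dots> = tree_class (\<lambda>_. p 1)" by (rule tree_class_cong[OF path_hom_rev_left]) (auto simp: p)
  also have "\<dots> = \<one>\<^bsub>P\<^esub>" using p by (simp add: tree_class_const pathin_ends)
  finally show ?thesis by (simp add: P.inv_equality tree_class_closed p pathin_rev)
qed

lemma tree_class_loop:
  assumes p: "p \<in> loops X x0"
  shows "tree_class p = loop_class X x0 p"
proof -
  have e: "pathin X p" "p 0 = x0" "p 1 = x0" using p by (auto simp: loops_def)
  have [simp]: "pathin X (\<lambda>_. x0)" by (simp add: path_facts base)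
  have r: "path_hom X x0 x0 (path_rev (T x0)) (\<lambda>_. x0)"
  proof -
    have "path_hom X x0 x0 (path_rev (T x0)) (loop_join (path_rev (T x0)) (\<lambda>_. x0))"
      by (intro path_hom_sym[OF path_hom_const_right]) (auto simp: path_facts base)
    also have "path_hom X x0 x0 \<dots> (loop_join (path_rev (T x0)) (T x0))"
      by (intro path_hom_join[OF path_hom_refl path_hom_sym[OF tree_base]]) (auto simp: path_facts base)
    also have "path_hom X x0 x0 \<dots> (\<lambda>_. x0)"
      by (intro path_hom_rev_left) (auto simp: path_facts base)
    finally show ?thesis .
  qed
  have "path_hom X x0 x0 (close_up p) (loop_join (\<lambda>_. x0) (loop_join p (\<lambda>_. x0)))"
    unfolding close_up_def e(2,3)
    by (intro path_hom_join[OF tree_base] path_hom_join[OF path_hom_refl r] e)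
  also have "path_hom X x0 x0 \<dots> (loop_join p (\<lambda>_. x0))"
    by (intro path_hom_const_left) (auto simp: e base intro!: pathin_loop_join)
  also have "path_hom X x0 x0 \<dots> p"
    by (intro path_hom_const_right e)
  finally show ?thesis unfolding tree_class_def by (rule loop_class_eqI)
qed

lemma tree_class_tree:
  assumes x: "x \<in> topspace X"
  shows "tree_class (T x) = \<one>\<^bsub>P\<^esub>"
proof -
  have "path_hom X x0 x0 (close_up (T x)) (loop_join (\<lambda>_. x0) (\<lambda>_. x0))"
    unfolding close_up_def tree_start[OF x] tree_end[OF x]
    by (intro path_hom_join[OF tree_base] path_hom_rev_right pathin_tree tree_start x)
  also have "path_hom X x0 x0 \<dots> (\<lambda>_. x0)"
    by (intro path_hom_const_left) (auto simp: path_facts base)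
  finally show ?thesis unfolding tree_class_def fundamental_group_one by (rule loop_class_eqI)
qed

text \<open>A path can be recovered, up to homotopy, from its closure by undoing the two added tree
  paths.\<close>

lemma tree_class_inject:
  assumes p: "pathin X p" "p 0 = x" "p 1 = y" and q: "pathin X q" "q 0 = x" "q 1 = y"
    and e: "tree_class p = tree_class q"
  shows "path_hom X x y p q"
proof -
  have t: "x \<in> topspace X" "y \<in> topspace X" using pathin_ends p by auto
  have undo: "path_hom X x y (loop_join (path_rev (T x)) (loop_join (close_up r) (T y))) r"
    if r: "pathin X r" "r 0 = x" "r 1 = y" for r
  proof -
    let ?a = "T x" and ?b = "T y"
    note [simp] = r t path_facts
    have "path_hom X x y (loop_join (path_rev ?a) (loop_join (close_up r) ?b))
       (loop_join (path_rev ?a) (loop_join ?a (loop_join (loop_join r (path_rev ?b)) ?b)))"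
      unfolding close_up_def r by (intro path_hom_join[of _ _ x0] path_hom_assoc path_hom_refl) auto
    also have "path_hom X x y \<dots> (loop_join (loop_join (path_rev ?a) ?a) (loop_join (loop_join r (path_rev ?b)) ?b))"
      by (intro path_hom_sym[OF path_hom_assoc]) auto
    also have "path_hom X x y \<dots> (loop_join (\<lambda>_. x) (loop_join r (loop_join (path_rev ?b) ?b)))"
      by (intro path_hom_join[of _ _ x] path_hom_assoc path_hom_rev_left) auto
    also have "path_hom X x y \<dots> (loop_join r (loop_join (path_rev ?b) ?b))"
      by (intro path_hom_const_left) auto
    also have "path_hom X x y \<dots> (loop_join r (\<lambda>_. y))"
      by (intro path_hom_join[of _ _ y] path_hom_refl path_hom_rev_left) auto
    also have "path_hom X x y \<dots> r"
      by (intro path_hom_const_right) auto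
    finally show ?thesis .
  qed
  have "path_hom X x0 x0 (close_up p) (close_up q)"
    using e loop_class_eq_iff[OF close_up_loop close_up_loop] p q by (simp add: tree_class_def)
  then have "path_hom X x y (loop_join (path_rev (T x)) (loop_join (close_up p) (T y)))
    (loop_join (path_rev (T x)) (loop_join (close_up q) (T y)))"
    by (intro path_hom_join[of _ _ x0] path_hom_refl) (auto simp: path_facts t)
  then show ?thesis
    using undo[OF p] undo[OF q] by (meson path_hom_sym path_hom_trans)
qed

lemma fundamental_group_base_change:
  assumes x: "x \<in> topspace X"
  shows "fundamental_group X x \<cong> P"
proof -
  define h where "h C = tree_class (SOME p. p \<in> C)" for C
  have h: "h (loop_class X x p) = tree_class p" if "p \<in> loops X x" for p
    using tree_class_cong[OF loop_class_rep[OF that]] by (simp add: h_def)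
  have L: "pathin X p" "p 0 = x" "p 1 = x" if "p \<in> loops X x" for p
    using that by (auto simp: loops_def)
  have hc: "h a \<in> carrier P" if a: "a \<in> carrier (fundamental_group X x)" for a
  proof -
    obtain p where p: "a = loop_class X x p" "p \<in> loops X x"
      using a unfolding carrier_fundamental_group by blast
    show ?thesis using h[OF p(2)] tree_class_closed[OF L(1)[OF p(2)]] by (simp add: p)
  qed
  have "h \<in> iso (fundamental_group X x) P"
  proof (rule isoI)
    show "h \<in> hom (fundamental_group X x) P"
    proof (rule homI)
      fix a b assume "a \<in> carrier (fundamental_group X x)" "b \<in> carrier (fundamental_group X x)"
      then show "h (a \<otimes>\<^bsub>fundamental_group X x\<^esub> b) = h a \<otimes>\<^bsub>P\<^esub> h b"
        by (auto simp: carrier_fundamental_group fundamental_group_mult h loop_join_closed tree_class_join L)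
    qed (rule hc)
    show "bij_betw h (carrier (fundamental_group X x)) (carrier P)"
    proof (rule bij_betwI')
      fix a b assume "a \<in> carrier (fundamental_group X x)" "b \<in> carrier (fundamental_group X x)"
      then obtain p q where pq: "a = loop_class X x p" "p \<in> loops X x" "b = loop_class X x q" "q \<in> loops X x"
        by (auto simp: carrier_fundamental_group)
      then show "(h a = h b) = (a = b)"
        using tree_class_inject[OF L[OF pq(2)] L[OF pq(4)]] tree_class_cong[of x x p q]
          loop_class_eq_iff[OF pq(2) pq(4)] by (simp only: pq h) blast
    next
      fix c assume "c \<in> carrier P"
      then obtain p where p: "c = loop_class X x0 p" "p \<in> loops X x0"
        by (auto simp: carrier_fundamental_group)
      have p': "pathin X p" "p 0 = x0" "p 1 = x0" using p(2) by (auto simp: loops_def)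
      let ?q = "loop_join (path_rev (T x)) (loop_join p (T x))"
      have q: "?q \<in> loops X x"
        unfolding loops_def using p' x by (auto simp: path_facts)
      have "tree_class ?q = tree_class p"
        using p' x by (simp add: tree_class_join path_facts tree_class_rev tree_class_tree tree_class_closed)
      then have "h (loop_class X x ?q) = c" using h[OF q] tree_class_loop p by simp
      then show "\<exists>a\<in>carrier (fundamental_group X x). c = h a"
        using q by (auto simp: carrier_fundamental_group)
    qed (rule hc)
  qed
  then show ?thesis by (auto simp: is_iso_def)
qed

end

section \<open>Holonomy of a local system\<close>

text \<open>Read \<open>f i\<close> as a section over \<open>U i\<close> of a covering with fibre \<open>G\<close>, on which \<open>G\<close> acts by left
  multiplication, written in a discontinuous global trivialisation. The last assumption says that
  any two sections differ, locally, by left multiplication with a constant, so that they define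
  the same covering space.\<close>

locale local_system = G: group G for G :: "('g, 'm) monoid_scheme" (structure) +
  fixes X :: "'a topology" and I :: "'i set" and U :: "'i \<Rightarrow> 'a set" and f :: "'i \<Rightarrow> 'a \<Rightarrow> 'g"
  assumes open_patch: "\<And>i. i \<in> I \<Longrightarrow> openin X (U i)"
    and cover: "\<And>x. x \<in> topspace X \<Longrightarrow> \<exists>i\<in>I. x \<in> U i"
    and section_closed: "\<And>i x. i \<in> I \<Longrightarrow> x \<in> U i \<Longrightarrow> f i x \<in> carrier G"
    and transition: "\<And>i j x. i \<in> I \<Longrightarrow> j \<in> I \<Longrightarrow> x \<in> U i \<Longrightarrow> x \<in> U j \<Longrightarrow>
      \<exists>W. openin X W \<and> x \<in> W \<and> (\<forall>y\<in>W. y \<in> U i \<and> y \<in> U j \<and>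
        f i y \<otimes> inv f j y = f i x \<otimes> inv f j x)"
begin

text \<open>\<open>l\<close> describes a continuous lift of \<open>F\<close> to the covering space: it differs from each section
  by left multiplication with a locally constant element.\<close>

definition lift :: "('t::metric_space) set \<Rightarrow> ('t \<Rightarrow> 'a) \<Rightarrow> ('t \<Rightarrow> 'g) \<Rightarrow> bool" where
  "lift T F l \<longleftrightarrow> l ` T \<subseteq> carrier G \<and>
     (\<forall>p\<in>T. \<forall>i\<in>I. F p \<in> U i \<longrightarrow>
        (\<forall>\<^sub>F q in at p within T. F q \<in> U i \<and> l q \<otimes> inv f i (F q) = l p \<otimes> inv f i (F p)))"

lemma liftI:
  assumes "\<And>p. p \<in> T \<Longrightarrow> l p \<in> carrier G"
    and "\<And>p i. p \<in> T \<Longrightarrow> i \<in> I \<Longrightarrow> F p \<in> U i \<Longrightarrow>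
      (\<forall>\<^sub>F q in at p within T. F q \<in> U i \<and> l q \<otimes> inv f i (F q) = l p \<otimes> inv f i (F p))"
  shows "lift T F l"
  using assms by (auto simp: lift_def)

lemma lift_closed: "lift T F l \<Longrightarrow> p \<in> T \<Longrightarrow> l p \<in> carrier G"
  by (auto simp: lift_def)

lemma liftD:
  "lift T F l \<Longrightarrow> p \<in> T \<Longrightarrow> i \<in> I \<Longrightarrow> F p \<in> U i \<Longrightarrow>
     (\<forall>\<^sub>F q in at p within T. F q \<in> U i \<and> l q \<otimes> inv f i (F q) = l p \<otimes> inv f i (F p))"
  by (auto simp: lift_def)

lemma eventually_preimage:
  assumes F: "continuous_map (top_of_set T) X F" and W: "openin X W" and p: "p \<in> T" "F p \<in> W"
  shows "\<forall>\<^sub>F q in at p within T. F q \<in> W"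
proof -
  have "openin (top_of_set T) {q \<in> T. F q \<in> W}"
    using openin_continuous_map_preimage[OF F W] by simp
  then obtain O' where "open O'" "{q \<in> T. F q \<in> W} = T \<inter> O'" by (auto simp: openin_open)
  then show ?thesis using p unfolding eventually_at_topological by blast
qed

lemma lift_local:
  assumes F: "continuous_map (top_of_set T) X F" and i: "i \<in> I" "F ` T \<subseteq> U i"
  shows "lift T F (\<lambda>q. f i (F q))"
proof (rule liftI)
  fix p j assume p: "p \<in> T" "j \<in> I" "F p \<in> U j"
  then obtain W where W: "openin X W" "F p \<in> W"
    "\<forall>y\<in>W. y \<in> U i \<and> y \<in> U j \<and> f i y \<otimes> inv f j y = f i (F p) \<otimes> inv f j (F p)"
    using transition[of i j "F p"] i by blast
  show "\<forall>\<^sub>F q in at p within T. F q \<in> U j \<and> f i (F q) \<otimes> inv f j (F q) = f i (F p) \<otimes> inv f j (F p)"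
    using eventually_preimage[OF F W(1) p(1) W(2)] by eventually_elim (use W(3) in blast)
qed (use i in \<open>auto intro!: section_closed\<close>)

lemma lift_translate:
  assumes l: "lift T F l" and g: "g \<in> carrier G"
  shows "lift T F (\<lambda>q. g \<otimes> l q)"
proof (rule liftI)
  fix p i assume p: "p \<in> T" "i \<in> I" "F p \<in> U i"
  show "\<forall>\<^sub>F q in at p within T. F q \<in> U i \<and>
      (g \<otimes> l q) \<otimes> inv f i (F q) = (g \<otimes> l p) \<otimes> inv f i (F p)"
  proof (rule eventually_elim2[OF liftD[OF l p]])
    show "\<forall>\<^sub>F q in at p within T. q \<in> T" by (simp add: eventually_at_filter)
  next
    fix q assume "F q \<in> U i \<and> l q \<otimes> inv f i (F q) = l p \<otimes> inv f i (F p)" "q \<in> T"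
    then show "F q \<in> U i \<and> (g \<otimes> l q) \<otimes> inv f i (F q) = (g \<otimes> l p) \<otimes> inv f i (F p)"
      using p g lift_closed[OF l] by (simp add: G.m_assoc section_closed)
  qed
qed (use g lift_closed[OF l] in auto)

lemma lift_compose:
  assumes l: "lift T F l" and u: "continuous_on S u" "u ` S \<subseteq> T"
  shows "lift S (F \<circ> u) (l \<circ> u)"
proof (rule liftI)
  fix p i assume p: "p \<in> S" "i \<in> I" "(F \<circ> u) p \<in> U i"
  let ?Q = "\<lambda>q. F q \<in> U i \<and> l q \<otimes> inv f i (F q) = l (u p) \<otimes> inv f i (F (u p))"
  have "\<forall>\<^sub>F q in at (u p) within T. ?Q q"
    using liftD[OF l, of "u p" i] p u by auto
  then obtain O' where O': "open O'" "u p \<in> O'" "\<forall>q\<in>O'. q \<noteq> u p \<longrightarrow> q \<in> T \<longrightarrow> ?Q q"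
    by (auto simp: eventually_at_topological)
  have Q: "?Q q" if "q \<in> O'" "q \<in> T" for q
    using that O' p by (cases "q = u p") auto
  have "(u \<longlongrightarrow> u p) (at p within S)" using u(1) p by (auto simp: continuous_on_def)
  then have "\<forall>\<^sub>F q in at p within S. u q \<in> O'" using O' by (auto dest: topological_tendstoD)
  moreover have "\<forall>\<^sub>F q in at p within S. q \<in> S" by (simp add: eventually_at_filter)
  ultimately show "\<forall>\<^sub>F q in at p within S. (F \<circ> u) q \<in> U i \<and>
      (l \<circ> u) q \<otimes> inv f i ((F \<circ> u) q) = (l \<circ> u) p \<otimes> inv f i ((F \<circ> u) p)"
    by eventually_elim (use Q u(2) in auto)
qed (use u lift_closed[OF l] in auto)

lemma lift_subset: "lift T F l \<Longrightarrow> S \<subseteq> T \<Longrightarrow> lift S F l"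
  using lift_compose[of T F l S id] by (auto simp: o_def)

text \<open>The quotient of two lifts is locally constant, as both have a locally constant quotient with
  the same section.\<close>

lemma lift_unique:
  assumes l: "lift T F l" and m: "lift T F m" and T: "connected T"
    and F: "F ` T \<subseteq> topspace X" and pq: "p \<in> T" "q \<in> T"
  shows "l p \<otimes> inv m p = l q \<otimes> inv m q"
proof (rule connected_local_const[OF T pq, of "\<lambda>p. l p \<otimes> inv m p"])
  show "\<forall>a\<in>T. \<forall>\<^sub>F b in at a within T. l a \<otimes> inv m a = l b \<otimes> inv m b"
  proof
    fix a assume a: "a \<in> T"
    then obtain i where i: "i \<in> I" "F a \<in> U i" using cover F by blast
    have "\<forall>\<^sub>F b in at a within T. b \<in> T" by (simp add: eventually_at_filter)
    with liftD[OF l a i] liftD[OF m a i]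
    show "\<forall>\<^sub>F b in at a within T. l a \<otimes> inv m a = l b \<otimes> inv m b"
    proof eventually_elim
      case (elim b)
      have c: "l a \<in> carrier G" "m a \<in> carrier G" "l b \<in> carrier G" "m b \<in> carrier G"
        "f i (F a) \<in> carrier G" "f i (F b) \<in> carrier G"
        using lift_closed[OF l] lift_closed[OF m] a i elim section_closed by auto
      have x: "x \<otimes> inv y = (x \<otimes> inv z) \<otimes> inv (y \<otimes> inv z)"
        if "x \<in> carrier G" "y \<in> carrier G" "z \<in> carrier G" for x y z
        using that by (simp add: G.inv_mult_group G.m_assoc G.inv_solve_left)
      show ?case using x[of "l a" "m a" "f i (F a)"] x[of "l b" "m b" "f i (F b)"] c elim by simp
    qed
  qed
qed

text \<open>After left multiplication with a constant the two lifts agree at one point of the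
  intersection, and then by uniqueness on all of it.\<close>

lemma lift_Un:
  assumes l: "lift S F l" and m: "lift T F m" and cl: "closed S" "closed T"
    and conn: "connected (S \<inter> T)" and F: "F ` (S \<union> T) \<subseteq> topspace X"
  shows "\<exists>k. lift (S \<union> T) F k"
proof -
  obtain m' where m': "lift T F m'" and eq: "\<And>p. p \<in> S \<Longrightarrow> p \<in> T \<Longrightarrow> m' p = l p"
  proof (cases "S \<inter> T = {}")
    case False
    then obtain p where p: "p \<in> S" "p \<in> T" by blast
    define g where "g = l p \<otimes> inv m p"
    have c: "l q \<in> carrier G" "m q \<in> carrier G" if "q \<in> S" "q \<in> T" for q
      using lift_closed[OF l] lift_closed[OF m] that by auto
    have g: "g \<in> carrier G" using c p by (simp add: g_def)
    have "g \<otimes> m q = l q" if q: "q \<in> S" "q \<in> T" for q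
    proof -
      have "g = l q \<otimes> inv m q"
        unfolding g_def
      proof (rule lift_unique[OF _ _ conn])
        show "lift (S \<inter> T) F l" "lift (S \<inter> T) F m" using lift_subset l m by blast+
      qed (use F p q in auto)
      then show ?thesis using c[OF q] by (simp add: G.m_assoc)
    qed
    then show thesis using that lift_translate[OF m g] by blast
  qed (use that[OF m] in blast)
  let ?k = "\<lambda>p. if p \<in> S then l p else m' p"
  have "lift (S \<union> T) F ?k"
  proof (rule liftI)
    fix p i assume p: "p \<in> S \<union> T" "i \<in> I" "F p \<in> U i"
    let ?Q = "\<lambda>q. F q \<in> U i \<and> ?k q \<otimes> inv f i (F q) = ?k p \<otimes> inv f i (F p)"
    have 1: "\<forall>\<^sub>F q in at p within S. ?Q q"
    proof (cases "p \<in> S")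
      case True
      have "\<forall>\<^sub>F b in at p within S. b \<in> S" by (simp add: eventually_at_filter)
      with liftD[OF l True p(2,3)] show ?thesis by eventually_elim (use True in auto)
    next
      case False
      then have "at p within S = bot" using cl(1) closed_limpt trivial_limit_within by blast
      then show ?thesis by simp
    qed
    have 2: "\<forall>\<^sub>F q in at p within T. ?Q q"
    proof (cases "p \<in> T")
      case True
      have "\<forall>\<^sub>F b in at p within T. b \<in> T" by (simp add: eventually_at_filter)
      with liftD[OF m' True p(2,3)] show ?thesis by eventually_elim (use True eq in auto)
    next
      case False
      then have "at p within T = bot" using cl(2) closed_limpt trivial_limit_within by blast
      then show ?thesis by simp
    qed
    show "\<forall>\<^sub>F q in at p within S \<union> T. ?Q q"
      unfolding at_within_union eventually_sup using 1 2 by blast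
  qed (use lift_closed[OF l] lift_closed[OF m'] in auto)
  then show ?thesis by blast
qed

text \<open>A Lebesgue number argument in two stages: a short vertical strip is assembled from small
  squares, each inside a single \<open>U i\<close>, and the rectangle is assembled from such strips.\<close>

lemma lift_rectangle:
  fixes F :: "real \<times> real \<Rightarrow> 'a"
  assumes F: "continuous_map euclidean X F" and ab: "a \<le> b" and cd: "c \<le> d"
  shows "\<exists>l. lift ({a..b} \<times> {c..d}) F l"
proof (rule Bolzano[OF ab, of "\<lambda>a b. \<exists>l. lift ({a..b} \<times> {c..d}) F l"])
  have F': "F ` S \<subseteq> topspace X" for S using F by (auto simp: continuous_map_def)
  have FT: "continuous_map (top_of_set T) X F" for T
    using F by (rule continuous_map_from_subtopology)
  fix a b b' assume "\<exists>l. lift ({a..b} \<times> {c..d}) F l" "\<exists>l. lift ({b..b'} \<times> {c..d}) F l"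
    and le: "a \<le> b" "b \<le> b'"
  then have "\<exists>l. lift ({a..b} \<times> {c..d} \<union> {b..b'} \<times> {c..d}) F l"
  proof (elim exE, intro lift_Un F')
    have "{a..b} \<times> {c..d} \<inter> {b..b'} \<times> {c..d} = {b} \<times> {c..d}" using le by auto
    then show "connected ({a..b} \<times> {c..d} \<inter> {b..b'} \<times> {c..d})"
      by (simp add: connected_Times)
  qed (auto intro: closed_Times)
  then show "\<exists>l. lift ({a..b'} \<times> {c..d}) F l"
    using ivl_disj_un_two_touch(4)[OF le] by (simp add: Sigma_Un_distrib1[symmetric])
next
  have F': "F ` S \<subseteq> topspace X" for S using F by (auto simp: continuous_map_def)
  have FT: "continuous_map (top_of_set T) X F" for T
    using F by (rule continuous_map_from_subtopology)
  fix x
  let ?L = "\<lambda>c d e. \<forall>a b. a \<le> x \<and> x \<le> b \<and> b - a < e \<longrightarrow> (\<exists>l. lift ({a..b} \<times> {c..d}) F l)"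
  show "\<exists>e>0. ?L c d e"
  proof (rule Bolzano[OF cd, of "\<lambda>c d. \<exists>e>0. ?L c d e"])
    fix c d d' assume "\<exists>e>0. ?L c d e" "\<exists>e>0. ?L d d' e" and le: "c \<le> d" "d \<le> d'"
    then obtain e e' where e: "0 < e" "?L c d e" "0 < e'" "?L d d' e'" by blast
    have "?L c d' (min e e')"
    proof (intro allI impI)
      fix a b assume "a \<le> x \<and> x \<le> b \<and> b - a < min e e'"
      then obtain l m where lm: "lift ({a..b} \<times> {c..d}) F l" "lift ({a..b} \<times> {d..d'}) F m"
        using e(2,4) by (metis min_less_iff_conj)
      have "\<exists>l. lift ({a..b} \<times> {c..d} \<union> {a..b} \<times> {d..d'}) F l"
      proof (rule lift_Un[OF lm])
        have "{a..b} \<times> {c..d} \<inter> {a..b} \<times> {d..d'} = {a..b} \<times> {d}" using le by auto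
        then show "connected ({a..b} \<times> {c..d} \<inter> {a..b} \<times> {d..d'})"
          by (simp add: connected_Times)
        show "F ` ({a..b} \<times> {c..d} \<union> {a..b} \<times> {d..d'}) \<subseteq> topspace X" by (rule F')
      qed (auto intro: closed_Times)
      then show "\<exists>l. lift ({a..b} \<times> {c..d'}) F l"
        using ivl_disj_un_two_touch(4)[OF le] by (simp add: Sigma_Un_distrib2[symmetric])
    qed
    then show "\<exists>e>0. ?L c d' e" using e by (intro exI[of _ "min e e'"]) auto
  next
    fix y
    obtain i where i: "i \<in> I" "F (x, y) \<in> U i" using cover F'[of UNIV] by blast
    have "open {p. F p \<in> U i}"
      using openin_continuous_map_preimage[OF F open_patch[OF i(1)]] by simp
    then obtain A B where AB: "open A" "open B" "(x, y) \<in> A \<times> B" "A \<times> B \<subseteq> {p. F p \<in> U i}"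
      using i by (elim open_prod_elim[of _ "(x, y)"]) auto
    then have "x \<in> A" "y \<in> B" by auto
    then obtain e e' where e: "0 < e" "ball x e \<subseteq> A" "0 < e'" "ball y e' \<subseteq> B"
      using AB(1,2) by (metis openE)
    have "\<exists>l. lift ({a..b} \<times> {c..d}) F l" if "a \<le> x" "x \<le> b" "b - a < e" "c \<le> y" "y \<le> d" "d - c < e'" for a b c d
    proof -
      have "{a..b} \<subseteq> ball x e" "{c..d} \<subseteq> ball y e'" using that by (auto simp: dist_real_def)
      then have "F ` ({a..b} \<times> {c..d}) \<subseteq> U i" using e AB by blast
      then show ?thesis using lift_local[OF FT i(1)] by blast
    qed
    then show "\<exists>e'>0. \<forall>c d. c \<le> y \<and> y \<le> d \<and> d - c < e' \<longrightarrow> (\<exists>e>0. ?L c d e)"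
      using e by blast
  qed
qed

lemma lift_unit_square:
  assumes F: "continuous_map unit_square X F"
  shows "\<exists>l. lift ({0..1} \<times> {0..1}) F l"
proof -
  \<comment> \<open>The retraction onto the square extends the map to the plane.\<close>
  let ?r = "\<lambda>t::real. max 0 (min 1 t)"
  let ?F = "F \<circ> (\<lambda>p. (?r (fst p), ?r (snd p)))"
  have "continuous_map euclidean X ?F"
  proof (rule continuous_map_compose[OF _ F])
    show "continuous_map euclidean unit_square (\<lambda>p::real\<times>real. (?r (fst p), ?r (snd p)))"
      by (auto simp: continuous_map_in_subtopology intro!: continuous_intros)
  qed
  then obtain l where l: "lift ({0..1} \<times> {0..1}) ?F l" using lift_rectangle[of ?F 0 1 0 1] by auto
  have "lift ({0..1} \<times> {0..1}) F l"
  proof (rule liftI)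
    fix p i assume p: "p \<in> {0..1} \<times> {0..1}" "i \<in> I" "F p \<in> U i"
    have e: "?F q = F q" if "q \<in> {0..1} \<times> {0..1}" for q using that by (cases q) auto
    have "\<forall>\<^sub>F b in at p within {0..1} \<times> {0..1}. b \<in> {0..1} \<times> {0..1}"
      by (simp add: eventually_at_filter)
    moreover have "?F p \<in> U i" using p e by simp
    from liftD[OF l p(1,2) this]
    have "\<forall>\<^sub>F q in at p within {0..1} \<times> {0..1}. ?F q \<in> U i \<and> l q \<otimes> inv f i (?F q) = l p \<otimes> inv f i (F p)"
      by (simp only: e[OF p(1)])
    ultimately show "\<forall>\<^sub>F q in at p within {0..1} \<times> {0..1}. F q \<in> U i \<and> l q \<otimes> inv f i (F q) = l p \<otimes> inv f i (F p)"
      by eventually_elim (simp only: e)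
  qed (use lift_closed[OF l] in blast)
  then show ?thesis by blast
qed

lemma lift_path:
  assumes p: "pathin X p"
  shows "\<exists>l. lift {0..1} p l"
proof -
  have "continuous_map unit_square X (p \<circ> snd)"
    by (rule continuous_map_compose[OF continuous_map_snd p[unfolded pathin_def]])
  from lift_unit_square[OF this] obtain l where l: "lift ({0..1::real} \<times> {0..1}) (p \<circ> snd) l" by blast
  have "lift {0..1} ((p \<circ> snd) \<circ> (\<lambda>t. (0::real, t))) (l \<circ> (\<lambda>t. (0, t)))"
    by (rule lift_compose[OF l]) (auto intro!: continuous_intros)
  then show ?thesis by (auto simp: o_def)
qed

text \<open>Independent of the lift: two lifts differ by a constant on the left, which cancels.\<close>

definition holonomy :: "(real \<Rightarrow> 'a) \<Rightarrow> 'g" where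
  "holonomy p = (SOME g. \<exists>l. lift {0..1} p l \<and> g = inv l 0 \<otimes> l 1)"

lemma holonomy_eq:
  assumes p: "pathin X p" and l: "lift {0..1} p l"
  shows "holonomy p = inv l 0 \<otimes> l 1"
proof -
  have "\<exists>m. lift {0..1} p m \<and> holonomy p = inv m 0 \<otimes> m 1"
    unfolding holonomy_def by (rule someI_ex) (use l in blast)
  then obtain m where m: "lift {0..1} p m" "holonomy p = inv m 0 \<otimes> m 1" by blast
  have "p ` {0..1} \<subseteq> topspace X" using p by (auto simp: pathin_def continuous_map_def)
  then have e: "l 0 \<otimes> inv m 0 = l 1 \<otimes> inv m 1"
    by (intro lift_unique[OF l m(1)]) auto
  have c: "l 0 \<in> carrier G" "m 0 \<in> carrier G" "l 1 \<in> carrier G" "m 1 \<in> carrier G"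
    using lift_closed[OF l] lift_closed[OF m(1)] by auto
  have "inv m 0 = inv l 0 \<otimes> (l 0 \<otimes> inv m 0)" using c by (simp add: G.m_assoc[symmetric])
  also have "\<dots> = inv l 0 \<otimes> l 1 \<otimes> inv m 1" using c by (simp add: e G.m_assoc)
  finally have "inv m 0 \<otimes> m 1 = inv l 0 \<otimes> l 1" using c by (simp add: G.m_assoc)
  then show ?thesis using m by simp
qed

lemma holonomy_closed: "pathin X p \<Longrightarrow> holonomy p \<in> carrier G"
  using lift_path[of p] holonomy_eq lift_closed by fastforce

lemma holonomy_const:
  assumes "x \<in> topspace X"
  shows "holonomy (\<lambda>_. x) = \<one>"
proof -
  obtain l where l: "lift {0..1::real} (\<lambda>_. x) l" using lift_path[of "\<lambda>_. x"] assms by (auto simp: pathin_def)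
  obtain i where i: "i \<in> I" "x \<in> U i" using cover assms by blast
  have c: "l t \<in> carrier G" if "t \<in> {0..1}" for t using lift_closed[OF l that] .
  have m: "lift {0..1::real} (\<lambda>_. x) (\<lambda>_. f i x)"
    using assms i by (intro lift_local) auto
  show ?thesis using holonomy_eq[OF _ m] assms i section_closed by (simp add: pathin_def)
qed

text \<open>Lift the whole homotopy. Along the two edges of the square that are mapped to a single point
  a lift is constant, so the lifts of the two paths have equal ends.\<close>

lemma holonomy_cong:
  assumes "path_hom X x y p q"
  shows "holonomy p = holonomy q"
proof -
  obtain h where h: "continuous_map unit_square X h"
    "\<And>s. h (0, s) = p s" "\<And>s. h (1, s) = q s"
    "\<And>t. t \<in> {0..1} \<Longrightarrow> h (t, 0) = x" "\<And>t. t \<in> {0..1} \<Longrightarrow> h (t, 1) = y"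
    using path_homE[OF assms] by metis
  note e = path_hom_imp[OF assms]
  have xy: "x \<in> topspace X" "y \<in> topspace X"
    using e by (auto simp: pathin_def continuous_map_def Pi_iff)
  obtain l where l: "lift ({0..1} \<times> {0..1}) h l" using lift_unit_square[OF h(1)] by blast
  have c: "l p \<in> carrier G" if "p \<in> {0..1} \<times> {0..1}" for p using lift_closed[OF l that] .
  have left: "lift {0..1} p (\<lambda>s. l (0, s))" and right: "lift {0..1} q (\<lambda>s. l (1, s))"
  proof -
    have "lift {0..1} (h \<circ> (\<lambda>s. (0, s))) (l \<circ> (\<lambda>s. (0, s)))" "lift {0..1} (h \<circ> (\<lambda>s. (1, s))) (l \<circ> (\<lambda>s. (1, s)))"
      by (rule lift_compose[OF l], auto intro!: continuous_intros)+
    then show "lift {0..1} p (\<lambda>s. l (0, s))" "lift {0..1} q (\<lambda>s. l (1, s))"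
      by (simp_all add: o_def h(2,3))
  qed
  have side: "l (0, s) = l (1, s)" if s: "s \<in> {0, 1}" for s
  proof -
    define z where "z = (if s = 0 then x else y)"
    have z: "z \<in> topspace X" using xy by (simp add: z_def)
    have ht: "h (t, s) = z" if "t \<in> {0..1}" for t using h(4,5) that s by (auto simp: z_def)
    have lt: "lift {0..1} (\<lambda>t. h (t, s)) (\<lambda>t. l (t, s))"
    proof -
      have "lift {0..1} (h \<circ> (\<lambda>t. (t, s))) (l \<circ> (\<lambda>t. (t, s)))"
        by (rule lift_compose[OF l]) (use s in \<open>auto intro!: continuous_intros\<close>)
      then show ?thesis by (simp add: o_def)
    qed
    obtain i where i: "i \<in> I" "z \<in> U i" using cover z by blast
    have "continuous_map (top_of_set {0..1}) X (\<lambda>t. h (t, s))"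
      by (rule continuous_map_eq[of _ _ "\<lambda>_. z"]) (use z in \<open>auto simp: ht\<close>)
    then have m: "lift {0..1} (\<lambda>t. h (t, s)) (\<lambda>t. f i (h (t, s)))"
      using i ht by (intro lift_local) auto
    have "l (0, s) \<otimes> inv f i (h (0, s)) = l (1, s) \<otimes> inv f i (h (1, s))"
      by (rule lift_unique[OF lt m]) (use z ht in auto)
    then have "l (0, s) \<otimes> inv f i z = l (1, s) \<otimes> inv f i z" by (simp add: ht)
    moreover have "l (0, s) \<in> carrier G" "l (1, s) \<in> carrier G" "f i z \<in> carrier G"
      using s i by (auto intro!: c section_closed)
    ultimately show ?thesis by (simp add: G.right_cancel)
  qed
  show ?thesis
    using holonomy_eq[OF e(1) left] holonomy_eq[OF e(2) right] side by simp
qed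

lemma holonomy_part:
  assumes p: "pathin X p" and l: "lift {0..1} p l" and ab: "0 \<le> a" "a \<le> b" "b \<le> 1"
  shows "holonomy (path_part p a b) = inv l a \<otimes> l b"
proof -
  have "lift {0..1} (p \<circ> (\<lambda>s. a + s * (b - a))) (l \<circ> (\<lambda>s. a + s * (b - a)))"
    by (rule lift_compose[OF l]) (use segment_in_unit_interval[OF ab] in \<open>auto intro!: continuous_intros\<close>)
  then have "lift {0..1} (path_part p a b) (l \<circ> (\<lambda>s. a + s * (b - a)))"
    by (simp add: path_part_def o_def)
  from holonomy_eq[OF pathin_part[OF p ab] this] show ?thesis by simp
qed

lemma holonomy_join:
  assumes p: "pathin X p" and q: "pathin X q" and e: "p 1 = q 0"
  shows "holonomy (loop_join p q) = holonomy p \<otimes> holonomy q"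
proof -
  let ?j = "loop_join p q"
  have j: "pathin X ?j" using pathin_loop_join[OF p q e] .
  obtain l where l: "lift {0..1} ?j l" using lift_path[OF j] by blast
  have c: "l t \<in> carrier G" if "t \<in> {0..1}" for t using lift_closed[OF l that] .
  have "path_hom X (p 0) (p 1) p (path_part ?j 0 (1/2))"
    by (rule path_hom_reparametrize[where F = p and u = id and v = id])
       (auto simp: p path_part_def loop_join_def)
  then have 1: "holonomy p = inv l 0 \<otimes> l (1/2)"
    using holonomy_cong holonomy_part[OF j l, of 0 "1/2"] by simp
  have "path_part ?j (1/2) 1 s = q s" if "s \<in> {0..1}" for s
    using that e by (cases "s = 0") (auto simp: path_part_def loop_join_def algebra_simps)
  then have "path_hom X (q 0) (q 1) q (path_part ?j (1/2) 1)"
    by (intro path_hom_reparametrize[where F = q and u = id and v = id]) (auto simp: q)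
  then have 2: "holonomy q = inv l (1/2) \<otimes> l 1"
    using holonomy_cong holonomy_part[OF j l, of "1/2" 1] by simp
  show ?thesis using c[of 0] c[of "1/2"] c[of 1]
    by (simp add: 1 2 holonomy_eq[OF j l] G.m_assoc) (simp add: G.m_assoc[symmetric])
qed

end

section \<open>Quotients of convex sets covered by contractible patches\<close>

text \<open>A quotient map \<open>q\<close> from a convex set \<open>D\<close> onto \<open>X\<close> with a cover of \<open>X\<close> by patches. The
  preimage of patch \<open>i\<close> is the disjoint union of the cells \<open>S i d\<close> for \<open>d \<in> C i\<close>; the cell
  contracts by \<open>c i d\<close> to its centre \<open>ctr i d\<close> and carries the label \<open>H i d\<close>. The assumption
  \<open>glue\<close> says that identified points lie in corresponding cells, whose contractions are identified
  at all times, and that all labels at the first point become those at the second by right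
  multiplication with one and the same element.\<close>

locale glued_convex = G: group G for G :: "('g, 'm) monoid_scheme" (structure) +
  fixes X :: "'a topology" and D :: "'b::real_normed_vector set" and q :: "'b \<Rightarrow> 'a" and z0 :: 'b
    and I :: "'i set" and C :: "'i \<Rightarrow> 'c set" and S :: "'i \<Rightarrow> 'c \<Rightarrow> 'b set" and ctr :: "'i \<Rightarrow> 'c \<Rightarrow> 'b"
    and c :: "'i \<Rightarrow> 'c \<Rightarrow> real \<times> 'b \<Rightarrow> 'b" and H :: "'i \<Rightarrow> 'c \<Rightarrow> 'g"
  assumes quotient: "quotient_map (top_of_set D) X q"
    and convex: "convex D" and z0: "z0 \<in> D" and z0_single: "\<And>z. z \<in> D \<Longrightarrow> q z = q z0 \<Longrightarrow> z = z0"
    and S_open: "\<And>i d. i \<in> I \<Longrightarrow> d \<in> C i \<Longrightarrow> openin (top_of_set D) (S i d)"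
    and S_disjoint: "\<And>i d e z. i \<in> I \<Longrightarrow> d \<in> C i \<Longrightarrow> e \<in> C i \<Longrightarrow> z \<in> S i d \<Longrightarrow> z \<in> S i e \<Longrightarrow> d = e"
    and S_cover: "\<And>z. z \<in> D \<Longrightarrow> \<exists>i\<in>I. \<exists>d\<in>C i. z \<in> S i d"
    and contract: "\<And>i d. i \<in> I \<Longrightarrow> d \<in> C i \<Longrightarrow> continuous_on ({0..1} \<times> S i d) (c i d)"
    and contract_in: "\<And>i d t z. i \<in> I \<Longrightarrow> d \<in> C i \<Longrightarrow> t \<in> {0..1} \<Longrightarrow> z \<in> S i d \<Longrightarrow> c i d (t, z) \<in> D"
    and contract_0: "\<And>i d z. i \<in> I \<Longrightarrow> d \<in> C i \<Longrightarrow> z \<in> S i d \<Longrightarrow> c i d (0, z) = z"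
    and contract_1: "\<And>i d z. i \<in> I \<Longrightarrow> d \<in> C i \<Longrightarrow> z \<in> S i d \<Longrightarrow> c i d (1, z) = ctr i d"
    and ctr_in: "\<And>i d. i \<in> I \<Longrightarrow> d \<in> C i \<Longrightarrow> ctr i d \<in> S i d"
    and ctr_glued: "\<And>i d e. i \<in> I \<Longrightarrow> d \<in> C i \<Longrightarrow> e \<in> C i \<Longrightarrow> q (ctr i d) = q (ctr i e)"
    and H_closed: "\<And>i d. i \<in> I \<Longrightarrow> d \<in> C i \<Longrightarrow> H i d \<in> carrier G"
    and glue: "\<And>z w. z \<in> D \<Longrightarrow> w \<in> D \<Longrightarrow> q z = q w \<Longrightarrow>
      \<exists>\<gamma>\<in>carrier G. \<forall>i\<in>I. \<forall>d\<in>C i. z \<in> S i d \<longrightarrow>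
        (\<exists>e\<in>C i. w \<in> S i e \<and> H i e = H i d \<otimes> \<gamma> \<and> (\<forall>t\<in>{0..1}. q (c i d (t, z)) = q (c i e (t, w))))"
begin

text \<open>\<open>V i\<close> is the preimage in \<open>D\<close> of the patch \<open>U i\<close>, and \<open>F i\<close> the label of the cell that
  contains a given point. The values of \<open>F i\<close> at identified points may differ, so a representative
  has to be chosen for every point of \<open>X\<close> to obtain the section \<open>f i\<close>.\<close>

definition V :: "'i \<Rightarrow> 'b set" where "V i = (\<Union>d\<in>C i. S i d)"
definition U :: "'i \<Rightarrow> 'a set" where "U i = q ` V i"
definition idx :: "'i \<Rightarrow> 'b \<Rightarrow> 'c" where "idx i z = (THE d. d \<in> C i \<and> z \<in> S i d)"
definition rep :: "'a \<Rightarrow> 'b" where "rep x = (SOME z. z \<in> D \<and> q z = x)"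
definition F :: "'i \<Rightarrow> 'b \<Rightarrow> 'g" where "F i z = H i (idx i z)"
definition f :: "'i \<Rightarrow> 'a \<Rightarrow> 'g" where "f i x = F i (rep x)"
definition spoke :: "'b \<Rightarrow> real \<Rightarrow> 'a" where "spoke z = (\<lambda>t. q (z0 + t *\<^sub>R (z - z0)))"
definition tree :: "'a \<Rightarrow> real \<Rightarrow> 'a" where "tree x = spoke (rep x)"

lemma q_cont: "continuous_map (top_of_set D) X q"
  using quotient by (rule quotient_imp_continuous_map)

lemma topspace_X: "topspace X = q ` D"
  using quotient_imp_surjective_map[OF quotient] by simp

lemma idx_eq: "i \<in> I \<Longrightarrow> d \<in> C i \<Longrightarrow> z \<in> S i d \<Longrightarrow> idx i z = d"
  unfolding idx_def using S_disjoint by blast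

lemma idx_in: "i \<in> I \<Longrightarrow> z \<in> V i \<Longrightarrow> idx i z \<in> C i \<and> z \<in> S i (idx i z)"
  unfolding V_def using idx_eq by fastforce

lemma S_sub: "i \<in> I \<Longrightarrow> d \<in> C i \<Longrightarrow> S i d \<subseteq> D"
  using S_open openin_subset by fastforce

lemma V_sub: "i \<in> I \<Longrightarrow> V i \<subseteq> D"
  unfolding V_def using S_sub by blast

lemma rep: "x \<in> topspace X \<Longrightarrow> rep x \<in> D \<and> q (rep x) = x"
  unfolding rep_def by (rule someI_ex) (auto simp: topspace_X)

lemma rep_base: "rep (q z0) = z0"
  using rep[of "q z0"] z0 z0_single by (auto simp: topspace_X)

lemma F_closed: "i \<in> I \<Longrightarrow> z \<in> V i \<Longrightarrow> F i z \<in> carrier G"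
  unfolding F_def using idx_in H_closed by blast

text \<open>The condition on gluing in terms of \<open>F\<close>. The quotient of \<open>F i\<close> and \<open>F j\<close> does not depend on
  the choice of the representative, since the common factor cancels.\<close>

lemma glue_F:
  assumes "z \<in> D" "w \<in> D" "q z = q w"
  shows "\<exists>\<gamma>\<in>carrier G. \<forall>i\<in>I. z \<in> V i \<longrightarrow> w \<in> V i \<and> F i w = F i z \<otimes> \<gamma> \<and>
     (\<forall>t\<in>{0..1}. q (c i (idx i z) (t, z)) = q (c i (idx i w) (t, w)))"
proof -
  obtain \<gamma> where \<gamma>: "\<gamma> \<in> carrier G" and g: "\<forall>i\<in>I. \<forall>d\<in>C i. z \<in> S i d \<longrightarrow>
        (\<exists>e\<in>C i. w \<in> S i e \<and> H i e = H i d \<otimes> \<gamma> \<and> (\<forall>t\<in>{0..1}. q (c i d (t, z)) = q (c i e (t, w))))"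
    using glue[OF assms] by blast
  show ?thesis
  proof (intro bexI[OF _ \<gamma>] ballI impI)
    fix i assume i: "i \<in> I" "z \<in> V i"
    obtain e where e: "e \<in> C i" "w \<in> S i e" "H i e = H i (idx i z) \<otimes> \<gamma>"
      "\<forall>t\<in>{0..1}. q (c i (idx i z) (t, z)) = q (c i e (t, w))"
      using g i idx_in[OF i] by blast
    have "idx i w = e" using idx_eq i e by blast
    then show "w \<in> V i \<and> F i w = F i z \<otimes> \<gamma> \<and>
     (\<forall>t\<in>{0..1}. q (c i (idx i z) (t, z)) = q (c i (idx i w) (t, w)))"
      using e unfolding V_def F_def by blast
  qed
qed

lemma V_saturated: "i \<in> I \<Longrightarrow> z \<in> V i \<Longrightarrow> w \<in> D \<Longrightarrow> q z = q w \<Longrightarrow> w \<in> V i"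
  using glue_F[of z w] V_sub by blast

lemma saturated_open_image:
  assumes "openin (top_of_set D) Z" and "\<And>z w. z \<in> Z \<Longrightarrow> w \<in> D \<Longrightarrow> q z = q w \<Longrightarrow> w \<in> Z"
  shows "openin X (q ` Z)"
proof -
  have "Z \<subseteq> D" using openin_subset[OF assms(1)] by simp
  then have "{x \<in> D. q x \<in> q ` Z} = Z" using assms(2) by fastforce
  moreover have "q ` Z \<subseteq> topspace X" using \<open>Z \<subseteq> D\<close> topspace_X by blast
  moreover have "openin (top_of_set D) {x \<in> D. q x \<in> W} = openin X W" if "W \<subseteq> topspace X" for W
    using quotient that by (simp add: quotient_map_def)
  ultimately show ?thesis using assms(1) by metis
qed

lemma V_open: "i \<in> I \<Longrightarrow> openin (top_of_set D) (V i)"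
  unfolding V_def using S_open by blast

lemma U_open: "i \<in> I \<Longrightarrow> openin X (U i)"
  unfolding U_def by (rule saturated_open_image[OF V_open V_saturated])

lemma rep_V: "i \<in> I \<Longrightarrow> x \<in> U i \<Longrightarrow> rep x \<in> V i"
proof -
  assume i: "i \<in> I" and "x \<in> U i"
  then obtain z where z: "z \<in> V i" "x = q z" by (auto simp: U_def)
  then have "x \<in> topspace X" using V_sub[OF i] by (auto simp: topspace_X)
  then show "rep x \<in> V i" using V_saturated[OF i z(1)] rep z(2) by metis
qed

lemma U_sub: "i \<in> I \<Longrightarrow> U i \<subseteq> topspace X"
  using U_open openin_subset by blast

sublocale local_system G X I U f
proof
  show "\<exists>i\<in>I. x \<in> U i" if "x \<in> topspace X" for x
    using that S_cover unfolding topspace_X U_def V_def by blast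
  show "f i x \<in> carrier G" if "i \<in> I" "x \<in> U i" for i x
    unfolding f_def using that rep_V F_closed by blast
next
  fix i j x assume ij: "i \<in> I" "j \<in> I" and x: "x \<in> U i" "x \<in> U j"
  define Z where "Z = {z \<in> V i \<inter> V j. F i z \<otimes> inv F j z = f i x \<otimes> inv f j x}"
  have "openin (top_of_set D) Z"
  proof (subst openin_subopen, intro ballI)
    fix z assume z: "z \<in> Z"
    let ?O = "S i (idx i z) \<inter> S j (idx j z)"
    have zz: "z \<in> V i" "z \<in> V j" using z by (auto simp: Z_def)
    have "idx i w = idx i z" "idx j w = idx j z" "w \<in> V i" "w \<in> V j" if w: "w \<in> ?O" for w
    proof -
      show "idx i w = idx i z" "idx j w = idx j z"
        using w idx_in[OF ij(1) zz(1)] idx_in[OF ij(2) zz(2)] by (auto intro: idx_eq ij)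
      show "w \<in> V i" "w \<in> V j"
        using w idx_in[OF ij(1) zz(1)] idx_in[OF ij(2) zz(2)] by (auto simp: V_def)
    qed
    then have "?O \<subseteq> Z" using z unfolding Z_def F_def by (smt (verit) IntI mem_Collect_eq subsetI)
    moreover have "openin (top_of_set D) ?O"
      using idx_in[OF ij(1) zz(1)] idx_in[OF ij(2) zz(2)] S_open ij by blast
    moreover have "z \<in> ?O" using idx_in[OF ij(1) zz(1)] idx_in[OF ij(2) zz(2)] by blast
    ultimately show "\<exists>O'. openin (top_of_set D) O' \<and> z \<in> O' \<and> O' \<subseteq> Z" by blast
  qed
  moreover have sat: "w \<in> Z" "F i w \<otimes> inv F j w = F i z \<otimes> inv F j z"
    if z: "z \<in> Z" "w \<in> D" "q z = q w" for z w
  proof -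
    have zz: "z \<in> V i" "z \<in> V j" "z \<in> D" using z V_sub ij by (auto simp: Z_def)
    obtain \<gamma> where g: "\<gamma> \<in> carrier G" "w \<in> V i" "w \<in> V j" "F i w = F i z \<otimes> \<gamma>" "F j w = F j z \<otimes> \<gamma>"
      using glue_F[OF zz(3) z(2,3)] ij zz by blast
    have c: "F i z \<in> carrier G" "F j z \<in> carrier G" using F_closed ij zz by auto
    have "F i w \<otimes> inv F j w = F i z \<otimes> (\<gamma> \<otimes> inv \<gamma>) \<otimes> inv F j z"
      using g(1) c by (simp only: g G.inv_mult_group G.m_assoc G.m_closed G.inv_closed)
    then show "F i w \<otimes> inv F j w = F i z \<otimes> inv F j z" using g c by simp
    then show "w \<in> Z" using z g by (simp add: Z_def)
  qed
  ultimately have "openin X (q ` Z)" using saturated_open_image by blast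
  moreover have rx: "rep x \<in> V i" "rep x \<in> V j" "x \<in> topspace X" using rep_V U_sub ij x by auto
  then have "rep x \<in> Z" by (simp add: Z_def f_def)
  then have "x \<in> q ` Z" using rep[OF rx(3)] by (metis imageI)
  moreover have "y \<in> U i \<and> y \<in> U j \<and> f i y \<otimes> inv f j y = f i x \<otimes> inv f j x" if y: "y \<in> q ` Z" for y
  proof -
    obtain z where z: "z \<in> Z" "y = q z" using y by blast
    then have "y \<in> U i" "y \<in> U j" by (auto simp: Z_def U_def)
    moreover have "y \<in> topspace X" using calculation U_sub[OF ij(1)] by blast
    then have "rep y \<in> D" "q z = q (rep y)" using rep[of y] unfolding z(2)[symmetric] by simp_all
    then have "rep y \<in> Z" using sat(1)[OF z(1)] by blast
    ultimately show ?thesis by (simp add: Z_def f_def)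
  qed
  ultimately show "\<exists>W. openin X W \<and> x \<in> W \<and> (\<forall>y\<in>W. y \<in> U i \<and> y \<in> U j \<and>
        f i y \<otimes> inv f j y = f i x \<otimes> inv f j x)" by blast
qed (rule U_open)

lemma ray_in: "z \<in> D \<Longrightarrow> t \<in> {0..1} \<Longrightarrow> z0 + t *\<^sub>R (z - z0) \<in> D"
  using convexD_alt[OF convex z0, of z t] by (simp add: algebra_simps)

lemma pathin_ray: "z \<in> D \<Longrightarrow> pathin (top_of_set D) (\<lambda>t. z0 + t *\<^sub>R (z - z0))"
  using ray_in by (auto simp: pathin_def intro!: continuous_intros)

lemma pathin_q: "pathin (top_of_set D) u \<Longrightarrow> pathin X (q \<circ> u)"
  unfolding pathin_def by (rule continuous_map_compose[OF _ q_cont])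

lemma pathin_spoke: "z \<in> D \<Longrightarrow> pathin X (spoke z)"
  using pathin_q[OF pathin_ray] by (simp add: spoke_def o_def)

lemma spoke_ends [simp]: "spoke z 0 = q z0" "spoke z 1 = q z"
  by (simp_all add: spoke_def)

text \<open>The tree consists of the radial paths to the chosen representatives.\<close>

sublocale path_tree X "q z0" tree
proof
  show b: "q z0 \<in> topspace X" using z0 topspace_X by blast
  show "path_hom X (q z0) (q z0) (tree (q z0)) (\<lambda>_. q z0)"
    using b by (simp add: tree_def rep_base spoke_def path_hom_refl pathin_def)
qed (use rep pathin_spoke in \<open>auto simp: tree_def\<close>)

lemma tree_class_spoke_rep: "x \<in> topspace X \<Longrightarrow> tree_class (spoke (rep x)) = \<one>\<^bsub>P\<^esub>"
  using tree_class_tree by (simp add: tree_def)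

text \<open>Since \<open>D\<close> is convex, a path in \<open>D\<close> is homotopic to going back to \<open>z0\<close> on one spoke and out
  again on the other.\<close>

lemma tree_class_in_disc:
  assumes u: "pathin (top_of_set D) u"
  shows "tree_class (q \<circ> u) = inv\<^bsub>P\<^esub> tree_class (spoke (u 0)) \<otimes>\<^bsub>P\<^esub> tree_class (spoke (u 1))"
proof -
  have uD: "u 0 \<in> D" "u 1 \<in> D" using u by (auto simp: pathin_def continuous_map_def Pi_iff)
  let ?a = "\<lambda>z t. z0 + t *\<^sub>R (z - z0)"
  have j: "pathin (top_of_set D) (loop_join (?a (u 0)) u)"
    by (rule pathin_loop_join[OF pathin_ray[OF uD(1)] u]) simp
  have e: "loop_join (spoke (u 0)) (q \<circ> u) s = q (loop_join (?a (u 0)) u s)" for s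
    by (simp add: loop_join_def spoke_def)
  have "path_hom X (spoke (u 1) 0) (spoke (u 1) 1) (spoke (u 1)) (loop_join (spoke (u 0)) (q \<circ> u))"
  proof (rule path_hom_convex_image[OF q_cont convex, of "?a (u 1)" "loop_join (?a (u 0)) u"])
    show "continuous_on {0..1} (loop_join (?a (u 0)) u)" "loop_join (?a (u 0)) u ` {0..1} \<subseteq> D"
      "continuous_on {0..1} (?a (u 1))" "?a (u 1) ` {0..1} \<subseteq> D"
      using j pathin_ray[OF uD(2)] by (auto simp: pathin_def)
  qed (simp_all only: e loop_join_ends, simp_all add: spoke_def)
  then have "tree_class (spoke (u 1)) = tree_class (loop_join (spoke (u 0)) (q \<circ> u))" by (rule tree_class_cong)
  also have "\<dots> = tree_class (spoke (u 0)) \<otimes>\<^bsub>P\<^esub> tree_class (q \<circ> u)"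
    by (rule tree_class_join) (auto simp: pathin_spoke uD pathin_q u)
  finally show ?thesis
    using P.inv_solve_left'[of "tree_class (q \<circ> u)" "tree_class (spoke (u 0))" "tree_class (spoke (u 1))"]
    by (simp add: tree_class_closed pathin_spoke uD pathin_q u)
qed

definition contraction :: "'i \<Rightarrow> real \<times> 'a \<Rightarrow> 'a" where
  "contraction i = (\<lambda>(t, x). q (c i (idx i (rep x)) (t, rep x)))"

lemma contraction_q:
  assumes "i \<in> I" "z \<in> V i" "t \<in> {0..1}"
  shows "contraction i (t, q z) = q (c i (idx i z) (t, z))"
proof -
  have z: "z \<in> D" "q z \<in> topspace X" using assms V_sub topspace_X by auto
  have r: "rep (q z) \<in> D" "q z = q (rep (q z))" using rep[OF z(2)] by auto
  show ?thesis using glue_F[OF z(1) r] assms by (fastforce simp: contraction_def)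
qed

text \<open>The contractions of the cells are compatible with the gluing, hence descend to the patch.
  Continuity descends because the product of a quotient map with the identity of the compact
  interval is again a quotient map.\<close>

lemma contraction_cont:
  assumes i: "i \<in> I"
  shows "continuous_map (prod_topology (top_of_set {0..1}) (subtopology X (U i))) X (contraction i)"
proof -
  have "quotient_map (subtopology (top_of_set D) (V i)) (subtopology X (U i)) q"
  proof (rule quotient_map_restriction[OF quotient _ disjI1[OF U_open[OF i]]])
    show "{x \<in> topspace (top_of_set D). q x \<in> U i} = V i"
      using V_saturated[OF i] V_sub[OF i] by (fastforce simp: U_def)
  qed
  then have Q: "quotient_map (top_of_set (V i)) (subtopology X (U i)) q"
    using V_sub[OF i] by (simp add: subtopology_subtopology Int_absorb1)
  have "quotient_map (prod_topology (top_of_set {0..1::real}) (top_of_set (V i)))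
     (prod_topology (top_of_set {0..1}) (subtopology X (U i))) (\<lambda>(x, y). (x, q y))"
  proof (rule quotient_map_prod_right[OF _ _ Q])
    show "locally_compact_space (top_of_set {0..1::real})"
      by (intro compact_imp_locally_compact_space) (simp add: compact_space_subtopology)
    show "Hausdorff_space (top_of_set {0..1::real}) \<or> regular_space (top_of_set {0..1::real})"
      by (simp add: Hausdorff_space_subtopology)
  qed
  moreover have "continuous_map (prod_topology (top_of_set {0..1::real}) (top_of_set (V i))) X
     (contraction i \<circ> (\<lambda>(x, y). (x, q y)))"
  proof (rule pasting_lemma[where I = "C i" and T = "\<lambda>d. {0..1} \<times> S i d" and f = "\<lambda>d. q \<circ> c i d"])
    fix d assume d: "d \<in> C i"
    have "S i d \<subseteq> V i" using d by (auto simp: V_def)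
    then have "openin (top_of_set (V i)) (S i d)"
      using S_open[OF i d] V_sub[OF i] by (meson openin_subset_trans)
    then show "openin (prod_topology (top_of_set {0..1}) (top_of_set (V i))) ({0..1::real} \<times> S i d)"
      by (simp only: openin_prod_Times_iff) simp
    have "continuous_map (top_of_set ({0..1} \<times> S i d)) X (q \<circ> c i d)"
      by (rule continuous_map_compose[OF _ q_cont])
         (use contract[OF i d] contract_in[OF i d] in \<open>auto simp: continuous_map_in_subtopology\<close>)
    moreover have "({0..1} \<times> V i) \<inter> ({0..1} \<times> S i d) = {0..1::real} \<times> S i d"
      using \<open>S i d \<subseteq> V i\<close> by blast
    ultimately show "continuous_map (subtopology (prod_topology (top_of_set {0..1}) (top_of_set (V i)))
       ({0..1} \<times> S i d)) X (q \<circ> c i d)"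
      by (simp add: subtopology_subtopology)
  next
    fix d e x assume "d \<in> C i" "e \<in> C i"
      "x \<in> topspace (prod_topology (top_of_set {0..1}) (top_of_set (V i))) \<inter> ({0..1} \<times> S i d) \<inter> ({0..1::real} \<times> S i e)"
    then have "d = e" using S_disjoint i by blast
    then show "(q \<circ> c i d) x = (q \<circ> c i e) x" by simp
  next
    fix x assume "x \<in> topspace (prod_topology (top_of_set {0..1::real}) (top_of_set (V i)))"
    then obtain t z where x: "x = (t, z)" "t \<in> {0..1}" "z \<in> V i" by auto
    then show "\<exists>d. d \<in> C i \<and> x \<in> {0..1} \<times> S i d \<and> (contraction i \<circ> (\<lambda>(x, y). (x, q y))) x = (q \<circ> c i d) x"
      using idx_in[OF i x(3)] contraction_q[OF i x(3,2)] by auto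
  qed
  ultimately show ?thesis by (rule continuous_compose_quotient_map)
qed

text \<open>Contracting a path within a patch gives a square with one constant side. Its other sides run
  from the two ends of the path to the centre of the patch and stay in a cell, where
  \<open>tree_class_in_disc\<close> applies.\<close>

lemma tree_class_in_patch:
  assumes i: "i \<in> I" and p: "pathin X p" and pU: "p ` {0..1} \<subseteq> U i"
  shows "tree_class p = tree_class (spoke (ctr i (idx i (rep (p 0))))) \<otimes>\<^bsub>P\<^esub> inv\<^bsub>P\<^esub> tree_class (spoke (ctr i (idx i (rep (p 1)))))"
proof -
  have pU: "p s \<in> U i" if "s \<in> {0..1}" for s using pU that by auto
  define h where "h = (\<lambda>(t, s). contraction i (t, p s))"
  have "continuous_map unit_square X (contraction i \<circ> (\<lambda>(t, s). (t, p s)))"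
  proof (rule continuous_map_compose[OF _ contraction_cont[OF i]])
    have "continuous_map (top_of_set {0..1}) (subtopology X (U i)) p"
      using p pU by (auto simp: pathin_def continuous_map_in_subtopology)
    then have "continuous_map unit_square (subtopology X (U i)) (p \<circ> snd)"
      by (rule continuous_map_compose[OF continuous_map_snd])
    then show "continuous_map unit_square (prod_topology (top_of_set {0..1}) (subtopology X (U i))) (\<lambda>(t, s). (t, p s))"
      using continuous_map_fst[of "top_of_set {0..1::real}" "top_of_set {0..1::real}"]
      by (intro continuous_map_pairwise[THEN iffD2]) (auto simp: o_def case_prod_unfold)
  qed
  then have hc: "continuous_map unit_square X h" by (simp add: h_def o_def case_prod_unfold)
  have r: "rep (p s) \<in> V i" "rep (p s) \<in> D" "q (rep (p s)) = p s"
    "idx i (rep (p s)) \<in> C i" "rep (p s) \<in> S i (idx i (rep (p s)))" if "s \<in> {0..1}" for s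
    using rep_V[OF i pU[OF that]] idx_in[OF i] rep U_sub[OF i] pU[OF that] by auto
  have h0: "h (0, s) = p s" if "s \<in> {0..1}" for s
    using r[OF that] contract_0 i by (simp add: h_def contraction_def)
  have h1: "h (1, s) = q (ctr i (idx i (rep (p s))))" if "s \<in> {0..1}" for s
    using r[OF that] contract_1 i by (simp add: h_def contraction_def)
  have side: "tree_class (\<lambda>t. h (t, s)) = tree_class (spoke (ctr i (idx i (rep (p s)))))" if s: "s \<in> {0..1}" for s
  proof -
    let ?z = "rep (p s)" and ?d = "idx i (rep (p s))"
    let ?u = "\<lambda>t. c i ?d (t, ?z)"
    have "continuous_on {0..1} ?u"
      by (rule continuous_on_compose2[OF contract[OF i r(4)[OF s]]])
         (use r(5)[OF s] in \<open>auto intro!: continuous_intros\<close>)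
    then have "pathin (top_of_set D) ?u"
      using contract_in[OF i r(4)[OF s] _ r(5)[OF s]] by (auto simp: pathin_def)
    from tree_class_in_disc[OF this] have "tree_class (q \<circ> ?u) = inv\<^bsub>P\<^esub> tree_class (spoke ?z) \<otimes>\<^bsub>P\<^esub> tree_class (spoke (ctr i ?d))"
      using contract_0[OF i r(4,5)[OF s]] contract_1[OF i r(4,5)[OF s]] by simp
    moreover have "p s \<in> topspace X" using pU[OF s] U_sub[OF i] by blast
    moreover have "ctr i ?d \<in> D" using ctr_in[OF i r(4)[OF s]] S_sub[OF i r(4)[OF s]] by blast
    ultimately show ?thesis
      by (simp add: tree_class_spoke_rep tree_class_closed pathin_spoke h_def contraction_def o_def)
  qed
  have pq: "pathin X (\<lambda>t. h (t, s))" if s: "s \<in> {0..1}" for s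
  proof -
    have "continuous_map (top_of_set {0..1}) unit_square (\<lambda>t. (t, s))"
      using s by (auto simp: continuous_map_in_subtopology intro!: continuous_intros)
    from continuous_map_compose[OF this hc] show ?thesis by (simp add: pathin_def o_def)
  qed
  let ?x = "q (ctr i (idx i (rep (p 0))))"
  have x: "?x \<in> topspace X"
    using ctr_in[OF i r(4)] S_sub[OF i r(4)] by (force simp: topspace_X)
  have h1': "h (1, s) = ?x" if "s \<in> {0..1}" for s
    using h1[OF that] ctr_glued[OF i r(4)[OF that] r(4)[of 0]] by simp
  have "path_hom X (p 0) (p 1) (\<lambda>s. h (0, s)) p"
    by (rule path_hom_reparametrize[OF p, of id id]) (auto simp: h0)
  then have 1: "tree_class (\<lambda>s. h (0, s)) = tree_class p" "pathin X (\<lambda>s. h (0, s))" by (auto dest: tree_class_cong path_hom_imp)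
  have "path_hom X ?x ?x (\<lambda>s. h (1, s)) (\<lambda>_. ?x)"
    by (rule path_hom_reparametrize[of X "\<lambda>_. ?x" id id]) (auto simp: h1' x pathin_const)
  then have 2: "tree_class (\<lambda>s. h (1, s)) = \<one>\<^bsub>P\<^esub>" "pathin X (\<lambda>s. h (1, s))"
    using tree_class_const[OF x] by (auto dest: tree_class_cong path_hom_imp)
  have "tree_class (loop_join (\<lambda>s. h (0, s)) (\<lambda>t. h (t, 1))) = tree_class (loop_join (\<lambda>t. h (t, 0)) (\<lambda>s. h (1, s)))"
    by (rule tree_class_cong[OF path_hom_square[OF hc]])
  then have "tree_class p \<otimes>\<^bsub>P\<^esub> tree_class (\<lambda>t. h (t, 1)) = tree_class (\<lambda>t. h (t, 0)) \<otimes>\<^bsub>P\<^esub> \<one>\<^bsub>P\<^esub>"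
    using tree_class_join[OF 1(2) pq[of 1]] tree_class_join[OF pq[of 0] 2(2)] 1 2 by simp
  then have "tree_class p = tree_class (\<lambda>t. h (t, 0)) \<otimes>\<^bsub>P\<^esub> inv\<^bsub>P\<^esub> tree_class (\<lambda>t. h (t, 1))"
    using pq p by (intro P.inv_solve_right[THEN iffD2]) (auto simp: tree_class_closed)
  then show ?thesis by (simp add: side)
qed

text \<open>The factor by which the labels at \<open>z\<close> are multiplied when \<open>z\<close> is replaced by the chosen
  representative of its class.\<close>

definition seam :: "'b \<Rightarrow> 'g" where
  "seam z = (SOME g. g \<in> carrier G \<and> (\<forall>i\<in>I. z \<in> V i \<longrightarrow> f i (q z) = F i z \<otimes> g))"

lemma seam:
  assumes "z \<in> D"
  shows "seam z \<in> carrier G" "\<And>i. i \<in> I \<Longrightarrow> z \<in> V i \<Longrightarrow> f i (q z) = F i z \<otimes> seam z"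
proof -
  have "\<exists>g. g \<in> carrier G \<and> (\<forall>i\<in>I. z \<in> V i \<longrightarrow> f i (q z) = F i z \<otimes> g)"
    using glue_F[OF assms, of "rep (q z)"] rep[of "q z"] assms topspace_X unfolding f_def by fastforce
  from someI_ex[OF this] show "seam z \<in> carrier G"
    "\<And>i. i \<in> I \<Longrightarrow> z \<in> V i \<Longrightarrow> f i (q z) = F i z \<otimes> seam z"
    unfolding seam_def by blast+
qed

lemma V_cover: "z \<in> D \<Longrightarrow> \<exists>i\<in>I. z \<in> V i"
  using S_cover unfolding V_def by blast

lemma seam_base: "seam z0 = \<one>"
proof -
  obtain i where i: "i \<in> I" "z0 \<in> V i" using V_cover z0 by blast
  have "F i z0 = F i z0 \<otimes> seam z0" using seam(2)[OF z0 i] by (simp add: f_def rep_base)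
  then show ?thesis using F_closed[OF i] seam(1)[OF z0] by (simp add: G.l_cancel_one')
qed

text \<open>Within \<open>D\<close> a lift changes only through the change of representatives.\<close>

lemma holonomy_spoke:
  assumes z: "z \<in> D"
  shows "holonomy (spoke z) = seam z"
proof -
  let ?u = "\<lambda>t. z0 + t *\<^sub>R (z - z0)"
  have "lift {0..1} (spoke z) (seam \<circ> ?u)"
  proof (rule liftI)
    fix p i assume p: "p \<in> {0..1}" "i \<in> I" "spoke z p \<in> U i"
    have uD: "?u t \<in> D" if "t \<in> {0..1}" for t using ray_in[OF z that] .
    have up: "?u p \<in> V i"
    proof -
      obtain w where "w \<in> V i" "q (?u p) = q w" using p(3) by (auto simp: U_def spoke_def)
      then show ?thesis using V_saturated[OF p(2) _ uD[OF p(1)]] by metis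
    qed
    note d = idx_in[OF p(2) up]
    let ?d = "idx i (?u p)"
    have val: "spoke z t \<in> U i \<and> (seam \<circ> ?u) t \<otimes> inv f i (spoke z t) = inv H i ?d"
      if t: "t \<in> {0..1}" "?u t \<in> S i ?d" for t
    proof -
      have V: "?u t \<in> V i" using t d by (auto simp: V_def)
      have F: "F i (?u t) = H i ?d" using idx_eq[OF p(2) _ t(2)] d by (simp add: F_def)
      have g: "seam (?u t) \<in> carrier G" "H i ?d \<in> carrier G"
        using seam(1)[OF uD[OF t(1)]] H_closed p d by auto
      have fe: "f i (spoke z t) = H i ?d \<otimes> seam (?u t)"
        using seam(2)[OF uD[OF t(1)] p(2) V] F by (simp add: spoke_def)
      have "seam (?u t) \<otimes> inv f i (spoke z t) = (seam (?u t) \<otimes> inv seam (?u t)) \<otimes> inv H i ?d"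
        unfolding fe using g by (simp only: G.inv_mult_group G.m_assoc G.inv_closed)
      then show ?thesis using g V by (auto simp: U_def spoke_def)
    qed
    have "continuous_map (top_of_set {0..1}) (top_of_set D) ?u" using pathin_ray[OF z] by (simp add: pathin_def)
    from openin_continuous_map_preimage[OF this S_open[OF p(2)], of ?d]
    obtain O' where "open O'" "{t \<in> {0..1}. ?u t \<in> S i ?d} = {0..1} \<inter> O'"
      using d by (auto simp: openin_open)
    then have "\<forall>\<^sub>F t in at p within {0..1}. t \<in> {0..1} \<and> ?u t \<in> S i ?d"
      using p d unfolding eventually_at_topological by blast
    then show "\<forall>\<^sub>F t in at p within {0..1}. spoke z t \<in> U i \<and>
       (seam \<circ> ?u) t \<otimes> inv f i (spoke z t) = (seam \<circ> ?u) p \<otimes> inv f i (spoke z p)"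
      by eventually_elim (use val[of p] p d val in auto)
  qed (use seam(1) ray_in[OF z] in auto)
  from holonomy_eq[OF pathin_spoke[OF z] this] show ?thesis
    using seam(1)[OF z] by (simp add: seam_base)
qed

text \<open>\<open>\<phi>\<close> is the inverse of the holonomy. The hypothesis on \<open>\<phi>\<close> is what both composites need: it
  makes \<open>\<phi>\<close> of the holonomy of a short path equal to the class of that path, and it says which
  loops realise the generators.\<close>

theorem fundamental_group_iso:
  assumes \<phi>: "\<phi> \<in> hom G P"
    and \<phi>_H: "\<And>i d e. i \<in> I \<Longrightarrow> d \<in> C i \<Longrightarrow> e \<in> C i \<Longrightarrow>
       \<phi> (inv H i d \<otimes> H i e) = tree_class (spoke (ctr i d)) \<otimes>\<^bsub>P\<^esub> inv\<^bsub>P\<^esub> tree_class (spoke (ctr i e))"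
    and gen: "carrier G \<subseteq> generate G {inv H i d \<otimes> H i e | i d e. i \<in> I \<and> d \<in> C i \<and> e \<in> C i}"
  shows "P \<cong> G"
proof -
  interpret \<phi>: group_hom G P \<phi>
    using \<phi> by (auto simp: group_hom_def group_hom_axioms_def)
  have ctrD: "ctr i d \<in> D" if "i \<in> I" "d \<in> C i" for i d
    using ctr_in[OF that] S_sub[OF that] by blast
  \<comment> \<open>Multiplicative along subdivisions, and true for pieces inside one patch.\<close>
  have \<phi>_holonomy: "\<phi> (holonomy p) = tree_class p" if p: "pathin X p" for p
  proof -
    obtain l where l: "lift {0..1} p l" using lift_path[OF p] by blast
    have lc: "l t \<in> carrier G" if "t \<in> {0..1}" for t using lift_closed[OF l that] .
    have "0 \<le> (0::real) \<and> (1::real) \<le> 1 \<longrightarrow> \<phi> (inv l 0 \<otimes> l 1) = tree_class (path_part p 0 1)"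
    proof (rule Bolzano[of 0 1 "\<lambda>a b. 0 \<le> a \<and> b \<le> 1 \<longrightarrow> \<phi> (inv l a \<otimes> l b) = tree_class (path_part p a b)"])
      fix a b b' :: real
      assume A: "0 \<le> a \<and> b \<le> 1 \<longrightarrow> \<phi> (inv l a \<otimes> l b) = tree_class (path_part p a b)"
        "0 \<le> b \<and> b' \<le> 1 \<longrightarrow> \<phi> (inv l b \<otimes> l b') = tree_class (path_part p b b')" and le: "a \<le> b" "b \<le> b'"
      show "0 \<le> a \<and> b' \<le> 1 \<longrightarrow> \<phi> (inv l a \<otimes> l b') = tree_class (path_part p a b')"
      proof
        assume i: "0 \<le> a \<and> b' \<le> 1"
        have c: "l a \<in> carrier G" "l b \<in> carrier G" "l b' \<in> carrier G" using i le by (auto intro: lc)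
        have "(inv l a \<otimes> l b) \<otimes> (inv l b \<otimes> l b') = inv l a \<otimes> ((l b \<otimes> inv l b) \<otimes> l b')"
          using c by (simp only: G.m_assoc G.m_closed G.inv_closed)
        then have "inv l a \<otimes> l b' = (inv l a \<otimes> l b) \<otimes> (inv l b \<otimes> l b')" using c by simp
        then have "\<phi> (inv l a \<otimes> l b') = tree_class (path_part p a b) \<otimes>\<^bsub>P\<^esub> tree_class (path_part p b b')"
          using A i le c by simp
        also have "\<dots> = tree_class (loop_join (path_part p a b) (path_part p b b'))"
          using i le p by (intro tree_class_join[symmetric] pathin_part) auto
        also have "\<dots> = tree_class (path_part p a b')"
          using i le by (intro tree_class_cong[OF path_hom_sym[OF path_part_join[OF p]]]) auto
        finally show "\<phi> (inv l a \<otimes> l b') = tree_class (path_part p a b')" .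
      qed
    next
      fix x :: real assume x: "0 \<le> x" "x \<le> 1"
      then have px: "p x \<in> topspace X" using p by (auto simp: pathin_def continuous_map_def)
      obtain i where i: "i \<in> I" "p x \<in> U i" using cover[OF px] by blast
      let ?Q = "\<lambda>t. p t \<in> U i \<and> l t \<otimes> inv f i (p t) = l x \<otimes> inv f i (p x)"
      have "\<forall>\<^sub>F t in at x within {0..1}. ?Q t" using liftD[OF l _ i] x by auto
      then obtain e where e: "e > 0" "\<And>t. t \<in> {0..1} \<Longrightarrow> t \<noteq> x \<Longrightarrow> dist t x < e \<Longrightarrow> ?Q t"
        by (auto simp: eventually_at)
      have Q: "?Q t" if "t \<in> {0..1}" "dist t x < e" for t
        using e(2)[OF that(1)] that i by (cases "t = x") auto
      have "\<phi> (inv l a \<otimes> l b) = tree_class (path_part p a b)"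
        if ab: "a \<le> x" "x \<le> b" "b - a < e" "0 \<le> a" "b \<le> 1" for a b
      proof -
        have Q': "?Q t" if "t \<in> {a..b}" for t using that ab by (intro Q) (auto simp: dist_real_def)
        have sub: "path_part p a b ` {0..1} \<subseteq> U i"
          using Q' segment_in_unit_interval(1)[of a b] ab by (auto simp: path_part_def)
        have pab: "p a \<in> U i" "p b \<in> U i" using Q' ab by auto
        let ?d = "idx i (rep (p a))" and ?e = "idx i (rep (p b))"
        have de: "?d \<in> C i" "?e \<in> C i" using idx_in[OF i(1)] rep_V[OF i(1)] pab by auto
        have c: "l a \<in> carrier G" "l b \<in> carrier G" "H i ?d \<in> carrier G" "H i ?e \<in> carrier G"
          using ab de H_closed i by (auto intro: lc)
        have "l a \<otimes> inv H i ?d = l b \<otimes> inv H i ?e"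
          using Q'[of a] Q'[of b] ab by (simp add: f_def F_def)
        then have "l b = l a \<otimes> inv H i ?d \<otimes> H i ?e" using c by (simp add: G.inv_solve_right)
        then have "l b = l a \<otimes> (inv H i ?d \<otimes> H i ?e)" using c by (simp add: G.m_assoc)
        then have "inv l a \<otimes> l b = inv H i ?d \<otimes> H i ?e"
          using G.inv_solve_left'[of "inv H i ?d \<otimes> H i ?e" "l a" "l b"] c by simp
        then have "\<phi> (inv l a \<otimes> l b) = tree_class (spoke (ctr i ?d)) \<otimes>\<^bsub>P\<^esub> inv\<^bsub>P\<^esub> tree_class (spoke (ctr i ?e))"
          using \<phi>_H[OF i(1) de] by simp
        also have "\<dots> = tree_class (path_part p a b)"
          using tree_class_in_patch[OF i(1) pathin_part[OF p] sub] ab by simp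
        finally show ?thesis .
      qed
      then show "\<exists>e>0. \<forall>a b. a \<le> x \<and> x \<le> b \<and> b - a < e \<longrightarrow>
         0 \<le> a \<and> b \<le> 1 \<longrightarrow> \<phi> (inv l a \<otimes> l b) = tree_class (path_part p a b)"
        using e(1) by blast
    qed simp
    then have "\<phi> (holonomy p) = tree_class (path_part p 0 1)" using holonomy_eq[OF p l] by simp
    then show ?thesis by (simp add: path_part_def)
  qed
  define \<psi> where "\<psi> A = holonomy (SOME p. p \<in> A)" for A
  have \<psi>: "\<psi> (loop_class X (q z0) p) = holonomy p" if p: "p \<in> loops X (q z0)" for p
    using holonomy_cong[OF loop_class_rep[OF p]] by (simp add: \<psi>_def)
  have P_obtain: "\<exists>p. A = loop_class X (q z0) p \<and> p \<in> loops X (q z0) \<and> pathin X p \<and> p 0 = q z0 \<and> p 1 = q z0"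
    if A: "A \<in> carrier P" for A
    using A unfolding carrier_fundamental_group by (auto simp: loops_def)
  have \<psi>_hom: "\<psi> \<in> hom P G"
  proof (rule homI)
    show "\<psi> A \<in> carrier G" if "A \<in> carrier P" for A
      using P_obtain[OF that] \<psi> holonomy_closed by metis
    fix A B assume "A \<in> carrier P" "B \<in> carrier P"
    then obtain p r where p: "A = loop_class X (q z0) p" "p \<in> loops X (q z0)" "pathin X p" "p 1 = q z0"
      and r: "B = loop_class X (q z0) r" "r \<in> loops X (q z0)" "pathin X r" "r 0 = q z0"
      using P_obtain by meson
    then show "\<psi> (A \<otimes>\<^bsub>P\<^esub> B) = \<psi> A \<otimes> \<psi> B"
      by (simp add: fundamental_group_mult \<psi> loop_join_closed holonomy_join)
  qed
  interpret \<psi>: group_hom P G \<psi>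
    using \<psi>_hom by (auto simp: group_hom_def group_hom_axioms_def)
  have \<phi>\<psi>: "\<phi> (\<psi> A) = A" if A: "A \<in> carrier P" for A
    using P_obtain[OF A] \<psi> \<phi>_holonomy tree_class_loop by metis
  \<comment> \<open>The loop out along one spoke and back along another has holonomy given by the labels of the two cells.\<close>
  have gens: "\<psi> (\<phi> g) = g" "g \<in> carrier G"
    if g: "g \<in> {inv H i d \<otimes> H i e | i d e. i \<in> I \<and> d \<in> C i \<and> e \<in> C i}" for g
  proof -
    obtain i d e where g: "g = inv H i d \<otimes> H i e" and i: "i \<in> I" "d \<in> C i" "e \<in> C i" using g by blast
    let ?a = "ctr i d" and ?b = "ctr i e"
    have ab: "?a \<in> D" "?b \<in> D" using ctrD i by auto
    note pa = pathin_spoke[OF ab(1)] pathin_spoke[OF ab(2)]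
    have qab: "q ?a = q ?b" using ctr_glued i by blast
    let ?r = "loop_join (spoke ?a) (path_rev (spoke ?b))"
    have r: "?r \<in> loops X (q z0)"
      unfolding loops_def using pa qab by (auto intro!: pathin_loop_join pathin_rev)
    have "\<phi> g = tree_class ?r"
      unfolding g \<phi>_H[OF i] using pa qab tree_class_join[of "spoke ?a" "path_rev (spoke ?b)"]
      by (simp add: pathin_rev tree_class_rev)
    then have "\<phi> g = loop_class X (q z0) ?r" using tree_class_loop[OF r] by simp
    then have 1: "\<psi> (\<phi> g) = holonomy ?r" using \<psi>[OF r] by simp
    have cc: "H i d \<in> carrier G" "H i e \<in> carrier G" "seam ?a \<in> carrier G" "seam ?b \<in> carrier G"
      using H_closed i seam(1) ab by auto
    have "holonomy (path_rev (spoke ?b)) \<otimes> holonomy (spoke ?b) = holonomy (loop_join (path_rev (spoke ?b)) (spoke ?b))"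
      using pa by (intro holonomy_join[symmetric]) (auto intro: pathin_rev)
    also have "\<dots> = holonomy (\<lambda>_. q ?b)" by (intro holonomy_cong[OF path_hom_rev_left]) (auto simp: pa)
    also have "\<dots> = \<one>" using ab topspace_X by (intro holonomy_const) auto
    finally have "holonomy (path_rev (spoke ?b)) = inv seam ?b"
      using pa holonomy_spoke[OF ab(2)] by (metis G.inv_equality holonomy_closed pathin_rev)
    then have 2: "holonomy ?r = seam ?a \<otimes> inv seam ?b"
      using holonomy_join[of "spoke ?a" "path_rev (spoke ?b)"] pa qab holonomy_spoke[OF ab(1)] by (simp add: pathin_rev)
    have Va: "?a \<in> V i" "?b \<in> V i" using ctr_in i by (auto simp: V_def)
    have "F i ?a = H i d" "F i ?b = H i e" using idx_eq ctr_in i by (auto simp: F_def)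
    then have "H i d \<otimes> seam ?a = H i e \<otimes> seam ?b"
      using seam(2)[OF ab(1) i(1) Va(1)] seam(2)[OF ab(2) i(1) Va(2)] qab by simp
    then have "seam ?a = inv H i d \<otimes> (H i e \<otimes> seam ?b)" using cc by (simp add: G.inv_solve_left)
    then have "seam ?a \<otimes> inv seam ?b = g" using cc by (simp add: g G.m_assoc)
    then show "\<psi> (\<phi> g) = g" using 1 2 by simp
    show "g \<in> carrier G" using cc by (simp add: g)
  qed
  have \<psi>\<phi>: "\<psi> (\<phi> g) = g" if "g \<in> carrier G" for g
  proof -
    have "g \<in> generate G {inv H i d \<otimes> H i e | i d e. i \<in> I \<and> d \<in> C i \<and> e \<in> C i}" using gen that by blast
    then have "g \<in> carrier G \<and> \<psi> (\<phi> g) = g"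
      by induction (use gens in \<open>simp_all add: \<phi>.hom_inv\<close>)
    then show ?thesis ..
  qed
  have "bij_betw \<psi> (carrier P) (carrier G)"
    by (rule bij_betwI[where g = \<phi>]) (use \<psi>.hom_closed \<phi>.hom_closed \<phi>\<psi> \<psi>\<phi> in auto)
  with \<psi>_hom show ?thesis unfolding is_iso_def iso_def by blast
qed

end

section \<open>Sectors of the disc\<close>

text \<open>Points of the circle are parametrised by the polygon: corners at integers, midpoints of
  sides at half-integers.\<close>

definition circle_point :: "nat \<Rightarrow> real \<Rightarrow> complex" where
  "circle_point n a = cis (2 * pi * a / real n)"

lemma polygon_side_circle_point: "polygon_side n k t = circle_point n (real k + t)"
  by (simp add: polygon_side_def circle_point_def)

lemma norm_circle_point [simp]: "norm (circle_point n a) = 1"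
  by (simp add: circle_point_def)

lemma circle_point_nonzero [simp]: "circle_point n a \<noteq> 0"
  by (metis norm_circle_point norm_zero zero_neq_one)

lemma circle_point_eq_iff:
  assumes "n > 0"
  shows "circle_point n a = circle_point n b \<longleftrightarrow> (\<exists>N. a = b + real_of_int N * real n)"
proof -
  have "circle_point n a = circle_point n b \<longleftrightarrow>
      (\<exists>N::int. \<i> * complex_of_real (2 * pi * a / n) = \<i> * complex_of_real (2 * pi * b / n) + (of_int (2 * N) * pi) * \<i>)"
    by (simp add: circle_point_def cis_conv_exp exp_eq)
  also have "\<dots> \<longleftrightarrow> (\<exists>N::int. 2 * pi * a / n = 2 * pi * b / n + 2 * N * pi)"
    by (intro iff_exI) (auto simp: complex_eq_iff)
  also have "\<dots> \<longleftrightarrow> (\<exists>N. a = b + real_of_int N * real n)"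
  proof (intro iff_exI)
    fix N :: int
    have "2 * pi * b / n + 2 * real_of_int N * pi = 2 * pi * (b + real_of_int N * real n) / n" using assms by (simp add: field_simps)
    then show "2 * pi * a / n = 2 * pi * b / n + 2 * real_of_int N * pi \<longleftrightarrow> a = b + real_of_int N * real n"
      using assms by simp
  qed
  finally show ?thesis .
qed

lemma circle_point_add: "circle_point n (a + b) = circle_point n a * circle_point n b"
  by (simp add: circle_point_def cis_mult add_divide_distrib distrib_left)

text \<open>The points of the disc, other than the centre, whose angle differs from that of the point
  \<open>a\<close> by less than half a side. The condition on the non-positive reals makes the logarithm
  continuous.\<close>

definition sector :: "nat \<Rightarrow> real \<Rightarrow> complex set" where
  "sector n a = {z \<in> cball 0 1. z / circle_point n a \<notin> \<real>\<^sub>\<le>\<^sub>0 \<and>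
     \<bar>Im (Ln (z / circle_point n a))\<bar> < pi / real n}"

text \<open>In logarithmic polar coordinates at the point \<open>a\<close> this is the straight contraction to \<open>0\<close>.
  It therefore maps the boundary circle to itself, linearly in the angle, as compatibility with
  the gluing of sides requires.\<close>

definition sector_contraction :: "nat \<Rightarrow> real \<Rightarrow> real \<times> complex \<Rightarrow> complex" where
  "sector_contraction n a = (\<lambda>(t, z). circle_point n a * exp (of_real (1 - t) * Ln (z / circle_point n a)))"

lemma sector_open: "openin (top_of_set (cball 0 1)) (sector n a)"
proof -
  let ?O = "{z. z / circle_point n a \<notin> \<real>\<^sub>\<le>\<^sub>0}"
  have "open ?O"
    using open_vimage[of "- \<real>\<^sub>\<le>\<^sub>0" "\<lambda>z. z / circle_point n a"]
    by (simp add: vimage_def closed_nonpos_Reals_complex continuous_intros open_Compl)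
  moreover have "continuous_on ?O (\<lambda>z. \<bar>Im (Ln (z / circle_point n a))\<bar>)"
    by (intro continuous_intros) auto
  ultimately have "open (?O \<inter> (\<lambda>z. \<bar>Im (Ln (z / circle_point n a))\<bar>) -` {..<pi / real n})"
    by (intro continuous_open_preimage) auto
  moreover have "sector n a = cball 0 1 \<inter> (?O \<inter> (\<lambda>z. \<bar>Im (Ln (z / circle_point n a))\<bar>) -` {..<pi / real n})"
    by (auto simp: sector_def)
  ultimately show ?thesis by (metis openin_open)
qed

lemma sector_contraction_cont: "continuous_on ({0..1} \<times> sector n a) (sector_contraction n a)"
  unfolding sector_contraction_def case_prod_unfold
  by (intro continuous_intros) (auto simp: sector_def)

lemma sector_nonzero: "z \<in> sector n a \<Longrightarrow> z / circle_point n a \<noteq> 0"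
  by (auto simp: sector_def)

lemma sector_contraction_0: "z \<in> sector n a \<Longrightarrow> sector_contraction n a (0, z) = z"
  using sector_nonzero[of z n a] by (simp add: sector_contraction_def)

lemma sector_contraction_1: "sector_contraction n a (1, z) = circle_point n a"
  by (simp add: sector_contraction_def)

lemma sector_contraction_in:
  assumes z: "z \<in> sector n a" and t: "t \<in> {0..1}"
  shows "sector_contraction n a (t, z) \<in> cball 0 1"
proof -
  have nz: "z / circle_point n a \<noteq> 0" "norm (z / circle_point n a) \<le> 1" "z \<noteq> 0"
    using sector_nonzero[OF z] z by (auto simp: sector_def norm_divide)
  have "Re (Ln (z / circle_point n a)) \<le> 0"
    using nz by (simp add: Re_Ln norm_divide)
  then have "(1 - t) * Re (Ln (z / circle_point n a)) \<le> 0"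
    using t by (simp add: mult_nonneg_nonpos)
  then show ?thesis by (simp add: sector_contraction_def norm_mult)
qed

lemma Ln_circle_point:
  assumes "n \<ge> 4" "\<bar>x\<bar> < 1 / 2"
  shows "Ln (circle_point n x) = \<i> * of_real (2 * pi * x / n)"
proof -
  have "\<bar>2 * pi * x / n\<bar> < pi"
  proof -
    have "\<bar>2 * pi * x / n\<bar> = pi * (2 * \<bar>x\<bar> / n)" using assms by (simp add: abs_mult)
    also have "2 * \<bar>x\<bar> / n < 1" using assms by (simp add: field_simps)
    then have "pi * (2 * \<bar>x\<bar> / n) < pi * 1" by (intro mult_strict_left_mono) auto
    finally show ?thesis by simp
  qed
  then have "- pi < 2 * pi * x / n" "2 * pi * x / n < pi" by (simp_all only: abs_less_iff) linarith
  then show ?thesis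
    unfolding circle_point_def cis_conv_exp by (intro Ln_exp) auto
qed

lemma circle_point_in_sector:
  assumes "n \<ge> 4" "\<bar>x\<bar> < 1 / 2"
  shows "circle_point n (a + x) \<in> sector n a"
    and "sector_contraction n a (t, circle_point n (a + x)) = circle_point n (a + (1 - t) * x)"
proof -
  have e: "circle_point n (a + x) / circle_point n a = circle_point n x"
    by (simp add: circle_point_add)
  note L = Ln_circle_point[OF assms]
  have b: "\<bar>2 * pi * x / n\<bar> < pi / n"
  proof -
    have "pi * (2 * \<bar>x\<bar>) < pi * 1" using assms by (intro mult_strict_left_mono) auto
    then show ?thesis using assms by (simp add: abs_mult divide_strict_right_mono)
  qed
  have "circle_point n x \<notin> \<real>\<^sub>\<le>\<^sub>0"
  proof
    assume "circle_point n x \<in> \<real>\<^sub>\<le>\<^sub>0"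
    then have "Im (Ln (circle_point n x)) = pi"
      by (metis circle_point_nonzero Im_Ln_eq_pi complex_nonpos_Reals_iff less_eq_real_def complex_eq_iff zero_complex.simps)
    moreover have "pi / n \<le> pi" using assms by (simp add: field_simps)
    ultimately show False using b by (simp add: L)
  qed
  then show "circle_point n (a + x) \<in> sector n a"
    using b by (simp add: sector_def e L)
  have "exp (of_real (1 - t) * Ln (circle_point n x)) = circle_point n ((1 - t) * x)"
    by (simp only: L) (simp add: circle_point_def cis_conv_exp algebra_simps)
  then show "sector_contraction n a (t, circle_point n (a + x)) = circle_point n (a + (1 - t) * x)"
    unfolding sector_contraction_def by (simp add: e circle_point_add[of n a "(1 - t) * x"])
qed

lemma sector_polar:
  assumes "n > 0" "z \<in> sector n a"
  obtains x where "\<bar>x\<bar> < 1 / 2" "z = norm z * circle_point n (a + x)"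
proof -
  let ?w = "Ln (z / circle_point n a)"
  define x where "x = Im ?w * n / (2 * pi)"
  have nz: "z / circle_point n a \<noteq> 0" using sector_nonzero[OF assms(2)] .
  have "\<bar>Im ?w\<bar> < pi / n" using assms by (simp add: sector_def)
  then have "\<bar>Im ?w\<bar> * n < pi" using assms by (simp add: field_simps)
  then have 1: "\<bar>x\<bar> < 1 / 2" by (simp add: x_def abs_mult field_simps)
  have "z / circle_point n a = exp ?w" using nz by simp
  also have "\<dots> = exp (Re ?w) * cis (Im ?w)" by (simp add: exp_eq_polar)
  also have "exp (Re ?w) = norm z" using nz by (simp add: Re_Ln norm_divide)
  also have "cis (Im ?w) = circle_point n x" using assms by (simp add: circle_point_def x_def)
  finally have "z = norm z * circle_point n (a + x)"
    by (simp add: circle_point_add field_simps)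
  with 1 show thesis by (rule that)
qed

lemma sector_circle_point:
  assumes n: "n > 0" and z: "circle_point n b \<in> sector n a"
  obtains N :: int where "\<bar>b - a - N * n\<bar> < 1 / 2"
proof -
  obtain x where x: "\<bar>x\<bar> < 1 / 2" "circle_point n b = norm (circle_point n b) * circle_point n (a + x)"
    using sector_polar[OF n z] by blast
  then obtain N :: int where "b = a + x + N * n" using circle_point_eq_iff[OF n] by auto
  then show thesis using x by (intro that[of N]) simp
qed

lemma sector_overlap:
  assumes n: "n > 0" and z: "z \<in> sector n a" "z \<in> sector n b"
  obtains N :: int where "\<bar>a - b - N * n\<bar> < 1"
proof -
  obtain x where x: "\<bar>x\<bar> < 1 / 2" "z = norm z * circle_point n (a + x)"
    using sector_polar[OF n z(1)] by blast
  obtain y where y: "\<bar>y\<bar> < 1 / 2" "z = norm z * circle_point n (b + y)"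
    using sector_polar[OF n z(2)] by blast
  have "norm z \<noteq> 0" using sector_nonzero[OF z(1)] by auto
  then have "circle_point n (a + x) = circle_point n (b + y)" using x y by (metis mult_cancel_left of_real_eq_0_iff)
  then obtain N :: int where "a + x = b + y + N * n" using circle_point_eq_iff[OF n] by auto
  then show thesis using x y by (intro that[of N]) linarith
qed

lemma circle_point_exists:
  assumes n: "n > 0" and z: "norm z = 1"
  obtains k t where "k < n" "t \<in> {0..<1}" "z = circle_point n (real k + t)"
proof -
  define a where "a = Arg2pi z * n / (2 * pi)"
  have "z = cis (Arg2pi z)" using z Arg2pi_eq[of z] by (simp add: cis_conv_exp)
  then have za: "z = circle_point n a" using n by (simp add: circle_point_def a_def)
  have a: "0 \<le> a" "a < n"
    using Arg2pi_ge_0[of z] Arg2pi_lt_2pi[of z] n by (auto simp: a_def field_simps)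
  define k where "k = nat \<lfloor>a\<rfloor>"
  have "real k \<le> a" "a < real k + 1" using a by (auto simp: k_def)
  moreover have "k < n" using a by (simp add: k_def) linarith
  ultimately show thesis using za by (intro that[of k "a - k"]) auto
qed

section \<open>Patches of the polygon\<close>

definition surface_map :: "nat \<Rightarrow> complex \<Rightarrow> (complex \<times> real) set" where
  "surface_map g z = side_gluing g `` {(z, 0)}"

lemma surface_map_eq_iff:
  assumes "z \<in> cball 0 1" "w \<in> cball 0 1"
  shows "surface_map g z = surface_map g w \<longleftrightarrow> equivclp (side_pairing g) z w"
proof -
  have "(z, 0) \<in> disc" "(w, 0) \<in> disc" using assms by (auto simp: disc_def)
  then show ?thesis
    unfolding surface_map_def using eq_equiv_class_iff[OF equiv_side_gluing, of "(z, 0)" "(w, 0)" g]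
    by (simp add: side_gluing_def)
qed

lemma quotient_map_surface_map:
  assumes "g \<ge> 1"
  shows "quotient_map (top_of_set (cball 0 1)) (surface g) (surface_map g)"
proof -
  have "homeomorphic_maps (top_of_set (cball 0 1)) (top_of_set disc) (\<lambda>z::complex. (z, 0::real)) fst"
    by (auto simp: homeomorphic_maps_def disc_def continuous_map_in_subtopology intro!: continuous_intros)
  then have "quotient_map (top_of_set (cball 0 1)) (top_of_set disc) (\<lambda>z::complex. (z, 0::real))"
    by (simp only: homeomorphic_maps_map homeomorphic_map_def)
  from quotient_map_compose[OF this quotient_map_quotient_space[of _ "side_gluing g"]]
  show ?thesis using assms by (simp add: surface_def surface_map_def[abs_def] o_def)
qed

text \<open>Sides are paired with their second neighbour; the sides that come first in their pair are
  those with \<open>k mod 4 < 2\<close>. The partner of the point \<open>k + t\<close> is \<open>k + 2 + (1 - t)\<close>.\<close>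

lemma side_pairing_iff:
  "side_pairing g z w \<longleftrightarrow> (\<exists>k<4 * g. k mod 4 < 2 \<and> (\<exists>t\<in>{0..1}.
     z = circle_point (4 * g) (real k + t) \<and> w = circle_point (4 * g) (real k + 3 - t)))"
proof
  assume "side_pairing g z w"
  then obtain i t where i: "i < g" and t: "t \<in> {0..1}" and zw:
    "(z = polygon_side (4 * g) (4 * i) t \<and> w = polygon_side (4 * g) (4 * i + 2) (1 - t)) \<or>
     (z = polygon_side (4 * g) (4 * i + 1) t \<and> w = polygon_side (4 * g) (4 * i + 3) (1 - t))"
    unfolding side_pairing_def by blast
  have e: "4 * real i + 2 + (1 - t) = 4 * real i + 3 - t" "4 * real i + 3 + (1 - t) = 4 * real i + 1 + 3 - t"
    by simp_all
  from zw show "\<exists>k<4 * g. k mod 4 < 2 \<and> (\<exists>t\<in>{0..1}.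
     z = circle_point (4 * g) (real k + t) \<and> w = circle_point (4 * g) (real k + 3 - t))"
  proof
    assume "z = polygon_side (4 * g) (4 * i) t \<and> w = polygon_side (4 * g) (4 * i + 2) (1 - t)"
    then show ?thesis using i t
      by (intro exI[of _ "4 * i"] conjI bexI[of _ t]) (simp_all add: polygon_side_circle_point e algebra_simps)
  next
    assume "z = polygon_side (4 * g) (4 * i + 1) t \<and> w = polygon_side (4 * g) (4 * i + 3) (1 - t)"
    moreover have "(4 * i + 1) mod 4 < 2" by presburger
    ultimately show ?thesis using i t
      by (intro exI[of _ "4 * i + 1"] conjI bexI[of _ t]) (simp_all add: polygon_side_circle_point e algebra_simps)
  qed
next
  assume "\<exists>k<4 * g. k mod 4 < 2 \<and> (\<exists>t\<in>{0..1}.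
     z = circle_point (4 * g) (real k + t) \<and> w = circle_point (4 * g) (real k + 3 - t))"
  then obtain k t where k: "k < 4 * g" "k mod 4 < 2" and t: "t \<in> {0..1}"
    and zw: "z = circle_point (4 * g) (real k + t)" "w = circle_point (4 * g) (real k + 3 - t)" by blast
  define i where "i = k div 4"
  have "i < g" using k by (simp add: i_def)
  have "k = 4 * i \<or> k = 4 * i + 1" using k unfolding i_def by presburger
  then show "side_pairing g z w"
  proof
    assume "k = 4 * i"
    then have "z = polygon_side (4 * g) (4 * i) t \<and> w = polygon_side (4 * g) (4 * i + 2) (1 - t)"
      using zw by (simp add: polygon_side_circle_point algebra_simps)
    then show ?thesis unfolding side_pairing_def using \<open>i < g\<close> t by blast
  next
    assume k1: "k = 4 * i + 1"
    have "real k + 3 - t = real (4 * i + 3) + (1 - t)" using k1 by simp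
    then have "z = polygon_side (4 * g) (4 * i + 1) t \<and> w = polygon_side (4 * g) (4 * i + 3) (1 - t)"
      using zw k1 by (simp only: polygon_side_circle_point)
    then show ?thesis unfolding side_pairing_def using \<open>i < g\<close> t by blast
  qed
qed

text \<open>\<open>Edge k\<close> is the patch around the midpoint of the edge that comes from the sides \<open>k\<close> and
  \<open>k + 2\<close>. The centres of the cells of \<open>Corner\<close> are all corners of the polygon, as these are
  identified to one vertex.\<close>

datatype patch = Face | Corner | Edge nat

definition patches :: "nat \<Rightarrow> patch set" where
  "patches n = insert Face (insert Corner (Edge ` {k. k < n \<and> k mod 4 < 2}))"

fun centres :: "nat \<Rightarrow> patch \<Rightarrow> real set" where
  "centres n Face = {0}"
| "centres n Corner = real ` {..<n}"
| "centres n (Edge k) = {k + 1/2, k + 5/2}"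

definition cell :: "nat \<Rightarrow> patch \<Rightarrow> real \<Rightarrow> complex set" where
  "cell n i a = (if i = Face then ball 0 1 else sector n a)"

definition cell_centre :: "nat \<Rightarrow> patch \<Rightarrow> real \<Rightarrow> complex" where
  "cell_centre n i a = (if i = Face then 0 else circle_point n a)"

definition cell_contraction :: "nat \<Rightarrow> patch \<Rightarrow> real \<Rightarrow> real \<times> complex \<Rightarrow> complex" where
  "cell_contraction n i a =
     (if i = Face then (\<lambda>(t, z). of_real (1 - t) * z) else sector_contraction n a)"

fun label :: "('g, 'm) monoid_scheme \<Rightarrow> (nat \<Rightarrow> 'g) \<Rightarrow> (nat \<Rightarrow> 'g) \<Rightarrow> patch \<Rightarrow> real \<Rightarrow> 'g" where
  "label K h \<gamma> Face a = \<one>\<^bsub>K\<^esub>"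
| "label K h \<gamma> Corner a = h (nat \<lfloor>a\<rfloor>)"
| "label K h \<gamma> (Edge k) a = (if a = k + 1/2 then \<one>\<^bsub>K\<^esub> else \<gamma> k)"

text \<open>Of all the cells, a point on a side can lie only in the sector of the nearer end of that
  side, and, unless it is an end, in that of the midpoint.\<close>

lemma side_point_in_cell:
  assumes n: "n = 4 * g" and j: "j < n" and \<tau>: "\<tau> \<in> {0..1}" and i: "i \<in> patches n" "a \<in> centres n i"
    and z: "circle_point n (j + \<tau>) \<in> cell n i a"
  shows "(i = Corner \<and> \<tau> < 1/2 \<and> a = j) \<or> (i = Corner \<and> \<tau> > 1/2 \<and> a = real ((j + 1) mod n)) \<or>
    (\<exists>m<n. m mod 4 < 2 \<and> i = Edge m \<and> 0 < \<tau> \<and> \<tau> < 1 \<and> a = j + 1/2 \<and> (j = m \<or> j = m + 2))"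
proof (cases i)
  case Face
  then show ?thesis using z by (simp add: cell_def)
next
  case Corner
  then obtain l where l: "l < n" "a = real l" using i by auto
  have s: "circle_point n (j + \<tau>) \<in> sector n l" using z Corner l by (simp add: cell_def)
  have "n > 0" using j by simp
  then obtain N :: int where N: "\<bar>real j + \<tau> - real l - N * n\<bar> < 1 / 2" using sector_circle_point[OF _ s] by blast
  \<comment> \<open>The integer distance of the two corners is near the parameter in the unit interval, so it is 0 or 1.\<close>
  define r where "r = int l + N * int n - int j"
  have r: "\<bar>\<tau> - real_of_int r\<bar> < 1/2" using N by (simp add: r_def algebra_simps)
  then have "real_of_int r > -1" "real_of_int r < 2"
    using \<tau> unfolding abs_less_iff atLeastAtMost_iff by linarith+
  then have "r = 0 \<or> r = 1" by linarith
  moreover have "int l = (int j + r) mod int n"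
  proof -
    have "int j + r = int l + N * int n" by (simp add: r_def)
    then show ?thesis using l by simp
  qed
  ultimately show ?thesis
  proof (elim disjE)
    assume r0: "r = 0" and "int l = (int j + r) mod int n"
    then have "l = j" using j by simp
    then show ?thesis using r r0 l Corner by auto
  next
    assume r1: "r = 1" and "int l = (int j + r) mod int n"
    then have "int l = int ((j + 1) mod n)" by (simp add: zmod_int add.commute)
    then have "l = (j + 1) mod n" by linarith
    then show ?thesis using r r1 l Corner by auto
  qed
next
  case (Edge m)
  then have m: "m < n" "m mod 4 < 2" using i by (auto simp: patches_def)
  then have m2: "m + 2 < n" using n by presburger
  obtain l where l: "a = real l + 1/2" "l = m \<or> l = m + 2" "l < n"
    using i(2) Edge m m2 by (cases "a = m + 1/2") (auto intro: that[of m] that[of "m + 2"])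
  have s: "circle_point n (j + \<tau>) \<in> sector n a" using z Edge by (simp add: cell_def)
  have "n > 0" using j by simp
  then obtain N :: int where N: "\<bar>real j + \<tau> - a - N * n\<bar> < 1 / 2" using sector_circle_point[OF _ s] by blast
  define r where "r = int l + N * int n - int j"
  have r: "\<bar>\<tau> - 1/2 - real_of_int r\<bar> < 1/2" using N l by (simp add: r_def algebra_simps)
  then have "real_of_int r > -1" "real_of_int r < 1"
    using \<tau> unfolding abs_less_iff atLeastAtMost_iff by linarith+
  then have r0: "r = 0" by linarith
  have "int j + r = int l + N * int n" by (simp add: r_def)
  then have "int l = int j mod int n" using l r0 by simp
  then have "l = j" using j by simp
  moreover have "0 < \<tau>" "\<tau> < 1" using r r0 unfolding abs_less_iff by simp_all
  ultimately show ?thesis using l Edge m by auto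
qed

lemma cell_contraction_on_side:
  assumes n: "n \<ge> 4" and i: "i \<noteq> Face" and x: "\<bar>\<tau> - \<sigma>\<bar> < 1/2"
    and a: "circle_point n a = circle_point n (b + \<sigma>)"
  shows "circle_point n (b + \<tau>) \<in> cell n i a"
    and "cell_contraction n i a (t, circle_point n (b + \<tau>)) = circle_point n (b + (\<sigma> + (1 - t) * (\<tau> - \<sigma>)))"
proof -
  have e: "sector n a = sector n (b + \<sigma>)" "sector_contraction n a = sector_contraction n (b + \<sigma>)"
    by (simp_all add: sector_def sector_contraction_def a)
  have "b + \<tau> = (b + \<sigma>) + (\<tau> - \<sigma>)" by simp
  then show "circle_point n (b + \<tau>) \<in> cell n i a"
    using circle_point_in_sector(1)[OF n x, of "b + \<sigma>"] i by (simp add: cell_def e)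
  show "cell_contraction n i a (t, circle_point n (b + \<tau>)) = circle_point n (b + (\<sigma> + (1 - t) * (\<tau> - \<sigma>)))"
    using circle_point_in_sector(2)[OF n x, of "b + \<sigma>" t] i by (simp add: cell_contraction_def e add.assoc)
qed

text \<open>On the side \<open>k\<close> the cell of patch \<open>i\<close> with centre \<open>a\<close> meets the side around the parameter
  \<open>\<sigma>\<close>, and on the partner side the cell with centre \<open>b\<close> does so around \<open>1 - \<sigma>\<close>.\<close>

definition matching :: "nat \<Rightarrow> nat \<Rightarrow> patch \<Rightarrow> real \<Rightarrow> real \<Rightarrow> real \<Rightarrow> bool" where
  "matching n k i a b \<sigma> \<longleftrightarrow>
     (i = Corner \<and> a = k \<and> b = real ((k + 3) mod n) \<and> \<sigma> = 0) \<or>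
     (i = Corner \<and> a = real ((k + 1) mod n) \<and> b = real k + 2 \<and> \<sigma> = 1) \<or>
     (i = Edge k \<and> a = k + 1/2 \<and> b = k + 5/2 \<and> \<sigma> = 1/2)"

lemma circle_point_mod: "n > 0 \<Longrightarrow> circle_point n (real (m mod n)) = circle_point n (real m)"
proof -
  assume n: "n > 0"
  have "real (m mod n) = real m + real_of_int (- int (m div n)) * real n"
  proof -
    have "real m = real (m div n) * real n + real (m mod n)"
      by (metis of_nat_add of_nat_mult div_mult_mod_eq)
    then show ?thesis by simp
  qed
  then show ?thesis using circle_point_eq_iff[OF n] by blast
qed

context
  fixes g n k :: nat
  assumes n: "n = 4 * g" and k: "k < n" "k mod 4 < 2"
begin

lemma matching_centres:
  assumes "matching n k i a b \<sigma>"
  shows "i \<in> patches n" "i \<noteq> Face" "a \<in> centres n i" "b \<in> centres n i" "\<sigma> \<in> {0..1}"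
    "circle_point n a = circle_point n (real k + \<sigma>)" "circle_point n b = circle_point n (real k + 3 - \<sigma>)"
proof -
  have n0: "n > 0" "k + 2 < n" using k n by presburger+
  have l: "(k + 3) mod n < n" "(k + 1) mod n < n" using n0 by simp_all
  have e: "circle_point n (real ((k + 3) mod n)) = circle_point n (k + 3)"
    "circle_point n (real ((k + 1) mod n)) = circle_point n (k + 1)"
    using circle_point_mod[OF n0(1), of "k + 3"] circle_point_mod[OF n0(1), of "k + 1"] by (simp_all add: add_ac)
  have m: "real k \<in> real ` {..<n}" "real k + 2 \<in> real ` {..<n}"
    "real ((k + 1) mod n) \<in> real ` {..<n}" "real ((k + 3) mod n) \<in> real ` {..<n}"
    using k(1) l image_eqI[of "real k + 2" real "k + 2" "{..<n}"] n0(2) by (auto simp del: mod_less)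
  show "i \<in> patches n" "i \<noteq> Face" "\<sigma> \<in> {0..1}"
    using assms k by (auto simp: matching_def patches_def)
  show "a \<in> centres n i" "b \<in> centres n i"
    using assms m unfolding matching_def by (metis centres.simps(2,3) insertCI)+
  consider "a = real k" "b = real ((k + 3) mod n)" "\<sigma> = 0"
    | "a = real ((k + 1) mod n)" "b = real k + 2" "\<sigma> = 1"
    | "a = real k + 1/2" "b = real k + 5/2" "\<sigma> = 1/2"
    using assms unfolding matching_def by blast
  then have "circle_point n a = circle_point n (real k + \<sigma>) \<and> circle_point n b = circle_point n (real k + 3 - \<sigma>)"
  proof cases
    case 1
    have "real k + 0 = real k" "real k + 3 - 0 = real (k + 3)" by simp_all
    then show ?thesis by (simp only: 1 e simp_thms)
  next
    case 2
    have "real k + 3 - 1 = real k + 2" by simp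
    then show ?thesis by (simp only: 2 e simp_thms) (simp add: add.commute)
  next
    case 3
    have "real k + 3 - 1/2 = real k + 5/2" by simp
    then show ?thesis by (simp only: 3 simp_thms)
  qed
  then show "circle_point n a = circle_point n (real k + \<sigma>)" "circle_point n b = circle_point n (real k + 3 - \<sigma>)"
    by blast+
qed

lemma cell_matching_left:
  assumes t: "t \<in> {0..1}" and i: "i \<in> patches n" "a \<in> centres n i"
    and z: "circle_point n (real k + t) \<in> cell n i a"
  shows "\<exists>b \<sigma>. matching n k i a b \<sigma> \<and> \<bar>t - \<sigma>\<bar> < 1/2"
  using side_point_in_cell[OF n k(1) t i z]
proof (elim disjE exE conjE)
  assume "i = Corner" "t < 1/2" "a = real k"
  then show ?thesis using t
    by (intro exI[of _ "real ((k + 3) mod n)"] exI[of _ 0]) (auto simp: matching_def)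
next
  assume "i = Corner" "t > 1/2" "a = real ((k + 1) mod n)"
  then show ?thesis using t
    by (intro exI[of _ "real k + 2"] exI[of _ 1]) (auto simp: matching_def)
next
  fix m assume "i = Edge m" "k = m" "0 < t" "t < 1" "a = real k + 1/2"
  then show ?thesis
    by (intro exI[of _ "real k + 5/2"] exI[of _ "1/2"]) (auto simp: matching_def abs_if)
next
  fix m assume "k = m + 2" "m mod 4 < 2"
  then have False using k(2) by presburger
  then show ?thesis ..
qed

lemma cell_matching_right:
  assumes t: "t \<in> {0..1}" and i: "i \<in> patches n" "b \<in> centres n i"
    and z: "circle_point n (real k + 3 - t) \<in> cell n i b"
  shows "\<exists>a \<sigma>. matching n k i a b \<sigma> \<and> \<bar>t - \<sigma>\<bar> < 1/2"
proof -
  have k2: "k + 2 < n" using k n by presburger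
  have e: "real k + 3 - t = real (k + 2) + (1 - t)" by simp
  have t': "1 - t \<in> {0..1}" using t by auto
  have e1: "k + 2 + 1 = k + 3" by simp
  from side_point_in_cell[OF n k2 t' i] z show ?thesis unfolding e e1
  proof (elim disjE exE conjE meta_impE)
    assume "i = Corner" "1 - t < 1/2" "b = real (k + 2)"
    then show ?thesis using t
      by (intro exI[of _ "real ((k + 1) mod n)"] exI[of _ 1]) (auto simp: matching_def)
  next
    assume "i = Corner" "1 - t > 1/2" "b = real ((k + 3) mod n)"
    then show ?thesis using t
      by (intro exI[of _ "real k"] exI[of _ 0]) (auto simp: matching_def)
  next
    fix m assume "i = Edge m" "k + 2 = m + 2" "0 < 1 - t" "1 - t < 1" "b = real (k + 2) + 1/2"
    then show ?thesis
      by (intro exI[of _ "real k + 1/2"] exI[of _ "1/2"]) (auto simp: matching_def abs_if)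
  next
    fix m assume "k + 2 = m" "m mod 4 < 2"
    then have False using k(2) by presburger
    then show ?thesis ..
  qed
qed

lemma matching_contraction:
  assumes m: "matching n k i a b \<sigma>" and t: "\<bar>t - \<sigma>\<bar> < 1/2" and ts: "t \<in> {0..1}"
  shows "circle_point n (real k + t) \<in> cell n i a" "circle_point n (real k + 3 - t) \<in> cell n i b"
    "\<forall>s\<in>{0..1}. surface_map g (cell_contraction n i a (s, circle_point n (real k + t))) =
       surface_map g (cell_contraction n i b (s, circle_point n (real k + 3 - t)))"
proof -
  note mc = matching_centres[OF m]
  have n4: "n \<ge> 4" using k n by presburger
  have t': "\<bar>(- t) - (- \<sigma>)\<bar> < 1/2" using t by linarith
  have b: "circle_point n b = circle_point n ((k + 3) + (- \<sigma>))" using mc(7) by simp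
  note L = cell_contraction_on_side[OF n4 mc(2) t mc(6)]
  note R = cell_contraction_on_side[OF n4 mc(2) t' b]
  show "circle_point n (real k + t) \<in> cell n i a" by (rule L)
  show "circle_point n (real k + 3 - t) \<in> cell n i b" using R(1) by simp
  show "\<forall>s\<in>{0..1}. surface_map g (cell_contraction n i a (s, circle_point n (real k + t))) =
       surface_map g (cell_contraction n i b (s, circle_point n (real k + 3 - t)))"
  proof
    fix s :: real assume s: "s \<in> {0..1}"
    define x where "x = \<sigma> + (1 - s) * (t - \<sigma>)"
    have x: "x \<in> {0..1}"
      using convexD_alt[of "{0..1::real}" \<sigma> t "1 - s"] mc(5) ts s by (simp add: x_def algebra_simps)
    have "cell_contraction n i a (s, circle_point n (real k + t)) = circle_point n (real k + x)"
      using L(2)[of s] by (simp add: x_def)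
    moreover have "cell_contraction n i b (s, circle_point n (real k + 3 - t)) = circle_point n (real k + 3 - x)"
      using R(2)[of s] by (simp add: x_def algebra_simps)
    moreover have "side_pairing g (circle_point n (real k + x)) (circle_point n (real k + 3 - x))"
      unfolding side_pairing_iff using k x n by blast
    then have "surface_map g (circle_point n (real k + x)) = surface_map g (circle_point n (real k + 3 - x))"
      by (subst surface_map_eq_iff) auto
    ultimately show "surface_map g (cell_contraction n i a (s, circle_point n (real k + t))) =
       surface_map g (cell_contraction n i b (s, circle_point n (real k + 3 - t)))" by simp
  qed
qed

end

section \<open>The polygon as a glued convex set\<close>

lemma side_pairing_norm: "side_pairing g z w \<Longrightarrow> norm z = 1 \<and> norm w = 1"
  by (auto simp: side_pairing_iff)

lemma equivclp_side_pairing_0: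
  assumes "equivclp (side_pairing g) 0 z"
  shows "z = 0"
  using assms by (induction rule: equivclp_induct) (auto dest: side_pairing_norm)

context
  fixes K :: "('g, 'm) monoid_scheme" (structure) and g n :: nat and h \<gamma> :: "nat \<Rightarrow> 'g"
  assumes K: "group K" and n: "n = 4 * g" and g: "g \<ge> 1"
    and h: "\<And>j. j < n \<Longrightarrow> h j \<in> carrier K"
    and \<gamma>: "\<And>k. k < n \<Longrightarrow> k mod 4 < 2 \<Longrightarrow> \<gamma> k \<in> carrier K"
    and h_first: "\<And>k. k < n \<Longrightarrow> k mod 4 < 2 \<Longrightarrow> h ((k + 3) mod n) = h k \<otimes> \<gamma> k"
    and h_second: "\<And>k. k < n \<Longrightarrow> k mod 4 < 2 \<Longrightarrow> h (k + 2) = h (k + 1) \<otimes> \<gamma> k"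
begin

interpretation K: group K by (rule K)

lemma label_closed: "i \<in> patches n \<Longrightarrow> a \<in> centres n i \<Longrightarrow> label K h \<gamma> i a \<in> carrier K"
  by (cases i) (auto simp: patches_def h \<gamma>)

text \<open>This is where the equations for the corner labels come from: the start of a side is glued to
  the end of its partner, and its end to the start of the partner.\<close>

lemma label_matching:
  assumes k: "k < n" "k mod 4 < 2" and m: "matching n k i a b \<sigma>"
  shows "label K h \<gamma> i b = label K h \<gamma> i a \<otimes> \<gamma> k"
proof -
  have k2: "k + 2 < n" using k n by presburger
  then have k1: "(k + 1) mod n = k + 1" by simp
  have fl: "nat \<lfloor>real j\<rfloor> = j" for j by simp
  have "real k + 2 = real (k + 2)" by simp
  then show ?thesis
    using m h_first[OF k] h_second[OF k] \<gamma>[OF k] unfolding matching_def k1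
    by (elim disjE conjE) (simp_all only: label.simps fl if_True if_False K.l_one, simp)
qed

definition glued :: "complex \<Rightarrow> complex \<Rightarrow> 'g \<Rightarrow> bool" where
  "glued z w x \<longleftrightarrow> x \<in> carrier K \<and> (\<forall>i\<in>patches n. \<forall>d\<in>centres n i. z \<in> cell n i d \<longrightarrow>
     (\<exists>e\<in>centres n i. w \<in> cell n i e \<and> label K h \<gamma> i e = label K h \<gamma> i d \<otimes> x \<and>
       (\<forall>t\<in>{0..1}. surface_map g (cell_contraction n i d (t, z)) = surface_map g (cell_contraction n i e (t, w)))))"

lemma glued_refl: "glued z z \<one>"
  unfolding glued_def by (auto simp: label_closed)

lemma glued_trans:
  assumes "glued z w x" "glued w v y"
  shows "glued z v (x \<otimes> y)"
  unfolding glued_def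
proof (intro conjI ballI impI)
  show "x \<otimes> y \<in> carrier K" using assms by (auto simp: glued_def)
  fix i d assume i: "i \<in> patches n" "d \<in> centres n i" "z \<in> cell n i d"
  then obtain e where e: "e \<in> centres n i" "w \<in> cell n i e" "label K h \<gamma> i e = label K h \<gamma> i d \<otimes> x"
    "\<forall>t\<in>{0..1}. surface_map g (cell_contraction n i d (t, z)) = surface_map g (cell_contraction n i e (t, w))"
    using assms(1) unfolding glued_def by blast
  then obtain f where f: "f \<in> centres n i" "v \<in> cell n i f" "label K h \<gamma> i f = label K h \<gamma> i e \<otimes> y"
    "\<forall>t\<in>{0..1}. surface_map g (cell_contraction n i e (t, w)) = surface_map g (cell_contraction n i f (t, v))"
    using assms(2) i unfolding glued_def by blast
  have "label K h \<gamma> i f = label K h \<gamma> i d \<otimes> (x \<otimes> y)"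
    using e(3) f(3) assms label_closed[OF i(1,2)] by (simp add: K.m_assoc glued_def)
  then show "\<exists>e\<in>centres n i. v \<in> cell n i e \<and> label K h \<gamma> i e = label K h \<gamma> i d \<otimes> (x \<otimes> y) \<and>
       (\<forall>t\<in>{0..1}. surface_map g (cell_contraction n i d (t, z)) = surface_map g (cell_contraction n i e (t, v)))"
    using f e(4) by (intro bexI[of _ f]) auto
qed

lemma glued_side_pairing:
  assumes "side_pairing g z w"
  shows "\<exists>x. glued z w x" "\<exists>x. glued w z x"
proof -
  obtain k t where k: "k < n" "k mod 4 < 2" and t: "t \<in> {0..1}"
    and zw: "z = circle_point n (real k + t)" "w = circle_point n (real k + 3 - t)"
    using assms unfolding side_pairing_iff n by blast
  have "glued z w (\<gamma> k)"
    unfolding glued_def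
  proof (intro conjI ballI impI \<gamma> k)
    fix i d assume i: "i \<in> patches n" "d \<in> centres n i" "z \<in> cell n i d"
    then obtain e \<sigma> where m: "matching n k i d e \<sigma>" "\<bar>t - \<sigma>\<bar> < 1/2"
      using cell_matching_left[OF n k t i(1,2)] zw by blast
    show "\<exists>e\<in>centres n i. w \<in> cell n i e \<and> label K h \<gamma> i e = label K h \<gamma> i d \<otimes> \<gamma> k \<and>
       (\<forall>t\<in>{0..1}. surface_map g (cell_contraction n i d (t, z)) = surface_map g (cell_contraction n i e (t, w)))"
      using matching_centres(4)[OF n k m(1)] matching_contraction[OF n k m t] label_matching[OF k m(1)]
      unfolding zw by blast
  qed
  then show "\<exists>x. glued z w x" ..
  have "glued w z (inv \<gamma> k)"
    unfolding glued_def
  proof (intro conjI ballI impI)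
    show "inv \<gamma> k \<in> carrier K" using \<gamma> k by simp
    fix i e assume i: "i \<in> patches n" "e \<in> centres n i" "w \<in> cell n i e"
    then obtain d \<sigma> where m: "matching n k i d e \<sigma>" "\<bar>t - \<sigma>\<bar> < 1/2"
      using cell_matching_right[OF n k t i(1,2)] zw by blast
    have d: "d \<in> centres n i" using matching_centres(3)[OF n k m(1)] .
    have "label K h \<gamma> i d = label K h \<gamma> i e \<otimes> inv \<gamma> k"
      using label_matching[OF k m(1)] label_closed[OF i(1) d] \<gamma>[OF k] by (simp add: K.m_assoc)
    then show "\<exists>d\<in>centres n i. z \<in> cell n i d \<and> label K h \<gamma> i d = label K h \<gamma> i e \<otimes> inv \<gamma> k \<and>
       (\<forall>t\<in>{0..1}. surface_map g (cell_contraction n i e (t, w)) = surface_map g (cell_contraction n i d (t, z)))"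
      using d matching_contraction[OF n k m t] unfolding zw by (intro bexI[OF _ d]) auto
  qed
  then show "\<exists>x. glued w z x" ..
qed

lemma glued_equivclp:
  assumes "equivclp (side_pairing g) z w"
  shows "\<exists>x. glued z w x"
  using assms
proof (induction rule: equivclp_induct)
  case base
  show ?case using glued_refl by blast
next
  case (step v w)
  then show ?case using glued_trans glued_side_pairing by meson
qed

text \<open>Along the corners \<open>4 i\<close>, \<open>4 i + 3\<close>, \<open>4 i + 2\<close>, \<open>4 i + 1\<close>, \<open>4 i + 4\<close> each is glued to the
  next one.\<close>

lemma corners_glued:
  assumes "j < n"
  shows "equivclp (side_pairing g) (circle_point n 0) (circle_point n (real j))"
proof -
  note eq = equivclp_sym equivclp_trans
  let ?E = "\<lambda>a b. equivclp (side_pairing g) (circle_point n a) (circle_point n b)"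
  have p: "?E (real k + t) (real k + 3 - t)" if "k < n" "k mod 4 < 2" "t \<in> {0..1}" for k t
  proof (rule r_into_equivclp)
    show "side_pairing g (circle_point n (real k + t)) (circle_point n (real k + 3 - t))"
      unfolding side_pairing_iff using that n by blast
  qed
  have block: "?E (4 * real i) (4 * real i + real r)" if i: "i < g" and r: "r \<le> 4" for i r
  proof -
    have k: "4 * i < n" "4 * i mod 4 < 2" "4 * i + 1 < n" "(4 * i + 1) mod 4 < 2"
      using i n by (auto simp: mod_Suc)
    have 3: "?E (4 * real i) (4 * real i + 3)" using p[OF k(1,2), of 0] by simp
    have "?E (4 * real i + 2) (4 * real i + 3)" using p[OF k(3,4), of 1] by (simp add: algebra_simps)
    with 3 have 2: "?E (4 * real i) (4 * real i + 2)" using eq by metis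
    have "?E (4 * real i + 1) (4 * real i + 2)" using p[OF k(1,2), of 1] by (simp add: algebra_simps)
    with 2 have 1: "?E (4 * real i) (4 * real i + 1)" using eq by metis
    have "?E (4 * real i + 1) (4 * real i + 4)" using p[OF k(3,4), of 0] by (simp add: algebra_simps)
    with 1 have 4: "?E (4 * real i) (4 * real i + 4)" using eq by metis
    have "r = 0 \<or> r = 1 \<or> r = 2 \<or> r = 3 \<or> r = 4" using r by linarith
    then show ?thesis using 1 2 3 4 by auto
  qed
  have corner: "?E 0 (4 * real i)" if "i \<le> g" for i
    using that
  proof (induction i)
    case (Suc i)
    then have "?E 0 (4 * real i)" "?E (4 * real i) (4 * real i + real 4)" using block[of i 4] by auto
    then have "?E 0 (4 * real i + real 4)" using eq by metis
    moreover have "4 * real i + real 4 = 4 * real (Suc i)" by simp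
    ultimately show ?case by metis
  qed simp
  have i: "j div 4 < g" "j mod 4 \<le> 4" using assms n by auto
  have "real j = real (4 * (j div 4) + j mod 4)" by simp
  then have "real j = 4 * real (j div 4) + real (j mod 4)" by (simp only: of_nat_add of_nat_mult of_nat_numeral)
  then show ?thesis using corner[of "j div 4"] block[OF i] i eq by (metis less_imp_le)
qed

lemma centres_differ:
  assumes "i \<in> patches n" "a \<in> centres n i" "b \<in> centres n i" "\<bar>a - b - real_of_int N * real n\<bar> < 1"
  shows "a = b"
proof -
  obtain c l m where lm: "a = real l + c" "b = real m + c" "l < n" "m < n"
  proof (cases i)
    case Face
    then show thesis using assms(2,3) n g that[of 0 0 0] by simp
  next
    case Corner
    then show thesis using assms(2,3) that[of _ 0] by auto
  next
    case (Edge k)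
    then have k: "k < n" "k mod 4 < 2" using assms(1) by (auto simp: patches_def)
    then have k2: "k + 2 < n" using n by presburger
    have "\<exists>l<n. x = real l + 1/2" if "x \<in> centres n i" for x
      using that Edge k k2 by (auto intro: exI[of _ k] exI[of _ "k + 2"])
    then show thesis using assms(2,3) that by meson
  qed
  define d where "d = int l - int m - N * int n"
  have "real_of_int d = a - b - real_of_int N * real n" by (simp add: d_def lm)
  then have "d = 0" using assms(4) by linarith
  then have "int l = (int m + N * int n)" by (simp add: d_def)
  then have "int l mod int n = int m mod int n" by simp
  then show ?thesis using lm by simp
qed

lemma polygon_glued_convex:
  "glued_convex K (surface g) (cball 0 1) (surface_map g) 0 (patches n) (centres n) (cell n)
     (cell_centre n) (cell_contraction n) (label K h \<gamma>)"
proof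
  have n4: "n \<ge> 4" using n g by simp
  show "quotient_map (top_of_set (cball 0 1)) (surface g) (surface_map g)"
    by (rule quotient_map_surface_map[OF g])
  show "z = 0" if "z \<in> cball 0 1" "surface_map g z = surface_map g 0" for z
    using that surface_map_eq_iff[of 0 z g] by (auto intro: equivclp_side_pairing_0)
  show "openin (top_of_set (cball 0 1)) (cell n i d)" for i d
    by (cases i) (auto simp: cell_def sector_open intro: open_subset)
  show "d = e" if "i \<in> patches n" "d \<in> centres n i" "e \<in> centres n i" "z \<in> cell n i d" "z \<in> cell n i e" for i d e z
  proof (cases "i = Face")
    case False
    then have "z \<in> sector n d" "z \<in> sector n e" using that by (auto simp: cell_def)
    then obtain N :: int where "\<bar>d - e - N * n\<bar> < 1" using sector_overlap[of n z d e] n4 by auto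
    then show ?thesis using centres_differ[OF that(1-3)] by simp
  qed (use that in auto)
  show "\<exists>i\<in>patches n. \<exists>d\<in>centres n i. z \<in> cell n i d" if z: "z \<in> cball 0 1" for z
  proof (cases "norm z = 1")
    case False
    then have "z \<in> cell n Face 0" using z by (simp add: cell_def)
    then show ?thesis by (force simp: patches_def)
  next
    case True
    obtain k t where kt: "k < n" "t \<in> {0..<1}" "z = circle_point n (real k + t)"
      using circle_point_exists[OF _ True, of n] n4 by auto
    have near: "circle_point n (real k + t) \<in> sector n (real k + s)" if "\<bar>t - s\<bar> < 1/2" for s
      using circle_point_in_sector(1)[OF n4 that, of "real k + s"] by simp
    consider "t < 1/2" | "t > 1/2" | "t = 1/2" by linarith
    then show ?thesis
    proof cases
      case 1
      then have "z \<in> cell n Corner (real k)" using near[of 0] kt by (simp add: cell_def)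
      then show ?thesis using kt(1) by (intro bexI[of _ Corner] bexI[of _ "real k"]) (auto simp: patches_def)
    next
      case 2
      let ?m = "(k + 1) mod n"
      have "circle_point n (real ?m) = circle_point n (real k + 1)"
        using circle_point_mod[of n "k + 1"] n4 by (simp add: add.commute)
      then have "sector n (real ?m) = sector n (real k + 1)" by (simp add: sector_def)
      then have "z \<in> cell n Corner (real ?m)" using near[of 1] 2 kt by (simp add: cell_def)
      moreover have "?m < n" using n4 by simp
      ultimately show ?thesis by (intro bexI[of _ Corner] bexI[of _ "real ?m"]) (auto simp: patches_def)
    next
      case 3
      then have z: "z \<in> sector n (real k + 1/2)" using near[of "1/2"] kt by simp
      show ?thesis
      proof (cases "k mod 4 < 2")
        case True
        then show ?thesis using z kt(1)
          by (intro bexI[of _ "Edge k"] bexI[of _ "real k + 1/2"]) (auto simp: patches_def cell_def)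
      next
        case False
        have k2: "k \<ge> 2"
        proof (rule ccontr)
          assume "\<not> k \<ge> 2"
          then have "k mod 4 = k" by simp
          with False \<open>\<not> k \<ge> 2\<close> show False by simp
        qed
        then obtain l where l: "k = l + 2" using le_Suc_ex by (metis add.commute)
        then have "l mod 4 < 2" using False by (simp add: mod_Suc split: if_splits)
        then have m: "(k - 2) mod 4 < 2" "k \<ge> 2" using l by simp_all
        then have "real (k - 2) + 5/2 = real k + 1/2" by simp
        then show ?thesis using z kt(1) m
          by (intro bexI[of _ "Edge (k - 2)"] bexI[of _ "real k + 1/2"]) (auto simp: patches_def cell_def)
      qed
    qed
  qed
  show "continuous_on ({0..1} \<times> cell n i d) (cell_contraction n i d)" for i d
  proof (cases "i = Face")
    case True
    have "cell_contraction n i d = (\<lambda>p. complex_of_real (1 - fst p) * snd p)"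
      using True by (auto simp: cell_contraction_def)
    then show ?thesis by (simp only:) (intro continuous_intros)
  qed (simp add: cell_def cell_contraction_def sector_contraction_cont)
  show "cell_contraction n i d (t, z) \<in> cball 0 1" if "t \<in> {0..1}" "z \<in> cell n i d" for i d t z
  proof (cases "i = Face")
    case True
    then have "norm z \<le> 1" "\<bar>1 - t\<bar> \<le> 1" using that by (auto simp: cell_def)
    then have "\<bar>1 - t\<bar> * norm z \<le> 1" by (simp add: mult_le_one)
    moreover have "norm (complex_of_real (1 - t)) = \<bar>1 - t\<bar>" by (rule norm_of_real)
    moreover have "cell_contraction n i d (t, z) = complex_of_real (1 - t) * z"
      using True by (simp add: cell_contraction_def)
    ultimately show ?thesis by (simp only: norm_mult mem_cball dist_0_norm)
  next
    case False
    then show ?thesis using sector_contraction_in[OF _ that(1), of z n d] that(2)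
      by (simp add: cell_def cell_contraction_def)
  qed
  show "cell_contraction n i d (0, z) = z" if "z \<in> cell n i d" for i d z
    using that sector_contraction_0[of z n d] by (auto simp: cell_def cell_contraction_def)
  show "cell_contraction n i d (1, z) = cell_centre n i d" if "z \<in> cell n i d" for i d z
    using sector_contraction_1[of n d z] by (auto simp: cell_centre_def cell_contraction_def)
  show "cell_centre n i d \<in> cell n i d" for i d
    using circle_point_in_sector(1)[OF n4, of 0 d] by (auto simp: cell_centre_def cell_def)
  show "surface_map g (cell_centre n i d) = surface_map g (cell_centre n i e)"
    if i: "i \<in> patches n" "d \<in> centres n i" "e \<in> centres n i" for i d e
  proof -
    have "equivclp (side_pairing g) (cell_centre n i d) (cell_centre n i e)"
    proof (cases i)
      case Face
      then show ?thesis by (simp add: cell_centre_def)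
    next
      case Corner
      then obtain l m where "d = real l" "e = real m" "l < n" "m < n" using i by auto
      then show ?thesis using Corner corners_glued
        by (simp add: cell_centre_def) (meson equivclp_sym equivclp_trans)
    next
      case (Edge k)
      then have k: "k < n" "k mod 4 < 2" using i by (auto simp: patches_def)
      have "circle_point n (real k + 5/2) = circle_point n (real k + 3 - 1/2)"
        by (rule arg_cong[of _ _ "circle_point n"]) simp
      moreover have "(1/2::real) \<in> {0..1}" by simp
      ultimately have "side_pairing g (circle_point n (real k + 1/2)) (circle_point n (real k + 5/2))"
        unfolding side_pairing_iff using k n by metis
      then have "equivclp (side_pairing g) (circle_point n (real k + 1/2)) (circle_point n (real k + 5/2))"
        by (rule r_into_equivclp)
      then show ?thesis using i Edge equivclp_sym by (auto simp: cell_centre_def)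
    qed
    moreover have "cell_centre n i a \<in> cball 0 1" for a by (simp add: cell_centre_def)
    ultimately show ?thesis by (simp only: surface_map_eq_iff)
  qed
  show "\<exists>x\<in>carrier K. \<forall>i\<in>patches n. \<forall>d\<in>centres n i. z \<in> cell n i d \<longrightarrow>
     (\<exists>e\<in>centres n i. w \<in> cell n i e \<and> label K h \<gamma> i e = label K h \<gamma> i d \<otimes> x \<and>
       (\<forall>t\<in>{0..1}. surface_map g (cell_contraction n i d (t, z)) = surface_map g (cell_contraction n i e (t, w))))"
    if "z \<in> cball 0 1" "w \<in> cball 0 1" "surface_map g z = surface_map g w" for z w
    using glued_equivclp that surface_map_eq_iff[OF that(1,2)] unfolding glued_def by blast
qed (use label_closed in auto)

end

section \<open>Surfaces of positive genus\<close>

definition surface_gens :: "nat \<Rightarrow> surface_gen set" where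
  "surface_gens g = Gen_a ` {1..g} \<union> Gen_b ` {1..g}"

definition commutator_word :: "nat \<Rightarrow> surface_gen word" where
  "commutator_word i = [(Gen_a i, True), (Gen_b i, True), (Gen_a i, False), (Gen_b i, False)]"

text \<open>The label of corner \<open>j\<close>. Between the corners \<open>4 i\<close> and \<open>4 i + 4\<close> the commutator is not read
  off in order: corner \<open>4 i + r\<close> with \<open>0 < r < 4\<close> has its prefix of length \<open>4 - r\<close>, since the side
  pairing relates \<open>4 i\<close> to \<open>4 i + 3\<close>, that to \<open>4 i + 2\<close>, and so on.\<close>

definition corner_word :: "nat \<Rightarrow> surface_gen word" where
  "corner_word j = surface_relator (j div 4) @ take ((4 - j mod 4) mod 4) (commutator_word (Suc (j div 4)))"

text \<open>The letter of a side that comes first in its pair. The side \<open>b\<close> stands for the inverse of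
  its generator, which gives the commutators the form that they have in the relator.\<close>

definition edge_word :: "nat \<Rightarrow> surface_gen word" where
  "edge_word k = (if k mod 4 = 0 then [(Gen_a (Suc (k div 4)), True)] else [(Gen_b (Suc (k div 4)), False)])"

lemma surface_relator_0 [simp]: "surface_relator 0 = []"
  by (simp add: surface_relator_def)

lemma surface_relator_Suc: "surface_relator (Suc i) = surface_relator i @ commutator_word (Suc i)"
  by (simp add: surface_relator_def commutator_word_def)

lemma surface_relator_words: "i \<le> g \<Longrightarrow> surface_relator i \<in> words (surface_gens g)"
  by (induction i) (auto simp: surface_relator_Suc commutator_word_def surface_gens_def)

lemma corner_word_relator: "corner_word (4 * i) = surface_relator i"
  by (simp add: corner_word_def)

lemma corner_word_simps:
  "corner_word (4 * i + 1) = surface_relator i @ [(Gen_a (Suc i), True), (Gen_b (Suc i), True), (Gen_a (Suc i), False)]"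
  "corner_word (4 * i + 2) = surface_relator i @ [(Gen_a (Suc i), True), (Gen_b (Suc i), True)]"
  "corner_word (4 * i + 3) = surface_relator i @ [(Gen_a (Suc i), True)]"
proof -
  have d: "(4 * i + 1) div 4 = i" "(4 * i + 2) div 4 = i" "(4 * i + 3) div 4 = i"
    "(4 * i + 1) mod 4 = 1" "(4 * i + 2) mod 4 = 2" "(4 * i + 3) mod 4 = 3"
    by presburger+
  show "corner_word (4 * i + 1) = surface_relator i @ [(Gen_a (Suc i), True), (Gen_b (Suc i), True), (Gen_a (Suc i), False)]"
  "corner_word (4 * i + 2) = surface_relator i @ [(Gen_a (Suc i), True), (Gen_b (Suc i), True)]"
  "corner_word (4 * i + 3) = surface_relator i @ [(Gen_a (Suc i), True)]"
    unfolding corner_word_def d by (simp_all add: commutator_word_def)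
qed

lemma edge_word_simps:
  "edge_word (4 * i) = [(Gen_a (Suc i), True)]" "edge_word (4 * i + 1) = [(Gen_b (Suc i), False)]"
proof -
  have d: "(4 * i) div 4 = i" "(4 * i + 1) div 4 = i" "(4 * i) mod 4 = 0" "(4 * i + 1) mod 4 = 1"
    by presburger+
  show "edge_word (4 * i) = [(Gen_a (Suc i), True)]" "edge_word (4 * i + 1) = [(Gen_b (Suc i), False)]"
    unfolding edge_word_def d by simp_all
qed

lemma first_sides_cases:
  assumes "k < 4 * g" "k mod 4 < (2::nat)"
  obtains i where "i < g" "k = 4 * i" | i where "i < g" "k = 4 * i + 1"
proof -
  have "k div 4 < g" using assms by auto
  moreover have "k = 4 * (k div 4) \<or> k = 4 * (k div 4) + 1" using assms by presburger
  ultimately show thesis using that by blast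
qed

lemma corner_word_words:
  assumes "j \<le> 4 * g"
  shows "corner_word j \<in> words (surface_gens g)"
proof (cases "j = 4 * g")
  case True
  then show ?thesis by (simp add: corner_word_relator surface_relator_words)
next
  case False
  then have "j div 4 < g" using assms by auto
  then have "commutator_word (Suc (j div 4)) \<in> words (surface_gens g)"
    by (auto simp: commutator_word_def surface_gens_def)
  moreover have "surface_relator (j div 4) \<in> words (surface_gens g)"
    using \<open>j div 4 < g\<close> by (simp add: surface_relator_words)
  ultimately show ?thesis unfolding corner_word_def by (metis append_take_drop_id words_append)
qed

lemma edge_word_words: "k < 4 * g \<Longrightarrow> edge_word k \<in> words (surface_gens g)"
  by (auto simp: edge_word_def surface_gens_def)

lemma corner_word_eval:
  fixes K (structure)
  assumes K: "group K" and f: "f \<in> surface_gens g \<rightarrow> carrier K" and k: "k < 4 * g" "k mod 4 < 2"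
  shows "word_eval K f (corner_word (k + 3)) = word_eval K f (corner_word k) \<otimes> word_eval K f (edge_word k)"
    "word_eval K f (corner_word (k + 2)) = word_eval K f (corner_word (k + 1)) \<otimes> word_eval K f (edge_word k)"
proof -
  interpret group K by (rule K)
  have letters: "word_eval K f (surface_relator i) \<in> carrier K" "f (Gen_a (Suc i)) \<in> carrier K" "f (Gen_b (Suc i)) \<in> carrier K"
    "surface_relator i \<in> words (surface_gens g)" "Gen_a (Suc i) \<in> surface_gens g" "Gen_b (Suc i) \<in> surface_gens g" if "i < g" for i
    using that f word_eval_closed[OF K f] surface_relator_words[of i g] by (auto simp: surface_gens_def Pi_iff)
  note ev = word_eval_append[OF K f]
  have "word_eval K f (corner_word (k + 3)) = word_eval K f (corner_word k) \<otimes> word_eval K f (edge_word k) \<and>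
    word_eval K f (corner_word (k + 2)) = word_eval K f (corner_word (k + 1)) \<otimes> word_eval K f (edge_word k)"
    using k
  proof (cases rule: first_sides_cases)
    case (1 i)
    show ?thesis unfolding 1(2) corner_word_simps edge_word_simps corner_word_relator
      using letters[OF 1(1)] by (simp add: ev m_assoc)
  next
    case (2 i)
    have e: "4 * i + 1 + 3 = 4 * Suc i" "4 * i + 1 + 2 = 4 * i + 3" "4 * i + 1 + 1 = 4 * i + 2" by simp_all
    show ?thesis unfolding 2(2) e corner_word_simps edge_word_simps corner_word_relator surface_relator_Suc commutator_word_def
      using letters[OF 2(1)] by (simp add: ev m_assoc)
  qed
  then show "word_eval K f (corner_word (k + 3)) = word_eval K f (corner_word k) \<otimes> word_eval K f (edge_word k)"
    "word_eval K f (corner_word (k + 2)) = word_eval K f (corner_word (k + 1)) \<otimes> word_eval K f (edge_word k)" by blast+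
qed

text \<open>The equations along the sides determine all values from the first: within a block they are
  passed on in the order \<open>4 i\<close>, \<open>4 i + 3\<close>, \<open>4 i + 2\<close>, \<open>4 i + 1\<close>, \<open>4 i + 4\<close>.\<close>

lemma corner_values_unique:
  fixes K (structure) and x y e :: "nat \<Rightarrow> _"
  assumes K: "group K" and c: "\<And>j. x j \<in> carrier K" "\<And>j. y j \<in> carrier K" "\<And>k. e k \<in> carrier K"
    and 0: "x 0 = y 0"
    and x: "\<And>k. k < 4 * g \<Longrightarrow> k mod 4 < 2 \<Longrightarrow> x (k + 3) = x k \<otimes> e k \<and> x (k + 2) = x (k + 1) \<otimes> e k"
    and y: "\<And>k. k < 4 * g \<Longrightarrow> k mod 4 < 2 \<Longrightarrow> y (k + 3) = y k \<otimes> e k \<and> y (k + 2) = y (k + 1) \<otimes> e k"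
    and j: "j \<le> 4 * g"
  shows "x j = y j"
proof -
  interpret group K by (rule K)
  have block: "x (4 * i + 1) = y (4 * i + 1) \<and> x (4 * i + 2) = y (4 * i + 2) \<and> x (4 * i + 3) = y (4 * i + 3) \<and>
      x (4 * Suc i) = y (4 * Suc i)" if i: "i < g" "x (4 * i) = y (4 * i)" for i
  proof -
    have k: "4 * i < 4 * g" "4 * i mod 4 < 2" "4 * i + 1 < 4 * g" "(4 * i + 1) mod 4 < 2"
      using i by (auto simp: mod_Suc)
    have e: "4 * i + 1 + 3 = 4 * Suc i" "4 * i + 1 + 2 = 4 * i + 3" "4 * i + 1 + 1 = 4 * i + 2" by simp_all
    note X = x[OF k(1,2)] x[OF k(3,4), unfolded e] and Y = y[OF k(1,2)] y[OF k(3,4), unfolded e]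
    have 3: "x (4 * i + 3) = y (4 * i + 3)" using X Y i by metis
    then have "x (4 * i + 2) \<otimes> e (4 * i + 1) = y (4 * i + 2) \<otimes> e (4 * i + 1)" using X Y by metis
    then have 2: "x (4 * i + 2) = y (4 * i + 2)" using c by simp
    then have "x (4 * i + 1) \<otimes> e (4 * i) = y (4 * i + 1) \<otimes> e (4 * i)" using X Y by metis
    then have 1: "x (4 * i + 1) = y (4 * i + 1)" using c by simp
    then have "x (4 * Suc i) = y (4 * Suc i)" using X Y by metis
    with 1 2 3 show ?thesis by blast
  qed
  have base: "x (4 * i) = y (4 * i)" if "i \<le> g" for i
    using that by (induction i) (use 0 block in auto)
  define i r where "i = j div 4" "r = j mod 4"
  have jr: "j = 4 * i + r" "r < 4" by (auto simp: i_r_def)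
  show ?thesis
  proof (cases "i < g")
    case True
    have "r = 0 \<or> r = 1 \<or> r = 2 \<or> r = 3" using jr by linarith
    then show ?thesis using base[of i] block[OF True] True jr by auto
  next
    case False
    then have "j = 4 * g" using j jr by linarith
    then show ?thesis using base by simp
  qed
qed

lemma pathin_circle_arc:
  "n > 0 \<Longrightarrow> pathin (top_of_set (cball 0 1)) (\<lambda>t. circle_point n (a + b * t))"
  unfolding pathin_def circle_point_def by (auto intro!: continuous_intros)

text \<open>Both the words \<open>corner_word\<close>, evaluated on loops, and the loops along the spokes to corner
  \<open>0\<close> and corner \<open>j\<close> satisfy the equations of \<open>corner_values_unique\<close>, so they agree. As corner \<open>n\<close>
  is corner \<open>0\<close>, the relator is trivial in the fundamental group, which gives the homomorphism
  that \<open>fundamental_group_iso\<close> asks for.\<close>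

theorem fundamental_group_surface:
  assumes g: "g \<ge> 1" and x: "x \<in> topspace (surface g)"
  shows "fundamental_group (surface g) x \<cong> surface_group g"
proof -
  define A where "A = surface_gens g"
  define R where "R = {surface_relator g}"
  define n where "n = 4 * g"
  define K where "K = presented_group A R"
  have Kg: "surface_group g = K" by (simp add: K_def surface_group_def A_def R_def surface_gens_def)
  have R: "R \<subseteq> words A" using surface_relator_words[of g g] by (simp add: R_def A_def)
  have K: "group K" unfolding K_def by (rule group_presented_group[OF R])
  interpret K: group K by (rule K)
  define fK where "fK a = pres_class A R [(a, True)]" for a
  have pc: "pres_class A R w = word_eval K fK w" if "w \<in> words A" for w
    using pres_class_eq_word_eval[OF R that] by (simp add: K_def fK_def[abs_def])
  have fK: "fK \<in> A \<rightarrow> carrier K" using pres_class_closed[OF R] by (auto simp: K_def fK_def)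
  define h where "h j = word_eval K fK (corner_word j)" for j
  define \<gamma> where "\<gamma> k = word_eval K fK (edge_word k)" for k
  have n4: "n \<ge> 4" "n > 0" using g by (auto simp: n_def)
  have cw: "corner_word j \<in> words A" if "j \<le> n" for j using corner_word_words that by (simp add: A_def n_def)
  have ew: "edge_word k \<in> words A" if "k < n" for k using edge_word_words that by (simp add: A_def n_def)
  have hc: "h j \<in> carrier K" if "j \<le> n" for j
    unfolding h_def by (rule word_eval_closed[OF K fK cw[OF that]])
  have \<gamma>c: "\<gamma> k \<in> carrier K" if "k < n" for k
    unfolding \<gamma>_def by (rule word_eval_closed[OF K fK ew[OF that]])
  have k3: "k + 3 \<le> n" if "k < n" "k mod 4 < 2" for k using that unfolding n_def by presburger
  have hn: "h n = h 0"
  proof -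
    have "h n = pres_class A R (surface_relator g)"
      using pc[of "surface_relator g"] R by (simp add: h_def n_def corner_word_relator R_def)
    also have "\<dots> = \<one>\<^bsub>K\<^esub>" using pres_class_relator[OF R] by (simp add: K_def R_def)
    also have "\<dots> = h 0" using corner_word_relator[of 0] by (simp add: h_def)
    finally show ?thesis .
  qed
  have h1: "h (k + 3) = h k \<otimes>\<^bsub>K\<^esub> \<gamma> k" and h2: "h (k + 2) = h (k + 1) \<otimes>\<^bsub>K\<^esub> \<gamma> k" if "k < n" "k mod 4 < 2" for k
    using corner_word_eval[OF K fK[unfolded A_def] that[unfolded n_def]] by (simp_all add: h_def \<gamma>_def)
  interpret S: glued_convex K "surface g" "cball 0 1" "surface_map g" 0 "patches n" "centres n" "cell n"
    "cell_centre n" "cell_contraction n" "label K h \<gamma>"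
  proof (rule polygon_glued_convex[OF K n_def g])
    show "h ((k + 3) mod n) = h k \<otimes>\<^bsub>K\<^esub> \<gamma> k" if "k < n" "k mod 4 < 2" for k
      using h1[OF that] k3[OF that] hn by (cases "k + 3 = n") auto
  qed (use hc \<gamma>c h2 in auto)
  let ?P = "fundamental_group (surface g) (surface_map g 0)"
  define \<theta> where "\<theta> a = S.tree_class (S.spoke (circle_point n a))" for a
  have \<theta>c: "\<theta> a \<in> carrier ?P" for a
    unfolding \<theta>_def by (intro S.tree_class_closed S.pathin_spoke) simp
  \<comment> \<open>The loop that leaves the disc through the point \<open>s\<close> of side \<open>k\<close> and returns through its partner.\<close>
  define \<kappa> where "\<kappa> k s = \<theta> (real k + s) \<otimes>\<^bsub>?P\<^esub> inv\<^bsub>?P\<^esub> \<theta> (real k + 3 - s)" for k s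
  have \<kappa>c: "\<kappa> k s \<in> carrier ?P" for k s using \<theta>c by (simp add: \<kappa>_def)
  \<comment> \<open>Sliding the meeting point of the two spokes along the edge is a homotopy of loops.\<close>
  have \<kappa>_const: "\<kappa> k 0 = \<kappa> k s" if k: "k < n" "k mod 4 < 2" and s: "s \<in> {0..1}" for k s
  proof -
    let ?u = "\<lambda>t. circle_point n (real k + s * t)" and ?v = "\<lambda>t. circle_point n ((real k + 3) + (- s) * t)"
    have "surface_map g (?u t) = surface_map g (?v t)" if t: "t \<in> {0..1}" for t
    proof -
      have "s * t \<in> {0..1}" using s t by (auto intro: mult_le_one)
      moreover have "(real k + 3) + (- s) * t = real k + 3 - s * t" by simp
      ultimately have "side_pairing g (?u t) (?v t)"
        unfolding side_pairing_iff using k by (metis n_def)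
      then have "equivclp (side_pairing g) (?u t) (?v t)" by (rule r_into_equivclp)
      then show ?thesis by (subst surface_map_eq_iff) auto
    qed
    then have "path_hom (surface g) ((surface_map g \<circ> ?u) 0) ((surface_map g \<circ> ?u) 1) (surface_map g \<circ> ?u) (surface_map g \<circ> ?v)"
      by (intro path_hom_reparametrize[where F = "surface_map g \<circ> ?u" and u = id and v = id])
         (auto intro!: S.pathin_q[OF pathin_circle_arc[OF n4(2)]])
    from S.tree_class_cong[OF this] have "inv\<^bsub>?P\<^esub> \<theta> (real k) \<otimes>\<^bsub>?P\<^esub> \<theta> (real k + s) =
        inv\<^bsub>?P\<^esub> \<theta> (real k + 3) \<otimes>\<^bsub>?P\<^esub> \<theta> (real k + 3 - s)"
      unfolding S.tree_class_in_disc[OF pathin_circle_arc[OF n4(2)]] by (simp add: \<theta>_def)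
    then have "\<theta> (real k + s) = \<theta> (real k) \<otimes>\<^bsub>?P\<^esub> (inv\<^bsub>?P\<^esub> \<theta> (real k + 3) \<otimes>\<^bsub>?P\<^esub> \<theta> (real k + 3 - s))"
      using \<theta>c by (simp add: S.P.inv_solve_left')
    then show ?thesis using \<theta>c by (simp add: \<kappa>_def S.P.m_assoc)
  qed
  define fP where "fP a = (case a of Gen_a i \<Rightarrow> \<kappa> (4 * (i - 1)) 0 | Gen_b i \<Rightarrow> inv\<^bsub>?P\<^esub> \<kappa> (4 * (i - 1) + 1) 0)" for a
  have fP: "fP \<in> A \<rightarrow> carrier ?P" using \<kappa>c by (auto simp: fP_def split: surface_gen.split)
  have ewP: "word_eval ?P fP (edge_word k) = \<kappa> k 0" if k: "k < n" "k mod 4 < 2" for k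
    using k[unfolded n_def]
  proof (cases rule: first_sides_cases)
    case (1 i) then show ?thesis using \<kappa>c by (simp add: edge_word_simps fP_def)
  next
    case (2 i) then show ?thesis unfolding 2(2) edge_word_simps using \<kappa>c by (simp add: fP_def)
  qed
  define c where "c j = \<theta> 0 \<otimes>\<^bsub>?P\<^esub> inv\<^bsub>?P\<^esub> \<theta> (real j)" for j
  \<comment> \<open>Beyond \<open>n\<close> the words mention generators outside the presentation, hence the default value.\<close>
  have cwP: "word_eval ?P fP (corner_word j) = c j" if j: "j \<le> n" for j
  proof -
    let ?x = "\<lambda>j. if j \<le> n then word_eval ?P fP (corner_word j) else \<one>\<^bsub>?P\<^esub>"
    have "?x j = c j"
    proof (rule corner_values_unique[where K = ?P and x = ?x and y = c and e = "\<lambda>k. \<kappa> k 0" and g = g])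
      show "?x j \<in> carrier ?P" for j using word_eval_closed[OF S.P.group_axioms fP cw] by simp
      show "c j \<in> carrier ?P" for j using \<theta>c by (simp add: c_def)
      show "?x 0 = c 0" using corner_word_relator[of 0] \<theta>c by (simp add: c_def)
      show "j \<le> 4 * g" using j by (simp add: n_def)
    next
      fix k assume k: "k < 4 * g" "k mod 4 < 2"
      then have kn: "k < n" by (simp add: n_def)
      show "?x (k + 3) = ?x k \<otimes>\<^bsub>?P\<^esub> \<kappa> k 0 \<and> ?x (k + 2) = ?x (k + 1) \<otimes>\<^bsub>?P\<^esub> \<kappa> k 0"
        using corner_word_eval[OF S.P.group_axioms fP[unfolded A_def] k] ewP[OF kn k(2)] k3[OF kn k(2)] by simp
      have "c (k + 3) = c k \<otimes>\<^bsub>?P\<^esub> \<kappa> k 0"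
        using \<theta>c by (simp add: c_def \<kappa>_def S.P.m_assoc add.commute) (simp add: S.P.m_assoc[symmetric])
      moreover have "c (k + 2) = c (k + 1) \<otimes>\<^bsub>?P\<^esub> \<kappa> k 1"
        using \<theta>c by (simp add: c_def \<kappa>_def S.P.m_assoc add.commute) (simp add: S.P.m_assoc[symmetric])
      moreover have "\<kappa> k 1 = \<kappa> k 0" using \<kappa>_const[OF kn k(2), of 1] by simp
      ultimately show "c (k + 3) = c k \<otimes>\<^bsub>?P\<^esub> \<kappa> k 0 \<and> c (k + 2) = c (k + 1) \<otimes>\<^bsub>?P\<^esub> \<kappa> k 0" by simp
    qed (use \<kappa>c in auto)
    then show ?thesis using j by simp
  qed
  have "circle_point n (real n) = circle_point n 0"
    unfolding circle_point_eq_iff[OF n4(2)] by (rule exI[of _ 1]) simp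
  then have "c n = \<one>\<^bsub>?P\<^esub>" using \<theta>c[of 0] by (simp add: c_def \<theta>_def)
  then have "word_eval ?P fP r = \<one>\<^bsub>?P\<^esub>" if "r \<in> R" for r
    using that cwP[of n] by (simp add: R_def n_def corner_word_relator)
  then obtain \<phi> where \<phi>: "\<phi> \<in> hom K ?P" "\<And>w. w \<in> words A \<Longrightarrow> \<phi> (pres_class A R w) = word_eval ?P fP w"
    using presented_group_lift[OF R S.P.group_axioms fP] unfolding K_def by metis
  interpret \<phi>: group_hom K ?P \<phi>
    using \<phi>(1) by (auto simp: group_hom_def group_hom_axioms_def)
  have \<phi>h: "\<phi> (h j) = c j" if "j \<le> n" for j
    using \<phi>(2)[OF cw[OF that]] pc[OF cw[OF that]] cwP[OF that] by (simp add: h_def)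
  have \<phi>\<gamma>: "\<phi> (\<gamma> k) = \<kappa> k 0" if "k < n" "k mod 4 < 2" for k
    using \<phi>(2)[OF ew[OF that(1)]] pc[OF ew[OF that(1)]] ewP[OF that] by (simp add: \<gamma>_def)
  have "?P \<cong> K"
  proof (rule S.fundamental_group_iso[OF \<phi>(1)])
    fix i d e assume i: "i \<in> patches n" "d \<in> centres n i" "e \<in> centres n i"
    show "\<phi> (inv\<^bsub>K\<^esub> label K h \<gamma> i d \<otimes>\<^bsub>K\<^esub> label K h \<gamma> i e) =
       S.tree_class (S.spoke (cell_centre n i d)) \<otimes>\<^bsub>?P\<^esub> inv\<^bsub>?P\<^esub> S.tree_class (S.spoke (cell_centre n i e))"
    proof (cases i)
      case Face
      have "S.tree_class (S.spoke (cell_centre n i d)) \<in> carrier ?P"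
        by (intro S.tree_class_closed S.pathin_spoke) (simp add: Face cell_centre_def)
      then show ?thesis using i Face by simp
    next
      case Corner
      then obtain l m where lm: "d = real l" "e = real m" "l < n" "m < n" using i by auto
      have "\<phi> (inv\<^bsub>K\<^esub> h l \<otimes>\<^bsub>K\<^esub> h m) = inv\<^bsub>?P\<^esub> c l \<otimes>\<^bsub>?P\<^esub> c m"
        using hc[of l] hc[of m] lm by (simp add: \<phi>.hom_inv \<phi>h)
      also have "\<dots> = (\<theta> (real l) \<otimes>\<^bsub>?P\<^esub> inv\<^bsub>?P\<^esub> \<theta> 0) \<otimes>\<^bsub>?P\<^esub> (\<theta> 0 \<otimes>\<^bsub>?P\<^esub> inv\<^bsub>?P\<^esub> \<theta> (real m))"
        using \<theta>c by (simp add: c_def S.P.inv_mult_group)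
      also have "\<dots> = \<theta> (real l) \<otimes>\<^bsub>?P\<^esub> (inv\<^bsub>?P\<^esub> \<theta> 0 \<otimes>\<^bsub>?P\<^esub> \<theta> 0) \<otimes>\<^bsub>?P\<^esub> inv\<^bsub>?P\<^esub> \<theta> (real m)"
        using \<theta>c by (simp only: S.P.m_assoc S.P.m_closed S.P.inv_closed)
      also have "\<dots> = \<theta> (real l) \<otimes>\<^bsub>?P\<^esub> inv\<^bsub>?P\<^esub> \<theta> (real m)" using \<theta>c by simp
      finally show ?thesis using lm Corner by (simp add: cell_centre_def \<theta>_def)
    next
      case (Edge k)
      then have k: "k < n" "k mod 4 < 2" using i by (auto simp: patches_def)
      have "\<kappa> k 0 = \<kappa> k (1/2)" by (rule \<kappa>_const[OF k]) simp
      also have "\<dots> = \<theta> (real k + 1/2) \<otimes>\<^bsub>?P\<^esub> inv\<^bsub>?P\<^esub> \<theta> (real k + 5/2)"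
      proof -
        have "real k + 3 - 1/2 = real k + 5/2" by simp
        then show ?thesis by (simp only: \<kappa>_def)
      qed
      finally have e: "\<phi> (\<gamma> k) = \<theta> (real k + 1/2) \<otimes>\<^bsub>?P\<^esub> inv\<^bsub>?P\<^esub> \<theta> (real k + 5/2)" using \<phi>\<gamma>[OF k] by simp
      have "d = real k + 1/2 \<or> d = real k + 5/2" "e = real k + 1/2 \<or> e = real k + 5/2" using i Edge by auto
      moreover have "real k + 5/2 \<noteq> real k + 1/2" by simp
      ultimately have "\<phi> (inv\<^bsub>K\<^esub> label K h \<gamma> i d \<otimes>\<^bsub>K\<^esub> label K h \<gamma> i e) = \<theta> d \<otimes>\<^bsub>?P\<^esub> inv\<^bsub>?P\<^esub> \<theta> e"
        unfolding Edge label.simps using \<gamma>c[OF k(1)] \<theta>c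
        by (elim disjE) (simp_all add: \<phi>.hom_inv e S.P.inv_mult_group)
      then show ?thesis using Edge by (simp add: cell_centre_def \<theta>_def)
    qed
  next
    let ?X = "{inv\<^bsub>K\<^esub> label K h \<gamma> i d \<otimes>\<^bsub>K\<^esub> label K h \<gamma> i e | i d e.
       i \<in> patches n \<and> d \<in> centres n i \<and> e \<in> centres n i}"
    have X: "\<gamma> k \<in> ?X" "inv\<^bsub>K\<^esub> \<gamma> k \<in> ?X" if k: "k < n" "k mod 4 < 2" for k
    proof -
      have i: "Edge k \<in> patches n" "real k + 1/2 \<in> centres n (Edge k)" "real k + 5/2 \<in> centres n (Edge k)"
        using k by (auto simp: patches_def)
      have l: "label K h \<gamma> (Edge k) (real k + 1/2) = \<one>\<^bsub>K\<^esub>" "label K h \<gamma> (Edge k) (real k + 5/2) = \<gamma> k" by simp_all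
      have "inv\<^bsub>K\<^esub> label K h \<gamma> (Edge k) (real k + 1/2) \<otimes>\<^bsub>K\<^esub> label K h \<gamma> (Edge k) (real k + 5/2) \<in> ?X"
        "inv\<^bsub>K\<^esub> label K h \<gamma> (Edge k) (real k + 5/2) \<otimes>\<^bsub>K\<^esub> label K h \<gamma> (Edge k) (real k + 1/2) \<in> ?X"
        using i by blast+
      then show "\<gamma> k \<in> ?X" "inv\<^bsub>K\<^esub> \<gamma> k \<in> ?X" unfolding l using \<gamma>c[OF k(1)] by simp_all
    qed
    have "fK a \<in> ?X" if a: "a \<in> A" for a
    proof -
      have fa: "fK a \<in> carrier K" using fK a by auto
      consider i where "i \<in> {1..g}" "a = Gen_a i" | i where "i \<in> {1..g}" "a = Gen_b i"
        using a unfolding A_def surface_gens_def by blast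
      then show ?thesis
      proof cases
        case (1 i)
        have eq: "\<gamma> (4 * (i - 1)) = fK a" unfolding \<gamma>_def edge_word_simps using 1 fa by simp
        have "4 * (i - 1) < n" "4 * (i - 1) mod 4 < 2" using 1 by (auto simp: n_def)
        from X(1)[OF this] show ?thesis unfolding eq .
      next
        case (2 i)
        have eq: "inv\<^bsub>K\<^esub> \<gamma> (4 * (i - 1) + 1) = fK a" unfolding \<gamma>_def edge_word_simps using 2 fa by simp
        have "4 * (i - 1) + 1 < n" "(4 * (i - 1) + 1) mod 4 < 2" using 2 by (auto simp: n_def mod_Suc)
        from X(2)[OF this] show ?thesis unfolding eq .
      qed
    qed
    then have "fK ` A \<subseteq> ?X" by blast
    then have "generate K (fK ` A) \<subseteq> generate K ?X" by (rule K.mono_generate)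
    then show "carrier K \<subseteq> generate K ?X"
      using presented_group_generated[OF R] by (simp add: K_def fK_def[abs_def])
  qed
  with S.fundamental_group_base_change[OF x] show ?thesis unfolding Kg by (rule iso_trans)
qed

section \<open>The sphere\<close>

lemma carrier_surface_group_0: "carrier (surface_group 0) = {\<one>\<^bsub>surface_group 0\<^esub>}"
proof -
  have R: "{surface_relator 0} \<subseteq> words ({} :: surface_gen set)" by (simp add: surface_relator_def words_def)
  have "words ({} :: surface_gen set) = {[]}" by (auto simp: words_def)
  then show ?thesis
    using carrier_presented_group[OF R] pres_class_Nil[OF R] by (simp add: surface_group_def)
qed

lemma path_hom_continuous_image:
  assumes "path_hom X x y p q" and f: "continuous_map X Y f"
  shows "path_hom Y (f x) (f y) (f \<circ> p) (f \<circ> q)"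
proof -
  obtain h where h: "continuous_map unit_square X h"
    "\<And>s. h (0, s) = p s" "\<And>s. h (1, s) = q s"
    "\<And>t. t \<in> {0..1} \<Longrightarrow> h (t, 0) = x" "\<And>t. t \<in> {0..1} \<Longrightarrow> h (t, 1) = y"
    using path_homE[OF assms(1)] by metis
  show ?thesis
    by (rule path_homI[of _ "f \<circ> h"]) (use h continuous_map_compose[OF h(1) f] in auto)
qed

lemma loops_contractible_simply_connected:
  fixes S :: "'a::real_normed_vector set"
  assumes S: "simply_connected S" and p: "p \<in> loops (top_of_set S) x"
  shows "path_hom (top_of_set S) x x p (\<lambda>_. x)"
proof -
  have p': "path p" "path_image p \<subseteq> S" "pathstart p = x" "pathfinish p = x"
    using p by (auto simp: loops_def pathin_def path_def path_image_def pathstart_def pathfinish_def)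
  then have "homotopic_paths S p (linepath x x)"
    using S unfolding simply_connected_eq_contractible_path by metis
  moreover have "linepath x x = (\<lambda>_. x)" by (auto simp: linepath_def algebra_simps)
  ultimately show ?thesis
    using p' by (simp add: homotopic_paths_def path_hom_def pathstart_def pathfinish_def)
qed

theorem fundamental_group_surface_0:
  assumes x: "x \<in> topspace (surface 0)"
  shows "fundamental_group (surface 0) x \<cong> surface_group 0"
proof -
  let ?S = "sphere (0 :: complex \<times> real) 1" and ?P = "fundamental_group (surface 0) x"
  interpret P: group ?P by (rule group_fundamental_group[OF x])
  interpret K: group "surface_group 0" by (rule group_surface_group)
  have S: "simply_connected ?S" by (rule simply_connected_sphere) simp
  obtain f k where fk: "homeomorphic_maps (top_of_set ?S) (surface 0) f k"
    using surface_0_homeomorphic_sphere unfolding homeomorphic_space_def by blast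
  then have f: "continuous_map (top_of_set ?S) (surface 0) f" and k: "continuous_map (surface 0) (top_of_set ?S) k"
    and inv: "\<And>y. y \<in> topspace (surface 0) \<Longrightarrow> f (k y) = y" by (auto simp: homeomorphic_maps_def)
  have null: "path_hom (surface 0) x x p (\<lambda>_. x)" if p: "p \<in> loops (surface 0) x" for p
  proof -
    have pp: "pathin (surface 0) p" "p 0 = x" "p 1 = x" using p by (auto simp: loops_def)
    have top: "p t \<in> topspace (surface 0)" if "t \<in> {0..1}" for t
      using pp(1) that by (auto simp: pathin_def continuous_map_def)
    have "pathin (top_of_set ?S) (k \<circ> p)"
      using pp(1) k unfolding pathin_def by (rule continuous_map_compose)
    then have "k \<circ> p \<in> loops (top_of_set ?S) (k x)" using pp by (simp add: loops_def)
    from path_hom_continuous_image[OF loops_contractible_simply_connected[OF S this] f]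
    have "path_hom (surface 0) x x (f \<circ> (k \<circ> p)) (\<lambda>_. x)" using inv[OF x] by (simp add: o_def)
    moreover have "path_hom (surface 0) x x p (f \<circ> (k \<circ> p))"
      by (rule path_hom_reparametrize[OF pp(1), of id id]) (use pp inv top x in auto)
    ultimately show ?thesis by (rule path_hom_trans[rotated])
  qed
  then have P1: "carrier ?P = {\<one>\<^bsub>?P\<^esub>}"
    using P.one_closed unfolding carrier_fundamental_group fundamental_group_one
    by (auto dest: loop_class_eqI)
  have "(\<lambda>_. \<one>\<^bsub>surface_group 0\<^esub>) \<in> iso ?P (surface_group 0)"
    by (rule isoI) (auto simp: hom_def bij_betw_def P1 carrier_surface_group_0)
  then show ?thesis by (auto simp: is_iso_def)
qed

section \<open>Surface groups of different genus\<close>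

text \<open>The kernels of the homomorphisms to a group of order two: the whole group and the subgroups
  of index two. There is one set for each of these homomorphisms, while functions that agree on
  the carrier may differ elsewhere.\<close>

definition parity_kernels :: "('a, 'b) monoid_scheme \<Rightarrow> 'a set set" where
  "parity_kernels G = {N. N \<subseteq> carrier G \<and>
     (\<forall>x\<in>carrier G. \<forall>y\<in>carrier G. x \<otimes>\<^bsub>G\<^esub> y \<in> N \<longleftrightarrow> (x \<in> N \<longleftrightarrow> y \<in> N))}"

lemma parity_kernel_preimage:
  assumes f: "f \<in> hom G H" and N: "N \<in> parity_kernels H" and G: "group G"
  shows "{x \<in> carrier G. f x \<in> N} \<in> parity_kernels G"
proof -
  interpret group G by (rule G)
  have "f (x \<otimes>\<^bsub>G\<^esub> y) = f x \<otimes>\<^bsub>H\<^esub> f y" "f x \<in> carrier H" if "x \<in> carrier G" "y \<in> carrier G" for x y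
    using f that by (auto simp: hom_def)
  then show ?thesis using N by (auto simp: parity_kernels_def)
qed

lemma card_parity_kernels_iso:
  assumes G: "group G" and H: "group H" and iso: "G \<cong> H"
  shows "card (parity_kernels G) = card (parity_kernels H)"
proof -
  obtain f where f: "f \<in> iso G H" using iso by (auto simp: is_iso_def)
  \<comment> \<open>Preimages under an isomorphism and under its inverse are mutually inverse operations.\<close>
  let ?k = "inv_into (carrier G) f"
  have k: "?k \<in> iso H G" using group.iso_set_sym[OF G f] .
  have fh: "f \<in> hom G H" "bij_betw f (carrier G) (carrier H)" and kh: "?k \<in> hom H G"
    using f k by (auto simp: iso_def)
  have inv: "?k (f x) = x" "f x \<in> carrier H" if "x \<in> carrier G" for x
    using bij_betw_inv_into_left[OF fh(2) that] bij_betwE[OF fh(2)] that by auto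
  have inv': "f (?k y) = y" "?k y \<in> carrier G" if "y \<in> carrier H" for y
    using bij_betw_inv_into_right[OF fh(2) that] kh that by (auto simp: hom_def)
  have "bij_betw (\<lambda>N. {y \<in> carrier H. ?k y \<in> N}) (parity_kernels G) (parity_kernels H)"
  proof (rule bij_betw_byWitness[where f' = "\<lambda>N. {x \<in> carrier G. f x \<in> N}"])
    show "\<forall>N\<in>parity_kernels G. {x \<in> carrier G. f x \<in> {y \<in> carrier H. ?k y \<in> N}} = N"
    proof
      fix N assume "N \<in> parity_kernels G"
      then have "N \<subseteq> carrier G" by (simp add: parity_kernels_def)
      then show "{x \<in> carrier G. f x \<in> {y \<in> carrier H. ?k y \<in> N}} = N" using inv by auto
    qed
    show "\<forall>N\<in>parity_kernels H. {y \<in> carrier H. ?k y \<in> {x \<in> carrier G. f x \<in> N}} = N"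
    proof
      fix N assume "N \<in> parity_kernels H"
      then have "N \<subseteq> carrier H" by (simp add: parity_kernels_def)
      then show "{y \<in> carrier H. ?k y \<in> {x \<in> carrier G. f x \<in> N}} = N" using inv' by auto
    qed
    show "(\<lambda>N. {y \<in> carrier H. ?k y \<in> N}) ` parity_kernels G \<subseteq> parity_kernels H"
      using parity_kernel_preimage[OF kh _ H] by blast
    show "(\<lambda>N. {x \<in> carrier G. f x \<in> N}) ` parity_kernels H \<subseteq> parity_kernels G"
      using parity_kernel_preimage[OF fh(1) _ G] by blast
  qed
  then show ?thesis by (rule bij_betw_same_card)
qed

text \<open>The group of order two, with \<open>True\<close> as unit, so that \<open>\<phi> x\<close> itself says that \<open>x\<close> lies in the
  kernel of \<open>\<phi>\<close>.\<close>

definition parity_group :: "bool monoid" where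
  "parity_group = \<lparr>carrier = UNIV, mult = (\<lambda>x y. x = y), one = True\<rparr>"

lemma group_parity_group: "group parity_group"
  by (rule groupI) (auto simp: parity_group_def)

lemma inv_parity_group: "inv\<^bsub>parity_group\<^esub> x = x"
  by (rule group.inv_equality[OF group_parity_group]) (auto simp: parity_group_def)

lemma word_eval_parity:
  "word_eval parity_group f (w @ [(a, True), (b, True), (a, False), (b, False)] @ v) = word_eval parity_group f (w @ v)"
  by (induction w) (auto simp: inv_parity_group, auto simp: parity_group_def)

lemma word_eval_parity_relator: "word_eval parity_group f (surface_relator g)"
proof (induction g)
  case 0
  then show ?case by (simp add: surface_relator_def parity_group_def)
next
  case (Suc g)
  then show ?case
    using word_eval_parity[of f "surface_relator g" "Gen_a (Suc g)" "Gen_b (Suc g)" "[]"]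
    by (simp add: surface_relator_def)
qed

text \<open>If all relators evaluate to the unit, the generators may be sent anywhere; and a
  homomorphism is determined by its values on the generators.\<close>

lemma card_parity_kernels_presented_group:
  assumes R: "R \<subseteq> words A" and rel: "\<And>f r. r \<in> R \<Longrightarrow> word_eval parity_group f r"
  shows "card (parity_kernels (presented_group A R)) = card (Pow A)"
proof -
  let ?G = "presented_group A R"
  interpret group ?G by (rule group_presented_group[OF R])
  have "bij_betw (\<lambda>N. {a \<in> A. pres_class A R [(a, True)] \<in> N}) (parity_kernels ?G) (Pow A)"
  proof (rule bij_betwI')
    fix N M assume NM: "N \<in> parity_kernels ?G" "M \<in> parity_kernels ?G"
    show "({a \<in> A. pres_class A R [(a, True)] \<in> N} = {a \<in> A. pres_class A R [(a, True)] \<in> M}) = (N = M)"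
    proof
      assume eq: "{a \<in> A. pres_class A R [(a, True)] \<in> N} = {a \<in> A. pres_class A R [(a, True)] \<in> M}"
      have mem: "x \<otimes>\<^bsub>?G\<^esub> y \<in> L \<longleftrightarrow> (x \<in> L \<longleftrightarrow> y \<in> L)"
        if "L \<in> parity_kernels ?G" "x \<in> carrier ?G" "y \<in> carrier ?G" for L x y
        using that by (simp add: parity_kernels_def)
      have one: "\<one>\<^bsub>?G\<^esub> \<in> L" if "L \<in> parity_kernels ?G" for L
        using mem[OF that one_closed one_closed] by simp
      have inv: "inv\<^bsub>?G\<^esub> x \<in> L \<longleftrightarrow> x \<in> L" if "L \<in> parity_kernels ?G" "x \<in> carrier ?G" for L x
        using mem[OF that(1) inv_closed[OF that(2)] that(2)] one[OF that(1)] that(2) by simp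
      have "pres_class A R w \<in> N \<longleftrightarrow> pres_class A R w \<in> M" if "w \<in> words A" for w
        using that
      proof (induction w)
        case Nil
        then show ?case using one NM by (simp add: pres_class_Nil[OF R])
      next
        case (Cons l w)
        obtain a b where l: "l = (a, b)" by fastforce
        have w: "a \<in> A" "w \<in> words A" "[(a, True)] \<in> words A" "[(a, b)] \<in> words A" using Cons.prems l by auto
        have c: "pres_class A R [(a, True)] \<in> carrier ?G" "pres_class A R [(a, b)] \<in> carrier ?G" "pres_class A R w \<in> carrier ?G"
          using w pres_class_closed[OF R] by auto
        have "pres_class A R [(a, b)] \<in> N \<longleftrightarrow> pres_class A R [(a, b)] \<in> M"
          using pres_class_letter[OF R w(1), of b] inv[OF NM(1) c(1)] inv[OF NM(2) c(1)] eq w(1)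
          by (cases b) auto
        moreover have "pres_class A R (l # w) = pres_class A R [(a, b)] \<otimes>\<^bsub>?G\<^esub> pres_class A R w"
          using pres_class_append[OF R w(4,2)] l by simp
        ultimately show ?case using mem NM c Cons.IH[OF w(2)] by simp
      qed
      moreover have "N \<subseteq> carrier ?G" "M \<subseteq> carrier ?G" using NM by (auto simp: parity_kernels_def)
      ultimately show "N = M" unfolding carrier_presented_group[OF R] by blast
    qed simp
  next
    fix B assume B: "B \<in> Pow A"
    let ?f = "\<lambda>a. a \<in> B"
    obtain \<phi> where \<phi>: "\<phi> \<in> hom ?G parity_group"
      "\<And>w. w \<in> words A \<Longrightarrow> \<phi> (pres_class A R w) = word_eval parity_group ?f w"
    proof (rule presented_group_lift[OF R group_parity_group, of ?f])
      show "?f \<in> A \<rightarrow> carrier parity_group" by (simp add: parity_group_def)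
      show "word_eval parity_group ?f r = \<one>\<^bsub>parity_group\<^esub>" if "r \<in> R" for r
        using rel[OF that, of ?f] by (simp add: parity_group_def)
    qed blast
    have "{True} \<in> parity_kernels parity_group" by (auto simp: parity_kernels_def parity_group_def)
    from parity_kernel_preimage[OF \<phi>(1) this is_group]
    have "{x \<in> carrier ?G. \<phi> x \<in> {True}} \<in> parity_kernels ?G" .
    moreover have "\<phi> (pres_class A R [(a, True)]) = (a \<in> B)" "pres_class A R [(a, True)] \<in> carrier ?G" if "a \<in> A" for a
      using \<phi>(2)[of "[(a, True)]"] that pres_class_closed[OF R, of "[(a, True)]"] by (simp_all add: parity_group_def)
    then have "B = {a \<in> A. pres_class A R [(a, True)] \<in> {x \<in> carrier ?G. \<phi> x \<in> {True}}}" using B by auto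
    ultimately show "\<exists>N\<in>parity_kernels ?G. B = {a \<in> A. pres_class A R [(a, True)] \<in> N}" by blast
  qed auto
  then show ?thesis by (rule bij_betw_same_card)
qed

lemma card_parity_kernels_surface_group: "card (parity_kernels (surface_group g)) = 4 ^ g"
proof -
  let ?A = "Gen_a ` {1..g} \<union> Gen_b ` {1..g}"
  have R: "{surface_relator g} \<subseteq> words ?A" by (auto simp: surface_relator_def words_def)
  have "card ?A = card (Gen_a ` {1..g}) + card (Gen_b ` {1..g})"
    by (rule card_Un_disjoint) auto
  also have "\<dots> = 2 * g" by (simp add: card_image inj_on_def)
  finally have "card ?A = 2 * g" .
  then have "card (Pow ?A) = 4 ^ g" by (simp add: card_Pow power_mult)
  then show ?thesis
    unfolding surface_group_def using card_parity_kernels_presented_group[OF R] word_eval_parity_relator by simp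
qed

theorem surface_groups_not_isomorphic:
  assumes "g \<noteq> h"
  shows "\<not> surface_group g \<cong> surface_group h"
proof
  assume "surface_group g \<cong> surface_group h"
  then have "(4::nat) ^ g = 4 ^ h"
    using card_parity_kernels_iso[OF group_surface_group group_surface_group] by (simp add: card_parity_kernels_surface_group)
  with assms show False by simp
qed

theorem theorem4p22:
  shows "(\<forall>g. \<forall>x \<in> topspace (surface g). fundamental_group (surface g) x \<cong> surface_group g) \<and>
         carrier (surface_group 0) = {\<one>\<^bsub>surface_group 0\<^esub>} \<and>
         (\<forall>g h. g \<noteq> h \<longrightarrow> \<not> surface_group g \<cong> surface_group h)"
proof (intro conjI allI ballI impI)
  fix g x assume "x \<in> topspace (surface g)"
  then show "fundamental_group (surface g) x \<cong> surface_group g"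
    using fundamental_group_surface[of g x] fundamental_group_surface_0[of x] by (cases "g = 0") auto
qed (use carrier_surface_group_0 surface_groups_not_isomorphic in auto)

end
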